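(* A valued vector space in the language $\mathrm{L}_{S,K}$ (resp. $\mathrm{L}_S$) is NIP if and only if its skeleton is NIP.
   Context: Valued vector space: $K$ is a field, $V$ a $K$-vector space, $(\Gamma,<,\infty)$ a totally ordered set with last element $\infty$, and $\mathrm{val}:V\to\Gamma$ a surjective map such that $\mathrm{val}(x)=\infty$ iff $x=0$, $\mathrm{val}(x-y)\ge\min(\mathrm{val}(x),\mathrm{val}(y))$, and $\mathrm{val}(kx)=\mathrm{val}(x)$ for all $k\in K\setminus\{0\}$, $x\in V$. For $\gamma\in\Gamma$ write $V_\gamma=\{x\mid\mathrm{val}(x)>\gamma\}$. Skeleton: $S(V)$ is the quotient of $\{(\gamma,v)\in\Gamma\times V\mid\mathrm{val}(v)\ge\gamma\}$ by $(\gamma,v)\simeq(\gamma',v')$ iff $\gamma=\gamma'$ and $\mathrm{val}(v-v')>\gamma$. The class of $(\gamma,v)$ is written $(\gamma,v+V_\gamma)$, and $\mathbf{0}=(\infty,0)$ is the unique class over $\infty$. Maps: $\pi:V\to S(V)$, $v\mapsto(\mathrm{val}(v),v+V_{\mathrm{val}(v)})$; $\mathrm{val}_S:S(V)\to\Gamma$, $(\gamma,v+V_\gamma)\mapsto\gamma$; $\mathrm{scal}_\bullet(k,(\gamma,v+V_\gamma)):=(\gamma,kv+V_\gamma)$ (also $\mathrm{scal}_{\bullet,k}$ for fixed $k$); $(\gamma,v+V_\gamma)+_\bullet(\gamma',v'+V_{\gamma'}):=(\gamma,v+v'+V_\gamma)$ if $\gamma=\gamma'$, and $\mathbf{0}$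 otherwise. Languages: $\mathrm{L}_{S,K}$ (fixed base field $K$) consists of $(V,+,0,(\mathrm{scal}_k:V\to V)_{k\in K})$, $(\Gamma,<,\infty)$, $\mathrm{val}:V\to\Gamma$, $(S(V),+_\bullet,\mathbf{0},(\mathrm{scal}_{\bullet,k})_{k\in K})$, $\mathrm{val}_S$ and $\pi$. $\mathrm{L}_S$ (variable base field) consists of $(V,+,0)$, $(K,+,\cdot,0,1)$, $(\Gamma,<,\infty)$, $\mathrm{scal}:K\times V\to V$, $\mathrm{val}$, $(S(V),+_\bullet,\mathbf{0})$, $\mathrm{scal}_\bullet:K\times S(V)\to S(V)$, $\mathrm{val}_S$ and $\pi$. The skeleton as a structure means the structure in the sublanguage $\{(S(V),+_\bullet,(\mathrm{scal}_{\bullet,k})_k,\mathbf{0}),(\Gamma,<),\mathrm{val}_S\}$ (case $\mathrm{L}_{S,K}$), resp. $\{(S(V),+_\bullet,\mathbf{0}),(\Gamma,<),(K,+,\cdot,0,1),\mathrm{scal}_\bullet,\mathrm{val}_S\}$ (case $\mathrm{L}_S$). *)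

theory Defs
  imports Complex_Main
begin

section \<open>Many-sorted first-order logic and NIP\<close>

text \<open>
  Variables carry their sort.  All elements of a many-sorted structure live in one type
  \<open>'u\<close>, with one carrier set per sort.  A sublanguage is a language with fewer sorts and
  symbols; satisfaction of its formulas in a structure involves only the corresponding reduct,
  so a structure for a language is used, without change, as a structure for its sublanguages.
\<close>

type_synonym 's var = "'s \<times> nat"

datatype ('s, 'f) tm = Var "'s var" | App 'f "('s, 'f) tm list"

datatype ('s, 'f, 'r) fm =
    Eq "('s, 'f) tm" "('s, 'f) tm"
  | Rel 'r "('s, 'f) tm list"
  | Neg "('s, 'f, 'r) fm"
  | Conj "('s, 'f, 'r) fm" "('s, 'f, 'r) fm"
  | Exi "'s var" "('s, 'f, 'r) fm"

record ('s, 'f, 'r) lang =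
  sorts :: "'s set"
  funs :: "'f set"
  rels :: "'r set"
  farity :: "'f \<Rightarrow> 's list \<times> 's"
  rarity :: "'r \<Rightarrow> 's list"

inductive has_sort :: "('s, 'f, 'r) lang \<Rightarrow> ('s, 'f) tm \<Rightarrow> 's \<Rightarrow> bool" for L where
  Var: "s \<in> sorts L \<Longrightarrow> has_sort L (Var (s, n)) s"
| App: "f \<in> funs L \<Longrightarrow> list_all2 (has_sort L) ts (fst (farity L f)) \<Longrightarrow>
    has_sort L (App f ts) (snd (farity L f))"

primrec wff :: "('s, 'f, 'r) lang \<Rightarrow> ('s, 'f, 'r) fm \<Rightarrow> bool" where
  "wff L (Eq t u) \<longleftrightarrow> (\<exists>s. has_sort L t s \<and> has_sort L u s)"
| "wff L (Rel r ts) \<longleftrightarrow> r \<in> rels L \<and> list_all2 (has_sort L) ts (rarity L r)"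
| "wff L (Neg \<phi>) \<longleftrightarrow> wff L \<phi>"
| "wff L (Conj \<phi> \<psi>) \<longleftrightarrow> wff L \<phi> \<and> wff L \<psi>"
| "wff L (Exi x \<phi>) \<longleftrightarrow> fst x \<in> sorts L \<and> wff L \<phi>"

primrec tm_vars :: "('s, 'f) tm \<Rightarrow> 's var set" where
  "tm_vars (Var x) = {x}"
| "tm_vars (App f ts) = \<Union> (set (map tm_vars ts))"

primrec free_vars :: "('s, 'f, 'r) fm \<Rightarrow> 's var set" where
  "free_vars (Eq t u) = tm_vars t \<union> tm_vars u"
| "free_vars (Rel r ts) = (\<Union>t\<in>set ts. tm_vars t)"
| "free_vars (Neg \<phi>) = free_vars \<phi>"
| "free_vars (Conj \<phi> \<psi>) = free_vars \<phi> \<union> free_vars \<psi>"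
| "free_vars (Exi x \<phi>) = free_vars \<phi> - {x}"

record ('s, 'f, 'r, 'u) struct =
  univ :: "'s \<Rightarrow> 'u set"
  fint :: "'f \<Rightarrow> 'u list \<Rightarrow> 'u"
  rint :: "'r \<Rightarrow> 'u list \<Rightarrow> bool"

definition is_structure :: "('s, 'f, 'r) lang \<Rightarrow> ('s, 'f, 'r, 'u) struct \<Rightarrow> bool" where
  "is_structure L M \<longleftrightarrow>
    (\<forall>s\<in>sorts L. univ M s \<noteq> {}) \<and>
    (\<forall>f\<in>funs L. \<forall>as. list_all2 (\<lambda>a s. a \<in> univ M s) as (fst (farity L f)) \<longrightarrow>
      fint M f as \<in> univ M (snd (farity L f)))"

primrec eval_tm :: "('s, 'f, 'r, 'u) struct \<Rightarrow> ('s var \<Rightarrow> 'u) \<Rightarrow> ('s, 'f) tm \<Rightarrow> 'u" where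
  "eval_tm M e (Var x) = e x"
| "eval_tm M e (App f ts) = fint M f (map (eval_tm M e) ts)"

primrec sat :: "('s, 'f, 'r, 'u) struct \<Rightarrow> ('s var \<Rightarrow> 'u) \<Rightarrow> ('s, 'f, 'r) fm \<Rightarrow> bool" where
  "sat M e (Eq t u) \<longleftrightarrow> eval_tm M e t = eval_tm M e u"
| "sat M e (Rel r ts) \<longleftrightarrow> rint M r (map (eval_tm M e) ts)"
| "sat M e (Neg \<phi>) \<longleftrightarrow> \<not> sat M e \<phi>"
| "sat M e (Conj \<phi> \<psi>) \<longleftrightarrow> sat M e \<phi> \<and> sat M e \<psi>"
| "sat M e (Exi x \<phi>) \<longleftrightarrow> (\<exists>a\<in>univ M (fst x). sat M (e(x := a)) \<phi>)"

definition tuples :: "('s, 'f, 'r, 'u) struct \<Rightarrow> 's var list \<Rightarrow> 'u list set" where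
  "tuples M xs = {as. list_all2 (\<lambda>a x. a \<in> univ M (fst x)) as xs}"

definition assign :: "'s var list \<Rightarrow> 'u list \<Rightarrow> 's var \<Rightarrow> 'u" where
  "assign xs as = (\<lambda>x. the (map_of (zip xs as) x))"

definition partitioned_formula ::
  "('s, 'f, 'r) lang \<Rightarrow> ('s, 'f, 'r) fm \<Rightarrow> 's var list \<Rightarrow> 's var list \<Rightarrow> bool" where
  "partitioned_formula L \<phi> xs ys \<longleftrightarrow>
    wff L \<phi> \<and> distinct (xs @ ys) \<and> fst ` set (xs @ ys) \<subseteq> sorts L \<and>
    free_vars \<phi> \<subseteq> set (xs @ ys)"

definition shatters ::
  "('s, 'f, 'r, 'u) struct \<Rightarrow> ('s, 'f, 'r) fm \<Rightarrow> 's var list \<Rightarrow> 's var list \<Rightarrow> 'u list set \<Rightarrow> bool"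
where
  "shatters M \<phi> xs ys A \<longleftrightarrow>
    (\<forall>I\<subseteq>A. \<exists>b\<in>tuples M ys. \<forall>a\<in>A. sat M (assign (xs @ ys) (a @ b)) \<phi> \<longleftrightarrow> a \<in> I)"

text \<open>
  The independence property in the form: for every \<open>n\<close> there are tuples
  \<open>a\<^sub>1, \<dots>, a\<^sub>n\<close> and \<open>b\<^sub>I\<close> (for \<open>I \<subseteq> {1, \<dots>, n}\<close>) with \<open>\<phi>(a\<^sub>i; b\<^sub>I)\<close> iff
  \<open>i \<in> I\<close>.  For each \<open>n\<close> this is a first-order sentence, so \<open>M\<close> itself decides whether
  \<open>\<phi>\<close> has the independence property for the complete theory of \<open>M\<close>.
\<close>

definition has_IP ::
  "('s, 'f, 'r, 'u) struct \<Rightarrow> ('s, 'f, 'r) fm \<Rightarrow> 's var list \<Rightarrow> 's var list \<Rightarrow> bool" where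
  "has_IP M \<phi> xs ys \<longleftrightarrow>
    (\<forall>n. \<exists>A \<subseteq> tuples M xs. finite A \<and> card A = n \<and> shatters M \<phi> xs ys A)"

definition NIP :: "('s, 'f, 'r) lang \<Rightarrow> ('s, 'f, 'r, 'u) struct \<Rightarrow> bool" where
  "NIP L M \<longleftrightarrow> (\<forall>\<phi> xs ys. partitioned_formula L \<phi> xs ys \<longrightarrow> \<not> has_IP M \<phi> xs ys)"


section \<open>Valued vector spaces\<close>

text \<open>The last element \<open>\<infinity>\<close> of \<open>\<Gamma>\<close> is \<open>top\<close>.\<close>

locale valued_vector_space = vector_space scale
  for scale :: "'k::field \<Rightarrow> 'v::ab_group_add \<Rightarrow> 'v" +
  fixes val :: "'v \<Rightarrow> 'g::{linorder, order_top}"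
  assumes surj_val: "surj val"
    and val_eq_top_iff: "val x = top \<longleftrightarrow> x = 0"
    and val_diff: "val (x - y) \<ge> min (val x) (val y)"
    and val_scale: "k \<noteq> 0 \<Longrightarrow> val (scale k x) = val x"


section \<open>The skeleton\<close>

text \<open>
  The only pair over \<open>\<infinity>\<close> is \<open>(\<infinity>, 0)\<close>, and \<open>val (0 - 0) > \<infinity>\<close> is false.  The second disjunct
  makes the relation reflexive there, so that \<open>(\<infinity>, 0)\<close> forms the unique class over \<open>\<infinity>\<close>; over
  \<open>\<gamma> < \<infinity>\<close> it is redundant.
\<close>

definition skel_pairs :: "('v::ab_group_add \<Rightarrow> 'g::{linorder, order_top}) \<Rightarrow> ('g \<times> 'v) set" where
  "skel_pairs val = {(\<gamma>, v). val v \<ge> \<gamma>}"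

definition skel_rel ::
  "('v::ab_group_add \<Rightarrow> 'g::{linorder, order_top}) \<Rightarrow> (('g \<times> 'v) \<times> ('g \<times> 'v)) set" where
  "skel_rel val = {((\<gamma>, v), (\<gamma>', v')). (\<gamma>, v) \<in> skel_pairs val \<and> (\<gamma>', v') \<in> skel_pairs val \<and>
    \<gamma> = \<gamma>' \<and> (val (v - v') > \<gamma> \<or> v = v')}"

definition skel :: "('v::ab_group_add \<Rightarrow> 'g::{linorder, order_top}) \<Rightarrow> ('g \<times> 'v) set set" where
  "skel val = skel_pairs val // skel_rel val"

definition skel_class ::
  "('v::ab_group_add \<Rightarrow> 'g::{linorder, order_top}) \<Rightarrow> 'g \<Rightarrow> 'v \<Rightarrow> ('g \<times> 'v) set" where
  "skel_class val \<gamma> v = skel_rel val `` {(\<gamma>, v)}"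

definition skel_zero :: "('v::ab_group_add \<Rightarrow> 'g::{linorder, order_top}) \<Rightarrow> ('g \<times> 'v) set" where
  "skel_zero val = skel_class val top 0"

definition skel_pi :: "('v::ab_group_add \<Rightarrow> 'g::{linorder, order_top}) \<Rightarrow> 'v \<Rightarrow> ('g \<times> 'v) set" where
  "skel_pi val v = skel_class val (val v) v"

text \<open>
  The remaining operations are given on representatives; \<open>the_elem\<close> extracts the common value.
  The equations on classes are derived below.
\<close>

definition skel_val :: "('g \<times> 'v) set \<Rightarrow> 'g" where
  "skel_val c = the_elem (fst ` c)"

definition skel_scale ::
  "('k \<Rightarrow> 'v \<Rightarrow> 'v) \<Rightarrow> ('v::ab_group_add \<Rightarrow> 'g::{linorder, order_top}) \<Rightarrow>
    'k \<Rightarrow> ('g \<times> 'v) set \<Rightarrow> ('g \<times> 'v) set" where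
  "skel_scale scale val k c = the_elem ((\<lambda>(\<gamma>, v). skel_class val \<gamma> (scale k v)) ` c)"

definition skel_add ::
  "('v::ab_group_add \<Rightarrow> 'g::{linorder, order_top}) \<Rightarrow>
    ('g \<times> 'v) set \<Rightarrow> ('g \<times> 'v) set \<Rightarrow> ('g \<times> 'v) set" where
  "skel_add val c c' = the_elem ((\<lambda>((\<gamma>, v), (\<gamma>', v')).
    if \<gamma> = \<gamma>' then skel_class val \<gamma> (v + v') else skel_zero val) ` (c \<times> c'))"

lemma the_elem_image_const:
  assumes "p \<in> A" "\<And>q. q \<in> A \<Longrightarrow> f q = y"
  shows "the_elem (f ` A) = y"
proof -
  have "f ` A = {y}"
    using assms by blast
  then show ?thesis
    by simp
qed

context valued_vector_space
begin

lemma val_zero [simp]: "val 0 = top"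
  by (simp add: val_eq_top_iff)

lemma val_minus: "val (- x) = val x"
  using val_scale[of "- 1" x] by simp

lemma val_diff_commute: "val (x - y) = val (y - x)"
  using val_minus[of "x - y"] by simp

lemma val_add: "val (x + y) \<ge> min (val x) (val y)"
  using val_diff[of x "- y"] by (simp add: val_minus)

lemma val_scale_ge: "val (scale k x) \<ge> val x"
  by (cases "k = 0") (simp_all add: val_scale)

lemma val_add_gt: "\<gamma> < val x \<Longrightarrow> \<gamma> < val y \<Longrightarrow> \<gamma> < val (x + y)"
  using val_add[of x y] by (meson min_less_iff_conj order_less_le_trans)

lemma val_add_ge: "\<gamma> \<le> val x \<Longrightarrow> \<gamma> \<le> val y \<Longrightarrow> \<gamma> \<le> val (x + y)"
  using val_add[of x y] by (meson min.boundedI order_trans)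

lemma equiv_skel_rel: "equiv (skel_pairs val) (skel_rel val)"
proof (rule equivI)
  show "skel_rel val \<subseteq> skel_pairs val \<times> skel_pairs val"
    by (auto simp: skel_rel_def)
  show "refl_on (skel_pairs val) (skel_rel val)"
    by (auto simp: refl_on_def skel_rel_def)
  show "sym (skel_rel val)"
    unfolding sym_def skel_rel_def using val_diff_commute by force
  show "trans (skel_rel val)"
  proof (rule transI)
    fix p q r assume pq: "(p, q) \<in> skel_rel val" "(q, r) \<in> skel_rel val"
    obtain \<gamma> u v w where eqs: "p = (\<gamma>, u)" "q = (\<gamma>, v)" "r = (\<gamma>, w)"
      using pq unfolding skel_rel_def by blast
    have "\<gamma> < val (u - w)" if "\<gamma> < val (u - v)" "\<gamma> < val (v - w)"
      using val_add_gt[OF that] by simp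
    then show "(p, r) \<in> skel_rel val"
      using pq unfolding skel_rel_def eqs by blast
  qed
qed

lemma skel_class_eq_iff:
  assumes "val v \<ge> \<gamma>" "val v' \<ge> \<gamma>'"
  shows "skel_class val \<gamma> v = skel_class val \<gamma>' v' \<longleftrightarrow>
    \<gamma> = \<gamma>' \<and> (val (v - v') > \<gamma> \<or> v = v')"
proof -
  have "skel_class val \<gamma> v = skel_class val \<gamma>' v' \<longleftrightarrow> ((\<gamma>, v), (\<gamma>', v')) \<in> skel_rel val"
    unfolding skel_class_def
    by (rule eq_equiv_class_iff[OF equiv_skel_rel]) (use assms in \<open>auto simp: skel_pairs_def\<close>)
  then show ?thesis
    using assms by (auto simp: skel_rel_def skel_pairs_def)
qed

lemma skel_iff: "c \<in> skel val \<longleftrightarrow> (\<exists>\<gamma> v. val v \<ge> \<gamma> \<and> c = skel_class val \<gamma> v)"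
  by (auto simp: skel_def skel_class_def quotient_def skel_pairs_def)

lemma in_skel_class:
  "val v \<ge> \<gamma> \<Longrightarrow> (\<gamma>', w) \<in> skel_class val \<gamma> v \<longleftrightarrow>
    \<gamma>' = \<gamma> \<and> val w \<ge> \<gamma> \<and> (val (v - w) > \<gamma> \<or> w = v)"
  by (auto simp: skel_class_def skel_rel_def skel_pairs_def)

lemma skel_class_self: "val v \<ge> \<gamma> \<Longrightarrow> (\<gamma>, v) \<in> skel_class val \<gamma> v"
  by (simp add: in_skel_class)

lemma skel_val_class: "val v \<ge> \<gamma> \<Longrightarrow> skel_val (skel_class val \<gamma> v) = \<gamma>"
  unfolding skel_val_def
  by (rule the_elem_image_const[OF skel_class_self]) (auto simp: in_skel_class)

lemma skel_scale_class:
  assumes "val v \<ge> \<gamma>"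
  shows "skel_scale scale val k (skel_class val \<gamma> v) = skel_class val \<gamma> (scale k v)"
  unfolding skel_scale_def
proof (rule the_elem_image_const[OF skel_class_self[OF assms]])
  fix q assume "q \<in> skel_class val \<gamma> v"
  then obtain w where q: "q = (\<gamma>, w)" "val w \<ge> \<gamma>" "val (v - w) > \<gamma> \<or> w = v"
    using assms by (cases q) (simp add: in_skel_class)
  have "val (scale k v - scale k w) > \<gamma> \<or> scale k v = scale k w"
    using q(3) val_scale_ge[of "v - w" k]
    by (metis order_less_le_trans scale_right_diff_distrib)
  moreover have "val (scale k v) \<ge> \<gamma>" "val (scale k w) \<ge> \<gamma>"
    using assms q(2) val_scale_ge order_trans by blast+
  ultimately have "skel_class val \<gamma> (scale k v) = skel_class val \<gamma> (scale k w)"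
    by (simp add: skel_class_eq_iff)
  then show "(case q of (\<gamma>, v) \<Rightarrow> skel_class val \<gamma> (scale k v)) = skel_class val \<gamma> (scale k v)"
    by (simp add: q(1))
qed

lemma skel_add_class:
  assumes "val v \<ge> \<gamma>" "val v' \<ge> \<gamma>'"
  shows "skel_add val (skel_class val \<gamma> v) (skel_class val \<gamma>' v') =
    (if \<gamma> = \<gamma>' then skel_class val \<gamma> (v + v') else skel_zero val)"
  unfolding skel_add_def
proof (rule the_elem_image_const[where p = "((\<gamma>, v), (\<gamma>', v'))"])
  show "((\<gamma>, v), (\<gamma>', v')) \<in> skel_class val \<gamma> v \<times> skel_class val \<gamma>' v'"
    using assms by (simp add: skel_class_self)
next
  fix q assume q_in: "q \<in> skel_class val \<gamma> v \<times> skel_class val \<gamma>' v'"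
  obtain \<delta> w \<delta>' w' where q': "q = ((\<delta>, w), (\<delta>', w'))"
    by (metis surj_pair)
  have [simp]: "\<delta> = \<gamma>" "\<delta>' = \<gamma>'"
    and w: "val w \<ge> \<gamma>" "val (v - w) > \<gamma> \<or> w = v"
    and w': "val w' \<ge> \<gamma>'" "val (v' - w') > \<gamma>' \<or> w' = v'"
    using q_in assms unfolding q' by (simp_all add: in_skel_class)
  have "skel_class val \<gamma> (v + v') = skel_class val \<gamma> (w + w')" if [simp]: "\<gamma>' = \<gamma>"
  proof -
    have "\<gamma> < val ((v - w) + (v' - w'))" if "v - w \<noteq> 0 \<or> v' - w' \<noteq> 0"
    proof (cases "v - w = 0 \<or> v' - w' = 0")
      case True
      then show ?thesis using w(2) w'(2) that by auto
    next
      case False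
      then show ?thesis using w(2) w'(2) by (intro val_add_gt) auto
    qed
    moreover have "(v - w) + (v' - w') = (v + v') - (w + w')"
      by simp
    ultimately have "val ((v + v') - (w + w')) > \<gamma> \<or> v + v' = w + w'"
      by (metis eq_iff_diff_eq_0)
    moreover have "val (v + v') \<ge> \<gamma>" "val (w + w') \<ge> \<gamma>"
      using assms w(1) w'(1) by (simp_all add: val_add_ge)
    ultimately show ?thesis
      by (simp add: skel_class_eq_iff)
  qed
  then show "(\<lambda>((\<gamma>, v), (\<gamma>', v')).
      if \<gamma> = \<gamma>' then skel_class val \<gamma> (v + v') else skel_zero val) q =
    (if \<gamma> = \<gamma>' then skel_class val \<gamma> (v + v') else skel_zero val)"
    by (auto simp: q')
qed

lemma skel_classI: "val v \<ge> \<gamma> \<Longrightarrow> skel_class val \<gamma> v \<in> skel val"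
  using skel_iff by blast

lemma skel_zero_in: "skel_zero val \<in> skel val"
  unfolding skel_zero_def by (rule skel_classI) simp

lemma skel_pi_in: "skel_pi val v \<in> skel val"
  unfolding skel_pi_def by (rule skel_classI) simp

lemma skel_scale_in:
  assumes "c \<in> skel val"
  shows "skel_scale scale val k c \<in> skel val"
proof -
  obtain \<gamma> v where "val v \<ge> \<gamma>" "c = skel_class val \<gamma> v"
    using assms skel_iff by blast
  then show ?thesis
    using order_trans[OF _ val_scale_ge] by (simp add: skel_scale_class skel_classI)
qed

lemma skel_add_in:
  assumes "c \<in> skel val" "c' \<in> skel val"
  shows "skel_add val c c' \<in> skel val"
proof -
  obtain \<gamma> v where "val v \<ge> \<gamma>" "c = skel_class val \<gamma> v"
    using assms(1) skel_iff by blast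
  moreover obtain \<gamma>' v' where "val v' \<ge> \<gamma>'" "c' = skel_class val \<gamma>' v'"
    using assms(2) skel_iff by blast
  ultimately show ?thesis
    by (simp add: skel_add_class skel_zero_in skel_classI val_add_ge)
qed

end


section \<open>The languages and structures\<close>

text \<open>
  Sorts: \<open>V\<close>, \<open>K\<close>, \<open>\<Gamma>\<close>, \<open>S(V)\<close>.  The sort \<open>FldS\<close> does not belong to the language with
  fixed base field.
\<close>

datatype sort = VecS | FldS | ValS | SkelS

datatype ('k, 'v, 'g) elem =
    InV (ofV: 'v)
  | InK (ofK: 'k)
  | InG (ofG: 'g)
  | InS (ofS: "('g \<times> 'v) set")

datatype rsym = Less

fun rsym_arity :: "rsym \<Rightarrow> sort list" where
  "rsym_arity Less = [ValS, ValS]"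

fun rsym_int :: "rsym \<Rightarrow> ('k, 'v, 'g::linorder) elem list \<Rightarrow> bool" where
  "rsym_int Less as \<longleftrightarrow> ofG (as ! 0) < ofG (as ! 1)"

fun sort_carrier ::
  "('v::ab_group_add \<Rightarrow> 'g::{linorder, order_top}) \<Rightarrow> sort \<Rightarrow> ('k, 'v, 'g) elem set" where
  "sort_carrier val VecS = range InV"
| "sort_carrier val FldS = range InK"
| "sort_carrier val ValS = range InG"
| "sort_carrier val SkelS = InS ` skel val"


subsection \<open>Fixed base field\<close>

datatype 'k fsym_SK =
  VAdd_SK | VZero_SK | VScal_SK 'k | Inf_SK | Val_SK |
  SAdd_SK | SZero_SK | SScal_SK 'k | SVal_SK | Pi_SK

primrec fsym_SK_arity :: "'k fsym_SK \<Rightarrow> sort list \<times> sort" where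
  "fsym_SK_arity VAdd_SK = ([VecS, VecS], VecS)"
| "fsym_SK_arity VZero_SK = ([], VecS)"
| "fsym_SK_arity (VScal_SK k) = ([VecS], VecS)"
| "fsym_SK_arity Inf_SK = ([], ValS)"
| "fsym_SK_arity Val_SK = ([VecS], ValS)"
| "fsym_SK_arity SAdd_SK = ([SkelS, SkelS], SkelS)"
| "fsym_SK_arity SZero_SK = ([], SkelS)"
| "fsym_SK_arity (SScal_SK k) = ([SkelS], SkelS)"
| "fsym_SK_arity SVal_SK = ([SkelS], ValS)"
| "fsym_SK_arity Pi_SK = ([VecS], SkelS)"

primrec fsym_SK_int ::
  "('k::field \<Rightarrow> 'v::ab_group_add \<Rightarrow> 'v) \<Rightarrow> ('v \<Rightarrow> 'g::{linorder, order_top}) \<Rightarrow>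
    'k fsym_SK \<Rightarrow> ('k, 'v, 'g) elem list \<Rightarrow> ('k, 'v, 'g) elem" where
  "fsym_SK_int scale val VAdd_SK = (\<lambda>as. InV (ofV (as ! 0) + ofV (as ! 1)))"
| "fsym_SK_int scale val VZero_SK = (\<lambda>as. InV 0)"
| "fsym_SK_int scale val (VScal_SK k) = (\<lambda>as. InV (scale k (ofV (as ! 0))))"
| "fsym_SK_int scale val Inf_SK = (\<lambda>as. InG top)"
| "fsym_SK_int scale val Val_SK = (\<lambda>as. InG (val (ofV (as ! 0))))"
| "fsym_SK_int scale val SAdd_SK = (\<lambda>as. InS (skel_add val (ofS (as ! 0)) (ofS (as ! 1))))"
| "fsym_SK_int scale val SZero_SK = (\<lambda>as. InS (skel_zero val))"
| "fsym_SK_int scale val (SScal_SK k) = (\<lambda>as. InS (skel_scale scale val k (ofS (as ! 0))))"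
| "fsym_SK_int scale val SVal_SK = (\<lambda>as. InG (skel_val (ofS (as ! 0))))"
| "fsym_SK_int scale val Pi_SK = (\<lambda>as. InS (skel_pi val (ofV (as ! 0))))"

definition L_SK :: "(sort, 'k fsym_SK, rsym) lang" where
  "L_SK = \<lparr>sorts = {VecS, ValS, SkelS}, funs = UNIV, rels = UNIV,
    farity = fsym_SK_arity, rarity = rsym_arity\<rparr>"

definition L_SK_skel :: "(sort, 'k fsym_SK, rsym) lang" where
  "L_SK_skel = L_SK\<lparr>sorts := {ValS, SkelS},
    funs := {SAdd_SK, SZero_SK, SVal_SK} \<union> range SScal_SK\<rparr>"

definition struct_SK ::
  "('k::field \<Rightarrow> 'v::ab_group_add \<Rightarrow> 'v) \<Rightarrow> ('v \<Rightarrow> 'g::{linorder, order_top}) \<Rightarrow>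
    (sort, 'k fsym_SK, rsym, ('k, 'v, 'g) elem) struct" where
  "struct_SK scale val =
    \<lparr>univ = sort_carrier val, fint = fsym_SK_int scale val, rint = rsym_int\<rparr>"


subsection \<open>Variable base field\<close>

datatype fsym_S =
  VAdd_S | VZero_S | KAdd_S | KMul_S | KZero_S | KOne_S | Inf_S | VScal_S | Val_S |
  SAdd_S | SZero_S | SScal_S | SVal_S | Pi_S

primrec fsym_S_arity :: "fsym_S \<Rightarrow> sort list \<times> sort" where
  "fsym_S_arity VAdd_S = ([VecS, VecS], VecS)"
| "fsym_S_arity VZero_S = ([], VecS)"
| "fsym_S_arity KAdd_S = ([FldS, FldS], FldS)"
| "fsym_S_arity KMul_S = ([FldS, FldS], FldS)"
| "fsym_S_arity KZero_S = ([], FldS)"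
| "fsym_S_arity KOne_S = ([], FldS)"
| "fsym_S_arity Inf_S = ([], ValS)"
| "fsym_S_arity VScal_S = ([FldS, VecS], VecS)"
| "fsym_S_arity Val_S = ([VecS], ValS)"
| "fsym_S_arity SAdd_S = ([SkelS, SkelS], SkelS)"
| "fsym_S_arity SZero_S = ([], SkelS)"
| "fsym_S_arity SScal_S = ([FldS, SkelS], SkelS)"
| "fsym_S_arity SVal_S = ([SkelS], ValS)"
| "fsym_S_arity Pi_S = ([VecS], SkelS)"

primrec fsym_S_int ::
  "('k::field \<Rightarrow> 'v::ab_group_add \<Rightarrow> 'v) \<Rightarrow> ('v \<Rightarrow> 'g::{linorder, order_top}) \<Rightarrow>
    fsym_S \<Rightarrow> ('k, 'v, 'g) elem list \<Rightarrow> ('k, 'v, 'g) elem" where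
  "fsym_S_int scale val VAdd_S = (\<lambda>as. InV (ofV (as ! 0) + ofV (as ! 1)))"
| "fsym_S_int scale val VZero_S = (\<lambda>as. InV 0)"
| "fsym_S_int scale val KAdd_S = (\<lambda>as. InK (ofK (as ! 0) + ofK (as ! 1)))"
| "fsym_S_int scale val KMul_S = (\<lambda>as. InK (ofK (as ! 0) * ofK (as ! 1)))"
| "fsym_S_int scale val KZero_S = (\<lambda>as. InK 0)"
| "fsym_S_int scale val KOne_S = (\<lambda>as. InK 1)"
| "fsym_S_int scale val Inf_S = (\<lambda>as. InG top)"
| "fsym_S_int scale val VScal_S = (\<lambda>as. InV (scale (ofK (as ! 0)) (ofV (as ! 1))))"
| "fsym_S_int scale val Val_S = (\<lambda>as. InG (val (ofV (as ! 0))))"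
| "fsym_S_int scale val SAdd_S = (\<lambda>as. InS (skel_add val (ofS (as ! 0)) (ofS (as ! 1))))"
| "fsym_S_int scale val SZero_S = (\<lambda>as. InS (skel_zero val))"
| "fsym_S_int scale val SScal_S =
    (\<lambda>as. InS (skel_scale scale val (ofK (as ! 0)) (ofS (as ! 1))))"
| "fsym_S_int scale val SVal_S = (\<lambda>as. InG (skel_val (ofS (as ! 0))))"
| "fsym_S_int scale val Pi_S = (\<lambda>as. InS (skel_pi val (ofV (as ! 0))))"

definition L_S :: "(sort, fsym_S, rsym) lang" where
  "L_S = \<lparr>sorts = UNIV, funs = UNIV, rels = UNIV,
    farity = fsym_S_arity, rarity = rsym_arity\<rparr>"

definition L_S_skel :: "(sort, fsym_S, rsym) lang" where
  "L_S_skel = L_S\<lparr>sorts := {FldS, ValS, SkelS},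
    funs := {SAdd_S, SZero_S, SScal_S, SVal_S, KAdd_S, KMul_S, KZero_S, KOne_S}\<rparr>"

definition struct_S ::
  "('k::field \<Rightarrow> 'v::ab_group_add \<Rightarrow> 'v) \<Rightarrow> ('v \<Rightarrow> 'g::{linorder, order_top}) \<Rightarrow>
    (sort, fsym_S, rsym, ('k, 'v, 'g) elem) struct" where
  "struct_S scale val =
    \<lparr>univ = sort_carrier val, fint = fsym_S_int scale val, rint = rsym_int\<rparr>"


subsection \<open>Well-definedness\<close>

context valued_vector_space
begin

lemma sort_carrier_nonempty: "sort_carrier val s \<noteq> {}"
  using skel_zero_in by (cases s) auto

lemma is_structure_SK: "is_structure L_SK (struct_SK scale val)"
  unfolding is_structure_def
proof (intro conjI ballI allI impI)
  fix f :: "'k fsym_SK" and as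
  assume "list_all2 (\<lambda>a s. a \<in> univ (struct_SK scale val) s) as (fst (farity L_SK f))"
  then show "fint (struct_SK scale val) f as \<in> univ (struct_SK scale val) (snd (farity L_SK f))"
    by (cases f) (auto simp: L_SK_def struct_SK_def list_all2_Cons2
        intro!: imageI skel_add_in skel_scale_in skel_zero_in skel_pi_in)
qed (simp add: struct_SK_def sort_carrier_nonempty)

lemma is_structure_S: "is_structure L_S (struct_S scale val)"
  unfolding is_structure_def
proof (intro conjI ballI allI impI)
  fix f as
  assume "list_all2 (\<lambda>a s. a \<in> univ (struct_S scale val) s) as (fst (farity L_S f))"
  then show "fint (struct_S scale val) f as \<in> univ (struct_S scale val) (snd (farity L_S f))"
    by (cases f) (auto simp: L_S_def struct_S_def list_all2_Cons2
        intro!: imageI skel_add_in skel_scale_in skel_zero_in skel_pi_in)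
qed (simp add: struct_S_def sort_carrier_nonempty)

lemma is_structure_SK_skel: "is_structure L_SK_skel (struct_SK scale val)"
  using is_structure_SK by (auto simp: is_structure_def L_SK_skel_def L_SK_def)

lemma is_structure_S_skel: "is_structure L_S_skel (struct_S scale val)"
  using is_structure_S by (auto simp: is_structure_def L_S_skel_def L_S_def)

end

end

theory Submission
  imports Defs "HOL-Library.FuncSet"
begin

text \<open>
  Given vectors \<open>u\<^sub>1, \<dots>, u\<^sub>n\<close> and \<open>v\<close>, write \<open>v = c + w\<close> with \<open>w\<close> a linear combination of the
  \<open>u\<^sub>i\<close> for which \<open>val c\<close> is maximal; such a \<open>w\<close> exists because the scalars have trivial valuation,
  so that finite-dimensional spaces have finitely many values.  Maximality makes
  \<open>\<pi>(k c + x)\<close>, for \<open>x\<close> in the span of the \<open>u\<^sub>i\<close>, a definable function of \<open>k\<close>, \<open>\<pi>(x)\<close> and \<open>\<pi>(c)\<close> in the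
  skeleton, so the vector \<open>v\<close> can be traded for \<open>\<pi>(c)\<close> and the coefficients of \<open>w\<close>.
  This eliminates vector quantifiers.  By Sauer--Shelah, NIP says that a formula cuts out polynomially
  many subsets of a finite set of parameters.  To bound this number for a formula with vector
  variables, given a finite set \<open>A\<close> of parameters, trade each remaining vector \<open>v\<close> in the same way,
  with \<open>w\<close> optimal among the combinations involving any one \<open>a \<in> A\<close>.  The \<open>a\<close> that attains the optimum
  contributes a factor \<open>card A\<close>, which is harmless, and induction leads to a formula of the skeleton.
\<close>

text \<open>Eliminating quantifiers leaves atoms \<open>z = \<pi>(t)\<close> with free vectors, so
  NIP of the skeleton does not apply yet: the remainder c of a vector v depends on the other
  vectors. If v lies on the side of the counted assignments, each a picks its own remainder, which
  costs nothing. If v is a parameter, one remainder must serve all of \<open>A\<close>, and the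
  optimal w is built from the vectors of a single a0, whose values then have to be available beside
  every other a. Shattered sets are hard to follow through such changes of the assignments, while
  the number of sets cut out survives them. For the same reason predicates are treated as sets of
  assignments, not as formulas with fixed lists of variables.

  The other obstacle is the base field. Atoms compare v with combinations whose coefficients are
  quotients, and division is not a symbol. Over a fixed field the quotients are constants; over a
  variable field they depend on the assignment, so that all coefficient vectors have to compete.
  Families of competitors parametrized by field variables cover both cases.\<close>

declare split_paired_All [simp del] split_paired_Ex [simp del]

section \<open>Counting the sets cut out by a formula\<close>

definition shattered :: "'a set set \<Rightarrow> 'a set \<Rightarrow> bool" where
  "shattered F S \<longleftrightarrow> (\<forall>I\<subseteq>S. \<exists>B\<in>F. S \<inter> B = I)"

lemma shattered_subset:
  assumes "shattered F S" "S' \<subseteq> S"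
  shows "shattered F S'"
  unfolding shattered_def
proof (intro allI impI)
  fix I assume "I \<subseteq> S'"
  then obtain B where "B \<in> F" "S \<inter> B = I"
    using assms unfolding shattered_def by (meson subset_trans)
  then show "\<exists>B\<in>F. S' \<inter> B = I"
    using \<open>I \<subseteq> S'\<close> assms(2) by blast
qed

text \<open>Pajor's form of the lemma. Deleting \<open>x\<close> from all members identifies exactly
  the pairs that differ in \<open>x\<close>, and these are counted by \<open>P \<inter> R\<close>. A
  set shattered by \<open>P \<inter> R\<close> stays shattered by \<open>F\<close> after adding
  \<open>x\<close>, since every trace comes from one member with \<open>x\<close> and from one
  without.\<close>

lemma card_le_card_shattered:
  assumes "finite A" "F \<subseteq> Pow A"
  shows "card F \<le> card {S. S \<subseteq> A \<and> shattered F S}"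
  using assms
proof (induction A arbitrary: F rule: finite_induct)
  case empty
  show ?case
  proof (cases "F = {}")
    case False
    with empty have "F = {{}}" by auto
    then have "{S. S \<subseteq> {} \<and> shattered F S} = {{}}"
      by (auto simp: shattered_def)
    then show ?thesis using \<open>F = {{}}\<close> by simp
  qed simp
next
  case (insert x A)
  define P where "P = {B \<in> F. x \<notin> B}"
  define R where "R = (\<lambda>B. B - {x}) ` {B \<in> F. x \<in> B}"
  let ?sh = "\<lambda>F. {S. S \<subseteq> A \<and> shattered F S}"
  have finF: "finite F"
    using insert.prems insert.hyps(1) by (meson finite.insertI finite_Pow_iff finite_subset)
  have PA: "P \<subseteq> Pow A" and RA: "R \<subseteq> Pow A"
    using insert.prems by (auto simp: P_def R_def)
  have "inj_on (\<lambda>B. B - {x}) {B \<in> F. x \<in> B}"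
    by (auto simp: inj_on_def)
  then have cR: "card R = card {B \<in> F. x \<in> B}"
    by (simp add: R_def card_image)
  have "P \<union> {B \<in> F. x \<in> B} = F" "P \<inter> {B \<in> F. x \<in> B} = {}"
    by (auto simp: P_def)
  then have "card F = card P + card {B \<in> F. x \<in> B}"
    using card_Un_disjoint[of P "{B \<in> F. x \<in> B}"] finF by (simp add: P_def)
  also have "\<dots> = card (P \<union> R) + card (P \<inter> R)"
    unfolding cR[symmetric] using finF by (intro card_Un_Int) (simp_all add: P_def R_def)
  also have "\<dots> \<le> card (?sh (P \<union> R)) + card (?sh (P \<inter> R))"
    using insert.IH[of "P \<union> R"] insert.IH[of "P \<inter> R"] PA RA by (simp add: add_mono le_infI1)
  also have "\<dots> = card (?sh (P \<union> R)) + card (Set.insert x ` ?sh (P \<inter> R))"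
    using insert.hyps(2) by (subst card_image) (auto simp: inj_on_def)
  also have "\<dots> = card (?sh (P \<union> R) \<union> Set.insert x ` ?sh (P \<inter> R))"
    using insert.hyps by (intro card_Un_disjoint[symmetric]) auto
  also have "\<dots> \<le> card {S. S \<subseteq> Set.insert x A \<and> shattered F S}"
  proof (rule card_mono)
    show "finite {S. S \<subseteq> Set.insert x A \<and> shattered F S}"
      using insert.hyps(1) by simp
    show "?sh (P \<union> R) \<union> Set.insert x ` ?sh (P \<inter> R) \<subseteq> {S. S \<subseteq> Set.insert x A \<and> shattered F S}"
    proof safe
      fix S assume S: "S \<subseteq> A" "shattered (P \<union> R) S"
      then have "x \<notin> S" using insert.hyps(2) by blast
      show "shattered F S"
        unfolding shattered_def
      proof (intro allI impI)
        fix I assume "I \<subseteq> S"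
        then obtain B where B: "B \<in> P \<union> R" "S \<inter> B = I"
          using S(2) unfolding shattered_def by blast
        then consider "B \<in> F" | C where "C \<in> F" "B = C - {x}"
          by (auto simp: P_def R_def)
        then show "\<exists>B\<in>F. S \<inter> B = I"
          using B(2) \<open>x \<notin> S\<close> by cases auto
      qed
    next
      fix S assume S: "S \<subseteq> A" "shattered (P \<inter> R) S"
      then have "x \<notin> S" using insert.hyps(2) by blast
      show "shattered F (Set.insert x S)"
        unfolding shattered_def
      proof (intro allI impI)
        fix I assume I: "I \<subseteq> Set.insert x S"
        then have "I - {x} \<subseteq> S" by blast
        then obtain B where B: "B \<in> P \<inter> R" "S \<inter> B = I - {x}"
          using S(2) unfolding shattered_def by blast
        then obtain C where "x \<in> C" "C \<in> F" "B = C - {x}" "B \<in> F"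
          by (auto simp: P_def R_def)
        then have B': "x \<notin> B" "B \<in> F" "Set.insert x B \<in> F"
          by (simp_all add: insert_absorb)
        show "\<exists>B\<in>F. Set.insert x S \<inter> B = I"
        proof (cases "x \<in> I")
          case True
          then have "Set.insert x S \<inter> Set.insert x B = I" using B(2) by auto
          then show ?thesis using B'(3) by blast
        next
          case False
          then have "Set.insert x S \<inter> B = I" using B(2) B'(1) by auto
          then show ?thesis using B'(2) by blast
        qed
      qed
    qed blast+
  qed
  finally show ?case .
qed

text \<open>Allowing one more element multiplies the count by at most \<open>card A + 1\<close>;
  this crude form suffices for polynomial growth.\<close>

lemma card_subsets_card_le:
  assumes "finite A"
  shows "card {S. S \<subseteq> A \<and> card S \<le> k} \<le> (card A + 1) ^ k"
proof (induction k)
  case 0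
  have "{S. S \<subseteq> A \<and> card S \<le> 0} = {{}}"
    using assms finite_subset by fastforce
  then show ?case by simp
next
  case (Suc k)
  let ?B = "{S. S \<subseteq> A \<and> card S \<le> k}"
  have fin: "finite ?B" using assms by simp
  have "{S. S \<subseteq> A \<and> card S \<le> Suc k} \<subseteq> ?B \<union> (\<lambda>(S, x). insert x S) ` (?B \<times> A)"
  proof
    fix S assume S: "S \<in> {S. S \<subseteq> A \<and> card S \<le> Suc k}"
    show "S \<in> ?B \<union> (\<lambda>(S, x). insert x S) ` (?B \<times> A)"
    proof (cases "card S \<le> k")
      case False
      then obtain x where "x \<in> S" by fastforce
      moreover have "finite S" using S assms finite_subset by blast
      ultimately have "(S - {x}, x) \<in> ?B \<times> A" "S = insert x (S - {x})"
        using S by (auto simp: card_Diff_singleton)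
      then show ?thesis by (metis (no_types, lifting) UnI2 case_prod_conv image_eqI)
    qed (use S in simp)
  qed
  then have "card {S. S \<subseteq> A \<and> card S \<le> Suc k} \<le> card (?B \<union> (\<lambda>(S, x). insert x S) ` (?B \<times> A))"
    using fin assms by (intro card_mono) auto
  also have "\<dots> \<le> card ?B + card ?B * card A"
    using fin assms
    by (intro order_trans[OF card_Un_le] add_mono order_refl order_trans[OF card_image_le])
      (auto simp: card_cartesian_product)
  also have "\<dots> = card ?B * (card A + 1)" by simp
  also have "\<dots> \<le> (card A + 1) ^ k * (card A + 1)" using Suc.IH by (rule mult_le_mono1)
  finally show ?case by (simp only: power_Suc2)
qed

theorem sauer_shelah:
  assumes "finite A" "F \<subseteq> Pow A" "\<And>S. S \<subseteq> A \<Longrightarrow> card S = n \<Longrightarrow> \<not> shattered F S"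
  shows "card F \<le> (card A + 1) ^ n"
proof -
  have "{S. S \<subseteq> A \<and> shattered F S} \<subseteq> {S. S \<subseteq> A \<and> card S \<le> n}"
  proof safe
    fix S assume S: "S \<subseteq> A" "shattered F S"
    show "card S \<le> n"
    proof (rule ccontr)
      assume "\<not> card S \<le> n"
      then obtain S' where "S' \<subseteq> S" "card S' = n"
        using obtain_subset_with_card_n[of n S] by (auto simp: not_le)
      moreover have "S' \<subseteq> A" using \<open>S' \<subseteq> S\<close> S(1) by blast
      ultimately show False using assms(3) shattered_subset[OF S(2)] by blast
    qed
  qed
  then have "card {S. S \<subseteq> A \<and> shattered F S} \<le> card {S. S \<subseteq> A \<and> card S \<le> n}"
    using assms(1) by (intro card_mono) auto
  then show ?thesis
    using card_le_card_shattered[OF assms(1,2)] card_subsets_card_le[OF assms(1), of n] by linarith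
qed

lemma ex_poly_less_exp: "\<exists>n. (n + 2) ^ d < (2::nat) ^ n"
proof -
  \<comment> \<open>The witness will be the power \<open>n = 2 ^ (2 * k)\<close>, which turns the
    claim into a comparison of exponents, \<open>(2 * k + 1) * d < 2 ^ (2 * k)\<close>. This follows
    by squaring \<open>k + 1 \<le> 2 ^ k\<close>.\<close>
  define k where "k = 2 * d + 1"
  have "k < 2 ^ k" by (rule less_exp)
  then have "(k + 1) * (k + 1) \<le> 2 ^ k * 2 ^ k" by (intro mult_le_mono) (simp_all add: Suc_le_eq)
  also have "\<dots> = 2 ^ (2 * k)" by (simp add: mult_2 power_add)
  finally have *: "(2 * k + 1) * d < 2 ^ (2 * k)"
    by (rule less_le_trans[rotated]) (simp add: k_def algebra_simps)
  have "(2::nat) ^ (2 * k) + 2 \<le> 2 ^ (2 * k + 1)"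
    using power_increasing[of 1 "2 * k" "2::nat"] by (simp add: k_def)
  then have "(2 ^ (2 * k) + 2) ^ d \<le> ((2::nat) ^ (2 * k + 1)) ^ d" by (rule power_mono) simp
  then have "(2 ^ (2 * k) + 2) ^ d \<le> (2::nat) ^ ((2 * k + 1) * d)"
    by (simp only: power_mult)
  also have "\<dots> < 2 ^ (2 ^ (2 * k))"
    using * by (intro power_strict_increasing) auto
  finally have "(2 ^ (2 * k) + 2) ^ d < (2::nat) ^ (2 ^ (2 * k))" .
  then show ?thesis by blast
qed

section \<open>Well-sorted assignments and dependence on variables\<close>

definition envs :: "('s, 'f, 'r, 'u) struct \<Rightarrow> ('s var \<Rightarrow> 'u) set" where
  "envs M = {e. \<forall>x. e x \<in> univ M (fst x)}"

definition depends_on :: "(('a \<Rightarrow> 'b) \<Rightarrow> 'c) \<Rightarrow> 'a set \<Rightarrow> bool" where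
  "depends_on P S \<longleftrightarrow> (\<forall>e e'. (\<forall>x\<in>S. e x = e' x) \<longrightarrow> P e = P e')"

lemma depends_onD: "depends_on P S \<Longrightarrow> (\<And>x. x \<in> S \<Longrightarrow> e x = e' x) \<Longrightarrow> P e = P e'"
  unfolding depends_on_def by blast

lemma depends_on_mono: "depends_on P S \<Longrightarrow> S \<subseteq> S' \<Longrightarrow> depends_on P S'"
  unfolding depends_on_def by blast

lemma depends_on_eval_tm: "depends_on (\<lambda>e. eval_tm M e t) (tm_vars t)"
  unfolding depends_on_def
proof (intro allI)
  fix e e' :: "'a var \<Rightarrow> 'b"
  show "(\<forall>x\<in>tm_vars t. e x = e' x) \<longrightarrow> eval_tm M e t = eval_tm M e' t"
  proof (induction t)
    case (App f ts)
    show ?case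
    proof
      assume "\<forall>x\<in>tm_vars (App f ts). e x = e' x"
      then have "map (eval_tm M e) ts = map (eval_tm M e') ts" using App by auto
      then show "eval_tm M e (App f ts) = eval_tm M e' (App f ts)" by (metis eval_tm.simps(2))
    qed
  qed simp
qed

lemma depends_on_sat: "depends_on (\<lambda>e. sat M e \<phi>) (free_vars \<phi>)"
proof (induction \<phi>)
  case (Eq t u)
  have "eval_tm M e t = eval_tm M e' t" "eval_tm M e u = eval_tm M e' u"
    if "\<forall>x\<in>tm_vars t \<union> tm_vars u. e x = e' x" for e e'
    using that by (auto intro: depends_onD[OF depends_on_eval_tm])
  then show ?case unfolding depends_on_def by (metis free_vars.simps(1) sat.simps(1))
next
  case (Rel r ts)
  have "map (eval_tm M e) ts = map (eval_tm M e') ts" if "\<forall>x\<in>free_vars (Rel r ts). e x = e' x" for e e'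
    using that by (auto intro!: depends_onD[OF depends_on_eval_tm])
  then show ?case unfolding depends_on_def by (metis sat.simps(2))
next
  case (Exi x \<phi>)
  have "sat M (e(x := a)) \<phi> = sat M (e'(x := a)) \<phi>"
    if "\<forall>y\<in>free_vars \<phi> - {x}. e y = e' y" for e e' a
    using that by (intro depends_onD[OF Exi]) auto
  then show ?case unfolding depends_on_def sat.simps free_vars.simps by metis
next
  case (Conj \<phi> \<psi>)
  then show ?case unfolding depends_on_def sat.simps free_vars.simps by (metis UnCI)
qed (simp add: depends_on_def)

lemma finite_tm_vars: "finite (tm_vars t)"
  by (induction t) auto

lemma finite_free_vars: "finite (free_vars \<phi>)"
  by (induction \<phi>) (auto simp: finite_tm_vars)

lemma has_sort_tm_vars: "has_sort L t s \<Longrightarrow> fst ` tm_vars t \<subseteq> sorts L"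
proof (induction rule: has_sort.induct)
  case (App f ts)
  then have "\<forall>t\<in>set ts. fst ` tm_vars t \<subseteq> sorts L"
    by (fastforce simp: list_all2_conv_all_nth in_set_conv_nth)
  then show ?case by auto
qed simp

lemma wff_free_vars: "wff L \<phi> \<Longrightarrow> fst ` free_vars \<phi> \<subseteq> sorts L"
proof (induction \<phi>)
  case (Eq t u)
  then show ?case using has_sort_tm_vars by (fastforce simp: image_Un)
next
  case (Rel r ts)
  then have "\<forall>t\<in>set ts. fst ` tm_vars t \<subseteq> sorts L"
    using has_sort_tm_vars by (fastforce simp: list_all2_conv_all_nth in_set_conv_nth)
  then show ?case by auto
qed auto

section \<open>NIP as polynomial growth of the number of patterns\<close>

definition comb :: "'a set \<Rightarrow> ('a \<Rightarrow> 'b) \<Rightarrow> ('a \<Rightarrow> 'b) \<Rightarrow> 'a \<Rightarrow> 'b" where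
  "comb X a b = (\<lambda>x. if x \<in> X then a x else b x)"

lemma comb_in [simp]: "x \<in> X \<Longrightarrow> comb X a b x = a x"
  and comb_notin [simp]: "x \<notin> X \<Longrightarrow> comb X a b x = b x"
  by (simp_all add: comb_def)

lemma comb_envs: "a \<in> envs M \<Longrightarrow> b \<in> envs M \<Longrightarrow> comb X a b \<in> envs M"
  by (simp add: comb_def envs_def)

lemma upd_envs: "e \<in> envs M \<Longrightarrow> a \<in> univ M (fst x) \<Longrightarrow> e(x := a) \<in> envs M"
  by (simp add: envs_def)

lemma envsD: "e \<in> envs M \<Longrightarrow> e x \<in> univ M (fst x)"
  by (simp add: envs_def)

text \<open>The traces on \<open>A\<close> of the family of sets defined by \<open>P\<close>:
  variables in \<open>X\<close> form the object side, all others the parameter side. Using whole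
  assignments instead of tuples lets new variables join either side without reindexing.\<close>

definition patterns ::
  "('s, 'f, 'r, 'u) struct \<Rightarrow> 's var set \<Rightarrow> (('s var \<Rightarrow> 'u) \<Rightarrow> bool) \<Rightarrow> ('s var \<Rightarrow> 'u) set \<Rightarrow>
    ('s var \<Rightarrow> 'u) set set" where
  "patterns M X P A = (\<lambda>b. {a \<in> A. P (comb X a b)}) ` envs M"

text \<open>The summand 2 keeps the base at least 2 even for empty \<open>A\<close>, so that
  constant factors and factors \<open>card A\<close> can be absorbed into the exponent.\<close>

definition poly_patterns ::
  "('s, 'f, 'r, 'u) struct \<Rightarrow> 's var set \<Rightarrow> (('s var \<Rightarrow> 'u) \<Rightarrow> bool) \<Rightarrow> bool" where
  "poly_patterns M X P \<longleftrightarrow>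
    (\<exists>d. \<forall>A\<subseteq>envs M. finite A \<longrightarrow> card (patterns M X P A) \<le> (card A + 2) ^ d)"

lemma patterns_subset: "patterns M X P A \<subseteq> Pow A"
  by (auto simp: patterns_def)

lemma finite_patterns: "finite A \<Longrightarrow> finite (patterns M X P A)"
  by (rule finite_subset[OF patterns_subset]) simp

lemma poly_patterns_cong:
  assumes "\<And>e. e \<in> envs M \<Longrightarrow> P e = Q e" "poly_patterns M X P"
  shows "poly_patterns M X Q"
proof -
  have "patterns M X P A = patterns M X Q A" if "A \<subseteq> envs M" for A
    unfolding patterns_def using that assms(1) comb_envs
    by (intro image_cong refl Collect_cong conj_cong) blast+
  then show ?thesis using assms(2) unfolding poly_patterns_def by simp
qed

lemma map_of_zip_map: "x \<in> set xs \<Longrightarrow> map_of (zip xs (map f xs)) x = Some (f x)"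
  by (induction xs) auto

lemma assign_map_map:
  assumes "distinct (xs @ ys)"
  shows "x \<in> set xs \<Longrightarrow> assign (xs @ ys) (map a xs @ map b ys) x = a x"
    and "x \<in> set ys \<Longrightarrow> assign (xs @ ys) (map a xs @ map b ys) x = b x"
proof -
  have "map a xs @ map b ys = map (\<lambda>x. if x \<in> set xs then a x else b x) (xs @ ys)"
    using assms by auto
  then have "assign (xs @ ys) (map a xs @ map b ys) x = (if x \<in> set xs then a x else b x)"
    if "x \<in> set (xs @ ys)" for x
    using that by (simp add: assign_def map_of_zip_map del: map_append)
  then show "x \<in> set xs \<Longrightarrow> assign (xs @ ys) (map a xs @ map b ys) x = a x"
    "x \<in> set ys \<Longrightarrow> assign (xs @ ys) (map a xs @ map b ys) x = b x"
    using assms by auto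
qed

lemma map_in_tuples: "e \<in> envs M \<Longrightarrow> map e xs \<in> tuples M xs"
  by (simp add: tuples_def list_all2_conv_all_nth envs_def)

lemma tuples_ex_env:
  assumes "as \<in> tuples M xs" "distinct xs" "w \<in> envs M"
  shows "\<exists>e\<in>envs M. map e xs = as"
proof -
  let ?e = "comb (set xs) (assign xs as) w"
  have len: "length as = length xs" and mem: "\<And>i. i < length xs \<Longrightarrow> as ! i \<in> univ M (fst (xs ! i))"
    using assms(1) by (auto simp: tuples_def list_all2_conv_all_nth)
  have eq: "assign xs as (xs ! i) = as ! i" if "i < length xs" for i
    using that len assms(2) by (simp add: assign_def map_of_zip_nth)
  have "assign xs as x \<in> univ M (fst x)" if "x \<in> set xs" for x
    using that eq mem by (metis in_set_conv_nth)
  then have "?e \<in> envs M"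
    using assms(3) by (simp add: envs_def comb_def)
  moreover have "map ?e xs = as"
    using len eq by (auto intro: nth_equalityI)
  ultimately show ?thesis by blast
qed

text \<open>Members of a shattered set of assignments are separated by instances of
  \<open>\<phi>\<close>, hence already differ on \<open>xs\<close>. Restriction to tuples is
  therefore injective on it, and a size at which \<open>\<phi>\<close> shatters no tuples is also
  missing for assignments, so that Sauer-Shelah applies.\<close>

lemma NIP_imp_poly_patterns:
  assumes "NIP L M" "wff L \<phi>"
  shows "poly_patterns M X (\<lambda>e. sat M e \<phi>)"
proof -
  obtain xs where xs: "set xs = free_vars \<phi> \<inter> X" "distinct xs"
    using finite_distinct_list[of "free_vars \<phi> \<inter> X"] finite_free_vars by blast
  obtain ys where ys: "set ys = free_vars \<phi> - X" "distinct ys"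
    using finite_distinct_list[of "free_vars \<phi> - X"] finite_free_vars by blast
  have dist: "distinct (xs @ ys)" using xs ys by auto
  have "set (xs @ ys) = free_vars \<phi>" using xs ys by auto
  then have "partitioned_formula L \<phi> xs ys"
    using dist assms(2) wff_free_vars unfolding partitioned_formula_def by fastforce
  then have "\<not> has_IP M \<phi> xs ys" using assms(1) unfolding NIP_def by blast
  then obtain n where n: "\<And>A. A \<subseteq> tuples M xs \<Longrightarrow> finite A \<Longrightarrow> card A = n \<Longrightarrow> \<not> shatters M \<phi> xs ys A"
    unfolding has_IP_def by blast
  have sat: "sat M (assign (xs @ ys) (map a xs @ map b ys)) \<phi> = sat M (comb X a b) \<phi>" for a b
  proof (rule depends_onD[OF depends_on_sat])
    fix x assume "x \<in> free_vars \<phi>"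
    then show "assign (xs @ ys) (map a xs @ map b ys) x = comb X a b x"
      using assign_map_map[OF dist, of x a b] xs ys by (cases "x \<in> X") simp_all
  qed
  have "card (patterns M X (\<lambda>e. sat M e \<phi>) A) \<le> (card A + 2) ^ n"
    if A: "A \<subseteq> envs M" "finite A" for A
  proof -
    let ?F = "patterns M X (\<lambda>e. sat M e \<phi>) A"
    have "\<not> shattered ?F S" if S: "S \<subseteq> A" "card S = n" for S
    proof
      assume sh: "shattered ?F S"
      have ex: "\<exists>b\<in>envs M. \<forall>a\<in>S. sat M (comb X a b) \<phi> \<longleftrightarrow> a \<in> I" if "I \<subseteq> S" for I
      proof -
        obtain B where "B \<in> ?F" "S \<inter> B = I"
          using sh \<open>I \<subseteq> S\<close> unfolding shattered_def by blast
        then obtain b where "b \<in> envs M" "S \<inter> {a \<in> A. sat M (comb X a b) \<phi>} = I"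
          unfolding patterns_def by blast
        then show ?thesis using S(1) by blast
      qed
      have inj: "inj_on (\<lambda>a. map a xs) S"
      proof (rule inj_onI, rule ccontr)
        fix a a' assume a: "a \<in> S" "a' \<in> S" "map a xs = map a' xs" "a \<noteq> a'"
        then obtain b where "\<forall>a''\<in>S. sat M (comb X a'' b) \<phi> \<longleftrightarrow> a'' \<in> {a}"
          using ex[of "{a}"] by auto
        then have "sat M (comb X a b) \<phi> \<noteq> sat M (comb X a' b) \<phi>" using a by auto
        then show False using sat[of a b] sat[of a' b] a(3) by simp
      qed
      let ?T = "(\<lambda>a. map a xs) ` S"
      have "shatters M \<phi> xs ys ?T"
        unfolding shatters_def
      proof (intro allI impI)
        fix I assume "I \<subseteq> ?T"
        obtain b where b: "b \<in> envs M" "\<forall>a\<in>S. sat M (comb X a b) \<phi> \<longleftrightarrow> a \<in> {a \<in> S. map a xs \<in> I}"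
          using ex[of "{a \<in> S. map a xs \<in> I}"] by auto
        then show "\<exists>b\<in>tuples M ys. \<forall>a\<in>?T. sat M (assign (xs @ ys) (a @ b)) \<phi> \<longleftrightarrow> a \<in> I"
          by (intro bexI[of _ "map b ys"]) (auto simp: sat map_in_tuples)
      qed
      moreover have "?T \<subseteq> tuples M xs" using S(1) A(1) map_in_tuples by blast
      moreover have "finite ?T" "card ?T = n"
        using S finite_subset[OF S(1) A(2)] card_image[OF inj] by auto
      ultimately show False using n by blast
    qed
    then have "card ?F \<le> (card A + 1) ^ n" using A(2) patterns_subset by (intro sauer_shelah)
    also have "\<dots> \<le> (card A + 2) ^ n" by (intro power_mono) auto
    finally show ?thesis .
  qed
  then show ?thesis unfolding poly_patterns_def by blast
qed

text \<open>Shattering \<open>n\<close> tuples produces \<open>2 ^ n\<close> patterns, so a single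
  \<open>n\<close> at which the exponential exceeds the polynomial refutes the independence
  property.\<close>

lemma poly_patterns_imp_NIP:
  assumes "\<And>s. univ M s \<noteq> {}"
    and "\<And>\<phi> X. wff L \<phi> \<Longrightarrow> finite X \<Longrightarrow> poly_patterns M X (\<lambda>e. sat M e \<phi>)"
  shows "NIP L M"
  unfolding NIP_def
proof (intro allI impI notI)
  fix \<phi> xs ys assume part: "partitioned_formula L \<phi> xs ys" and IP: "has_IP M \<phi> xs ys"
  have dist: "distinct (xs @ ys)" and fv: "free_vars \<phi> \<subseteq> set (xs @ ys)" and "wff L \<phi>"
    using part unfolding partitioned_formula_def by auto
  \<comment> \<open>Some well-sorted assignment is needed to extend tuples to all variables.\<close>
  have "(\<lambda>x. SOME a. a \<in> univ M (fst x)) \<in> envs M"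
    using assms(1) by (simp add: envs_def some_in_eq)
  then obtain w where w: "w \<in> envs M" by blast
  have sat: "sat M (assign (xs @ ys) (map a xs @ map b ys)) \<phi> = sat M (comb (set xs) a b) \<phi>" for a b
  proof (rule depends_onD[OF depends_on_sat])
    fix x assume "x \<in> free_vars \<phi>"
    then show "assign (xs @ ys) (map a xs @ map b ys) x = comb (set xs) a b x"
      using assign_map_map[OF dist, of x a b] fv by (cases "x \<in> set xs") auto
  qed
  obtain d where d: "\<And>A. A \<subseteq> envs M \<Longrightarrow> finite A \<Longrightarrow>
      card (patterns M (set xs) (\<lambda>e. sat M e \<phi>) A) \<le> (card A + 2) ^ d"
    using assms(2)[OF \<open>wff L \<phi>\<close>, of "set xs"] unfolding poly_patterns_def by auto
  obtain n where n: "(n + 2) ^ d < (2::nat) ^ n" using ex_poly_less_exp by blast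
  obtain A where A: "A \<subseteq> tuples M xs" "finite A" "card A = n" "shatters M \<phi> xs ys A"
    using IP unfolding has_IP_def by blast
  have "\<forall>as\<in>A. \<exists>e\<in>envs M. map e xs = as" using A(1) dist tuples_ex_env[OF _ _ w] by auto
  then obtain en where en: "\<And>as. as \<in> A \<Longrightarrow> en as \<in> envs M" "\<And>as. as \<in> A \<Longrightarrow> map (en as) xs = as"
    by metis
  have inj: "inj_on en A" by (metis en(2) inj_onI)
  have "Pow (en ` A) \<subseteq> patterns M (set xs) (\<lambda>e. sat M e \<phi>) (en ` A)"
  proof
    fix I assume I: "I \<in> Pow (en ` A)"
    define I' where "I' = {as \<in> A. en as \<in> I}"
    have "I' \<subseteq> A" by (auto simp: I'_def)
    then obtain bs where bs: "bs \<in> tuples M ys" "\<forall>as\<in>A. sat M (assign (xs @ ys) (as @ bs)) \<phi> \<longleftrightarrow> as \<in> I'"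
      using A(4) unfolding shatters_def by blast
    obtain b where b: "b \<in> envs M" "map b ys = bs"
      using tuples_ex_env[OF bs(1) _ w] dist by auto
    have "sat M (comb (set xs) (en as) b) \<phi> \<longleftrightarrow> en as \<in> I" if "as \<in> A" for as
      using sat[of "en as" b] bs(2) that en(2)[OF that] b(2) by (simp add: I'_def)
    then have "{a \<in> en ` A. sat M (comb (set xs) a b) \<phi>} = I" using I by auto
    then show "I \<in> patterns M (set xs) (\<lambda>e. sat M e \<phi>) (en ` A)"
      using b(1) unfolding patterns_def by blast
  qed
  then have "card (Pow (en ` A)) \<le> card (patterns M (set xs) (\<lambda>e. sat M e \<phi>) (en ` A))"
    using A(2) by (intro card_mono finite_patterns) auto
  also have "\<dots> \<le> (card (en ` A) + 2) ^ d" using A(2) en(1) by (intro d) auto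
  finally show False using n A(2,3) inj by (simp add: card_Pow card_image)
qed

section \<open>Definable relations of the skeleton\<close>

text \<open>Agreement is required on well-sorted assignments only, because interpretations are
  unconstrained off the carriers.\<close>

definition definable ::
  "('s, 'f, 'r) lang \<Rightarrow> ('s, 'f, 'r, 'u) struct \<Rightarrow> (('s var \<Rightarrow> 'u) \<Rightarrow> bool) \<Rightarrow> bool" where
  "definable L M P \<longleftrightarrow> (\<exists>\<psi>. wff L \<psi> \<and> (\<forall>e\<in>envs M. sat M e \<psi> = P e))"

lemma definableI: "wff L \<psi> \<Longrightarrow> (\<And>e. e \<in> envs M \<Longrightarrow> sat M e \<psi> = P e) \<Longrightarrow> definable L M P"
  unfolding definable_def by blast

lemma definable_cong:
  "definable L M P \<Longrightarrow> (\<And>e. e \<in> envs M \<Longrightarrow> P e = Q e) \<Longrightarrow> definable L M Q"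
  unfolding definable_def by metis

lemma definable_not: "definable L M P \<Longrightarrow> definable L M (\<lambda>e. \<not> P e)"
  unfolding definable_def by (metis sat.simps(3) wff.simps(3))

lemma definable_conj: "definable L M P \<Longrightarrow> definable L M Q \<Longrightarrow> definable L M (\<lambda>e. P e \<and> Q e)"
  unfolding definable_def by (metis sat.simps(4) wff.simps(4))

lemma definable_disj: "definable L M P \<Longrightarrow> definable L M Q \<Longrightarrow> definable L M (\<lambda>e. P e \<or> Q e)"
  using definable_not[OF definable_conj[OF definable_not definable_not]] by simp

lemma definable_ex:
  assumes "fst x \<in> sorts L" "definable L M P"
  shows "definable L M (\<lambda>e. \<exists>a\<in>univ M (fst x). P (e(x := a)))"
proof -
  obtain \<psi> where \<psi>: "wff L \<psi>" "\<And>e. e \<in> envs M \<Longrightarrow> sat M e \<psi> = P e"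
    using assms(2) unfolding definable_def by blast
  show ?thesis
    by (rule definableI[of _ "Exi x \<psi>"]) (use \<psi> assms(1) in \<open>auto simp: upd_envs\<close>)
qed

lemma fresh_var:
  assumes "finite Z"
  obtains x :: "'s var" where "fst x = s" "x \<notin> Z"
proof -
  obtain n where "n \<notin> snd ` Z" using assms by (metis ex_new_if_finite finite_imageI infinite_UNIV_nat)
  then have "(s, n) \<notin> Z" by (metis image_eqI snd_conv)
  then show thesis using that[of "(s, n)"] by simp
qed

text \<open>
  A set of coefficient vectors that quantifiers over the field sort of \<open>L\<close> can run through: the
  values of finitely many vectors of coefficient functions whose parameters can be chosen away from
  any given finite set of variables.
\<close>

definition coef_params ::
  "(sort, 'f, 'r) lang \<Rightarrow> (sort, 'f, 'r, 'u) struct \<Rightarrow> ((sort var \<Rightarrow> 'u) \<Rightarrow> 'k) set \<Rightarrow>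
    (sort var \<Rightarrow> 'k) set \<Rightarrow> (sort var \<Rightarrow> (sort var \<Rightarrow> 'u) \<Rightarrow> 'k) set \<Rightarrow> sort var set \<Rightarrow> bool" where
  "coef_params L M Cf T G S \<longleftrightarrow> finite G \<and> finite S \<and> fst ` S \<subseteq> {FldS} \<inter> sorts L \<and>
    (\<forall>g\<in>G. \<forall>u. g u \<in> Cf \<and> depends_on (g u) S) \<and>
    T = {\<lambda>u. g u e | g e. g \<in> G \<and> e \<in> envs M}"

definition coef_family ::
  "(sort, 'f, 'r) lang \<Rightarrow> (sort, 'f, 'r, 'u) struct \<Rightarrow> ((sort var \<Rightarrow> 'u) \<Rightarrow> 'k) set \<Rightarrow>
    (sort var \<Rightarrow> 'k) set \<Rightarrow> bool" where
  "coef_family L M Cf T \<longleftrightarrow>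
    (\<forall>Z. finite Z \<longrightarrow> (\<exists>G S. S \<inter> Z = {} \<and> coef_params L M Cf T G S))"

lemma coef_params_Un:
  assumes "coef_params L M Cf T G S" "coef_params L M Cf T' G' S'"
  shows "coef_params L M Cf (T \<union> T') (G \<union> G') (S \<union> S')"
proof -
  have "depends_on (g u) (S \<union> S')" if "g \<in> G \<union> G'" for g u
    using that assms depends_on_mono[of "g u" S "S \<union> S'"] depends_on_mono[of "g u" S' "S \<union> S'"]
    by (auto simp: coef_params_def)
  moreover have T: "T = {\<lambda>u. g u e | g e. g \<in> G \<and> e \<in> envs M}"
    "T' = {\<lambda>u. g u e | g e. g \<in> G' \<and> e \<in> envs M}"
    using assms by (simp_all add: coef_params_def)
  have "T \<union> T' = {\<lambda>u. g u e | g e. g \<in> G \<union> G' \<and> e \<in> envs M}"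
    unfolding T by blast
  with calculation show ?thesis
    using assms by (auto simp: coef_params_def)
qed

lemma coef_familyE:
  assumes "coef_family L M Cf T" "finite Z"
  obtains G S where "S \<inter> Z = {}" "coef_params L M Cf T G S"
proof -
  have "\<exists>G S. S \<inter> Z = {} \<and> coef_params L M Cf T G S"
    using assms by (simp add: coef_family_def)
  then show thesis by (elim exE conjE) (rule that)
qed

text \<open>Unions are needed because \<open>w\<close> has to be optimal for all atoms of a
  predicate at once.\<close>

lemma coef_family_Un:
  assumes "coef_family L M Cf T" "coef_family L M Cf T'"
  shows "coef_family L M Cf (T \<union> T')"
  unfolding coef_family_def
proof (intro allI impI)
  fix Z :: "sort var set" assume Z: "finite Z"
  obtain G S where G: "S \<inter> Z = {}" "coef_params L M Cf T G S"
    by (rule coef_familyE[OF assms(1) Z])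
  obtain G' S' where G': "S' \<inter> Z = {}" "coef_params L M Cf T' G' S'"
    by (rule coef_familyE[OF assms(2) Z])
  have "(S \<union> S') \<inter> Z = {}" using G(1) G'(1) by blast
  then show "\<exists>G S. S \<inter> Z = {} \<and> coef_params L M Cf (T \<union> T') G S"
    using coef_params_Un[OF G(2) G'(2)] by blast
qed

section \<open>Arithmetic of the skeleton; finitely many values on finite-dimensional spaces\<close>

context valued_vector_space
begin

lemma val_add_eq: "val x < val y \<Longrightarrow> val (y + x) = val x"
proof -
  assume "val x < val y"
  then have "val x \<le> val (y + x)" by (intro val_add_ge) auto
  moreover have "min (val (y + x)) (val y) \<le> val x" using val_diff[of "y + x" y] by simp
  ultimately show ?thesis using \<open>val x < val y\<close> by (auto simp: min_def split: if_splits)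
qed

lemma skel_val_pi: "skel_val (skel_pi val v) = val v"
  by (simp add: skel_pi_def skel_val_class)

lemma skel_scale_pi: "skel_scale scale val k (skel_pi val v) = skel_class val (val v) (scale k v)"
  by (simp add: skel_pi_def skel_scale_class)

lemma skel_pi_eq_zero_iff: "skel_pi val v = skel_zero val \<longleftrightarrow> v = 0"
  unfolding skel_pi_def skel_zero_def by (subst skel_class_eq_iff) (auto simp: val_eq_top_iff)

lemma skel_val_zero: "skel_val (skel_zero val) = top"
  by (simp add: skel_zero_def skel_val_class)

text \<open>With \<open>s = \<pi>(x)\<close> and \<open>t = \<pi>(c)\<close> this computes
  \<open>\<pi>(k c + x)\<close> as long as nothing cancels. Cases are needed because the addition of
  the skeleton returns the zero class on different values; there the summand of smaller value
  prevails.\<close>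

definition skel_shift :: "'k \<Rightarrow> ('g \<times> 'v) set \<Rightarrow> ('g \<times> 'v) set \<Rightarrow> ('g \<times> 'v) set" where
  "skel_shift k s t = (if k = 0 \<or> skel_val s < skel_val t then s
    else if skel_val t < skel_val s then skel_scale scale val k t
    else skel_add val s (skel_scale scale val k t))"

text \<open>The critical case is \<open>val x = val c\<close>. There
  \<open>val (k c + x) \<ge> val c\<close> holds anyway, and the hypothesis turns it into an
  equality, so that the sum of the two classes is taken at the value of \<open>k c + x\<close>
  itself.\<close>

lemma skel_pi_shift:
  assumes "k = 0 \<or> val (scale k c + x) \<le> val c"
  shows "skel_pi val (scale k c + x) = skel_shift k (skel_pi val x) (skel_pi val c)"
proof (cases "k = 0")
  case False
  then have le: "val (scale k c + x) \<le> val c" and kc: "val (scale k c) = val c"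
    using assms by (auto simp: val_scale)
  consider "val x < val c" | "val c < val x" | "val x = val c" by force
  then show ?thesis
  proof cases
    case 1
    then have "val (scale k c + x) = val x" using kc by (intro val_add_eq) simp
    moreover have "skel_class val (val x) (scale k c + x) = skel_class val (val x) x"
      using 1 kc calculation by (subst skel_class_eq_iff) auto
    ultimately show ?thesis using 1 by (simp add: skel_shift_def skel_val_pi) (simp add: skel_pi_def)
  next
    case 2
    then have "val (scale k c + x) = val c"
      using val_add_eq[of "scale k c" x] kc by (simp add: add.commute)
    moreover have "skel_class val (val c) (scale k c + x) = skel_class val (val c) (scale k c)"
      using 2 kc calculation by (subst skel_class_eq_iff) auto
    ultimately show ?thesis using 2 False
      by (simp add: skel_shift_def skel_val_pi skel_scale_pi less_not_sym) (simp add: skel_pi_def)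
  next
    case 3
    then have "val c \<le> val (scale k c + x)" using kc by (intro val_add_ge) auto
    then have "val (scale k c + x) = val c" using le by simp
    then show ?thesis
      using 3 False kc by (simp add: skel_shift_def skel_val_pi skel_scale_pi)
        (simp add: skel_pi_def skel_add_class add.commute)
  qed
qed (simp add: skel_shift_def)

text \<open>The skeleton elements outside the range of \<open>skel_pi\<close> are the classes of \<open>(\<gamma>, 0)\<close> with
  \<open>\<gamma> \<noteq> \<infinity>\<close>; they are the idempotents other than \<open>skel_zero\<close>.\<close>

lemma skel_idem_iff:
  assumes "val v \<ge> \<gamma>"
  shows "skel_add val (skel_class val \<gamma> v) (skel_class val \<gamma> v) = skel_class val \<gamma> v \<longleftrightarrow>
    val v > \<gamma> \<or> v = 0"
  using assms by (simp add: skel_add_class skel_class_eq_iff val_add_ge)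

lemma in_range_skel_pi_iff:
  assumes "s \<in> skel val"
  shows "s \<in> range (skel_pi val) \<longleftrightarrow> s = skel_zero val \<or> skel_add val s s \<noteq> s"
proof -
  obtain \<gamma> v where s: "val v \<ge> \<gamma>" "s = skel_class val \<gamma> v" using assms skel_iff by blast
  have eq: "s \<in> range (skel_pi val) \<longleftrightarrow> (\<exists>w. val w = \<gamma> \<and> (val (v - w) > \<gamma> \<or> v = w))"
    unfolding s(2) skel_pi_def using s(1) by (auto simp: skel_class_eq_iff image_iff)
  have z: "s = skel_zero val \<longleftrightarrow> \<gamma> = top"
    unfolding s(2) skel_zero_def using s(1)
    by (subst skel_class_eq_iff) (auto simp: val_eq_top_iff top_unique)
  show ?thesis
  proof (cases "val v = \<gamma>")
    case True
    then have "s \<in> range (skel_pi val)" using eq by blast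
    moreover have "s = skel_zero val \<or> skel_add val s s \<noteq> s"
    proof (cases "v = 0")
      case True
      then show ?thesis using z \<open>val v = \<gamma>\<close> by simp
    next
      case False
      then show ?thesis using skel_idem_iff[OF s(1)] \<open>val v = \<gamma>\<close> s(2) by simp
    qed
    ultimately show ?thesis by blast
  next
    case False
    then have gt: "val v > \<gamma>" using s(1) by simp
    have "\<not> val (v - w) > \<gamma>" if "val w = \<gamma>" for w
      using val_add_eq[of w v] val_add_eq[of "- w" v] gt that by (simp add: val_minus)
    moreover have "\<gamma> \<noteq> top" using gt top.extremum_strict by blast
    moreover have "v \<noteq> w" if "val w = \<gamma>" for w using gt that by auto
    ultimately have "s \<notin> range (skel_pi val)" "s \<noteq> skel_zero val" using eq z by blast+
    moreover have "skel_add val s s = s" using skel_idem_iff[OF s(1)] gt unfolding s(2) by blast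
    ultimately show ?thesis by blast
  qed
qed

text \<open>For \<open>s = \<pi>(x)\<close> and \<open>t = \<pi>(c)\<close> this expresses that
  adding \<open>x\<close> raises the value of \<open>c\<close>: cancellation makes the sum a class
  of some \<open>(\<gamma>, 0)\<close>, and such classes are recognized as idempotents. The
  condition on \<open>t\<close> excludes \<open>c = 0\<close>, whose value cannot rise.\<close>

definition skel_cancel :: "('g \<times> 'v) set \<Rightarrow> ('g \<times> 'v) set \<Rightarrow> bool" where
  "skel_cancel s t \<longleftrightarrow> skel_val s = skel_val t \<and> t \<noteq> skel_zero val \<and>
    skel_add val (skel_add val s t) (skel_add val s t) = skel_add val s t"

lemma skel_cancel_pi: "skel_cancel (skel_pi val x) (skel_pi val c) \<longleftrightarrow> val c < val (c + x)"
proof (cases "val x = val c")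
  case True
  have ge: "val c \<le> val (x + c)" using True by (intro val_add_ge) auto
  have add: "skel_add val (skel_pi val x) (skel_pi val c) = skel_class val (val c) (x + c)"
    using True by (simp add: skel_pi_def skel_add_class)
  have "val c < top" if "c \<noteq> 0"
    using that val_eq_top_iff top.not_eq_extremum by blast
  then have "val c < val (x + c) \<longleftrightarrow> c \<noteq> 0 \<and> (val c < val (x + c) \<or> x + c = 0)"
    by (cases "c = 0"; cases "x + c = 0") auto
  then show ?thesis
    unfolding skel_cancel_def add skel_idem_iff[OF ge] skel_val_pi skel_pi_eq_zero_iff using True
    by (simp add: add.commute)
next
  case False
  then consider "val x < val c" | "val c < val x" by force
  then have "\<not> val c < val (c + x)"
    using val_add_eq[of x c] val_add_eq[of c x] by cases (auto simp: add.commute)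
  then show ?thesis using False by (simp add: skel_cancel_def skel_val_pi)
qed

text \<open>Adjoining \<open>a\<close> adds at most one value. Scaling brings every vector outside
  the old span to the form \<open>a + y\<close>; if two of these have distinct values, their
  difference lies in the old span and has the smaller of the two values, which is therefore not
  new.\<close>

lemma finite_val_span:
  assumes "finite U"
  shows "finite (val ` span U)"
  using assms
proof induction
  case (insert a U)
  define D where "D = val ` {a + y | y. y \<in> span U} - val ` span U"
  have "m = m'" if m: "m \<in> D" "m' \<in> D" "m \<le> m'" for m m'
  proof (rule ccontr)
    assume "m \<noteq> m'"
    obtain y y' where y: "y \<in> span U" "m = val (a + y)" "y' \<in> span U" "m' = val (a + y')"
      using m unfolding D_def by auto
    have "val (a + y) < val (- (a + y'))"
      unfolding val_minus using y(2,4) m(3) \<open>m \<noteq> m'\<close> by simp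
    then have "val (- (a + y') + (a + y)) = m" unfolding y(2) by (rule val_add_eq)
    moreover have "- (a + y') + (a + y) = y - y'" by simp
    ultimately have "val (y - y') = m" by simp
    then have "m \<in> val ` span U" using span_diff[OF y(1,3)] by blast
    then show False using m(1) unfolding D_def by blast
  qed
  then have "m = m'" if "m \<in> D" "m' \<in> D" for m m' using that by (metis linear)
  then have "D \<subseteq> {m}" if "m \<in> D" for m using that by blast
  then have "finite D" using finite_subset[of D "{m}" for m] by (cases "D = {}") blast+
  have "val x \<in> val ` span U \<union> D" if "x \<in> span (insert a U)" for x
  proof -
    obtain k where k: "x - scale k a \<in> span U" using \<open>x \<in> _\<close> span_breakdown_eq by blast
    show ?thesis
    proof (cases "k = 0")
      case False
      have "val x = val (scale (inverse k) x)" using False by (simp add: val_scale)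
      also have "scale (inverse k) x = a + scale (inverse k) (x - scale k a)"
        using False by (simp add: scale_right_diff_distrib)
      finally show ?thesis using span_scale[OF k, of "inverse k"] unfolding D_def by auto
    qed (use k in auto)
  qed
  then have "val ` span (insert a U) \<subseteq> val ` span U \<union> D" by blast
  then show ?case using \<open>finite D\<close> insert.IH finite_subset by blast
qed simp

end

section \<open>Linear combinations and the setting common to both languages\<close>

definition lin_comb :: "('k \<Rightarrow> 'v \<Rightarrow> 'v) \<Rightarrow> sort var set \<Rightarrow> (sort var \<Rightarrow> 'k) \<Rightarrow>
    (sort var \<Rightarrow> ('k, 'v::ab_group_add, 'g) elem) \<Rightarrow> 'v" where
  "lin_comb scale J \<kappa> e = (\<Sum>u\<in>J. scale (\<kappa> u) (ofV (e u)))"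

lemma lin_comb_cong:
  "(\<And>u. u \<in> J \<Longrightarrow> \<kappa> u = \<kappa>' u) \<Longrightarrow> (\<And>u. u \<in> J \<Longrightarrow> e u = e' u) \<Longrightarrow> lin_comb scale J \<kappa> e = lin_comb scale J \<kappa>' e'"
  unfolding lin_comb_def by (intro sum.cong) auto

text \<open>Collects what the argument uses of the sublanguage, so that it runs once for both
  languages. \<open>Cf\<close> holds the coefficient functions of vector terms: constants over a
  fixed base field, integer polynomials in the field variables over a variable one. The quotients
  \<open>- F u / h\<close> need not belong to \<open>Cf\<close>; the last assumption supplies them
  as members of a family against which \<open>w\<close> has to compete.\<close>

locale valued_reduct = valued_vector_space scale val
  for scale :: "'k::field \<Rightarrow> 'v::ab_group_add \<Rightarrow> 'v" and val :: "'v \<Rightarrow> 'g::{linorder, order_top}" +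
  fixes L0 :: "(sort, 'f, rsym) lang"
    and M :: "(sort, 'f, rsym, ('k, 'v, 'g) elem) struct"
    and Cf :: "((sort var \<Rightarrow> ('k, 'v, 'g) elem) \<Rightarrow> 'k) set"
  assumes univ_M: "univ M = sort_carrier val"
    and sorts_L0: "VecS \<notin> sorts L0" "SkelS \<in> sorts L0"
    and Cf_zero: "(\<lambda>e. 0) \<in> Cf"
    and Cf_one: "(\<lambda>e. 1) \<in> Cf"
    and Cf_diff: "f \<in> Cf \<Longrightarrow> g \<in> Cf \<Longrightarrow> (\<lambda>e. f e - g e) \<in> Cf"
    and Cf_mult: "f \<in> Cf \<Longrightarrow> g \<in> Cf \<Longrightarrow> (\<lambda>e. f e * g e) \<in> Cf"
    and Cf_depends: "f \<in> Cf \<Longrightarrow> \<exists>S. finite S \<and> fst ` S \<subseteq> {FldS} \<and> depends_on f S"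
    and definable_coef_zero: "f \<in> Cf \<Longrightarrow> definable L0 M (\<lambda>e. f e = 0)"
    and definable_scale: "f \<in> Cf \<Longrightarrow> fst z = SkelS \<Longrightarrow> fst z' = SkelS \<Longrightarrow>
      definable L0 M (\<lambda>e. ofS (e z') = skel_scale scale val (f e) (ofS (e z)))"
    and definable_add: "fst z = SkelS \<Longrightarrow> fst x = SkelS \<Longrightarrow> fst y = SkelS \<Longrightarrow>
      definable L0 M (\<lambda>e. ofS (e z) = skel_add val (ofS (e x)) (ofS (e y)))"
    and definable_zero: "fst z = SkelS \<Longrightarrow> definable L0 M (\<lambda>e. ofS (e z) = skel_zero val)"
    and definable_less: "fst x = SkelS \<Longrightarrow> fst y = SkelS \<Longrightarrow>
      definable L0 M (\<lambda>e. skel_val (ofS (e x)) < skel_val (ofS (e y)))"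
    and coef_family_ex: "finite J \<Longrightarrow> (\<And>u. u \<in> J \<Longrightarrow> F u \<in> Cf) \<Longrightarrow> h \<in> Cf \<Longrightarrow>
      \<exists>T. T \<noteq> {} \<and> coef_family L0 M Cf T \<and>
        (\<forall>e\<in>envs M. h e \<noteq> 0 \<longrightarrow> (\<exists>\<kappa>\<in>T. \<forall>u\<in>J. \<kappa> u = - F u e / h e))"
begin

abbreviation lin :: "sort var set \<Rightarrow> (sort var \<Rightarrow> 'k) \<Rightarrow> (sort var \<Rightarrow> ('k, 'v, 'g) elem) \<Rightarrow> 'v"
  where "lin \<equiv> lin_comb scale"

lemma lin_mono: "finite J' \<Longrightarrow> J \<subseteq> J' \<Longrightarrow> lin J' (\<lambda>u. if u \<in> J then \<kappa> u else 0) e = lin J \<kappa> e"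
  unfolding lin_comb_def by (rule sum.mono_neutral_cong_right) auto

lemma lin_diff: "lin J (\<lambda>u. \<kappa> u - \<kappa>' u) e = lin J \<kappa> e - lin J \<kappa>' e"
  by (simp add: lin_comb_def scale_left_diff_distrib sum_subtractf)

lemma lin_add: "lin J (\<lambda>u. \<kappa> u + \<kappa>' u) e = lin J \<kappa> e + lin J \<kappa>' e"
  by (simp add: lin_comb_def scale_left_distrib sum.distrib)

lemma lin_scale: "lin J (\<lambda>u. k * \<kappa> u) e = scale k (lin J \<kappa> e)"
  by (simp add: lin_comb_def scale_sum_right)

lemma Cf_add: "f \<in> Cf \<Longrightarrow> g \<in> Cf \<Longrightarrow> (\<lambda>e. f e + g e) \<in> Cf"
  using Cf_diff[of f "\<lambda>e. 0 - g e"] Cf_diff[OF Cf_zero, of g] by simp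

lemma Cf_upd:
  assumes "f \<in> Cf" "fst x \<noteq> FldS"
  shows "f (e(x := a)) = f e"
proof -
  obtain S where S: "fst ` S \<subseteq> {FldS}" "depends_on f S" using Cf_depends[OF assms(1)] by blast
  show ?thesis
    by (rule depends_onD[OF S(2)]) (use S(1) assms(2) in auto)
qed

lemma coef_family_nonempty: "\<exists>T. T \<noteq> {} \<and> coef_family L0 M Cf T"
  using coef_family_ex[of "{}" "\<lambda>_ _. 0" "\<lambda>_. 0"] Cf_zero by auto

lemma univ_Vec: "univ M VecS = range InV"
  and univ_Skel: "univ M SkelS = InS ` skel val"
  by (simp_all add: univ_M)

lemma env_Skel: "e \<in> envs M \<Longrightarrow> fst z = SkelS \<Longrightarrow> \<exists>s\<in>skel val. e z = InS s"
  using envsD[of e M z] univ_Skel by auto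

lemma env_Vec: "e \<in> envs M \<Longrightarrow> fst v = VecS \<Longrightarrow> e v = InV (ofV (e v))"
  using envsD[of e M v] univ_Vec by auto

lemma definable_eq:
  assumes "fst x = SkelS" "fst y = SkelS"
  shows "definable L0 M (\<lambda>e. ofS (e x) = ofS (e y))"
proof (rule definableI[of _ "Eq (Var x) (Var y)"])
  show "wff L0 (Eq (Var x) (Var y))"
    using assms sorts_L0 by (cases x, cases y) (auto intro: has_sort.Var)
  show "sat M e (Eq (Var x) (Var y)) = (ofS (e x) = ofS (e y))" if "e \<in> envs M" for e
    using env_Skel[OF that assms(1)] env_Skel[OF that assms(2)] by auto
qed

lemma definable_shift:
  assumes "f \<in> Cf" "fst x = SkelS" "fst y = SkelS" "fst z = SkelS"
  shows "definable L0 M (\<lambda>e. ofS (e z) = skel_shift (f e) (ofS (e x)) (ofS (e y)))"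
proof -
  \<comment> \<open>The assumed definable relations take variables only, so the inner scaled class
    is named by a quantified \<open>w\<close>.\<close>
  obtain w :: "sort var" where w: "fst w = SkelS" "w \<notin> {x, y, z}"
    by (rule fresh_var[of "{x, y, z}" SkelS]) simp_all
  have 1: "definable L0 M (\<lambda>e. \<exists>a\<in>univ M (fst w). (\<lambda>e. ofS (e w) = skel_scale scale val (f e) (ofS (e y)) \<and>
      ofS (e z) = skel_add val (ofS (e x)) (ofS (e w))) (e(w := a)))"
    using w assms sorts_L0 by (intro definable_ex definable_conj definable_scale definable_add) auto
  have "definable L0 M (\<lambda>e. ofS (e z) = skel_add val (ofS (e x)) (skel_scale scale val (f e) (ofS (e y))))"
  proof (rule definable_cong[OF 1])
    fix e assume "e \<in> envs M"
    then have "ofS (e y) \<in> skel val" using env_Skel assms(3) by fastforce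
    then have "skel_scale scale val (f e) (ofS (e y)) \<in> skel val" by (rule skel_scale_in)
    then show "(\<exists>a\<in>univ M (fst w). (\<lambda>e. ofS (e w) = skel_scale scale val (f e) (ofS (e y)) \<and>
      ofS (e z) = skel_add val (ofS (e x)) (ofS (e w))) (e(w := a))) \<longleftrightarrow>
      ofS (e z) = skel_add val (ofS (e x)) (skel_scale scale val (f e) (ofS (e y)))"
      using w by (auto simp: univ_Skel Cf_upd[OF assms(1)])
  qed
  then have "definable L0 M (\<lambda>e.
    ((f e = 0 \<or> skel_val (ofS (e x)) < skel_val (ofS (e y))) \<and> ofS (e z) = ofS (e x)) \<or>
    (\<not> (f e = 0 \<or> skel_val (ofS (e x)) < skel_val (ofS (e y))) \<and>
      ((skel_val (ofS (e y)) < skel_val (ofS (e x)) \<and> ofS (e z) = skel_scale scale val (f e) (ofS (e y))) \<or>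
       (\<not> skel_val (ofS (e y)) < skel_val (ofS (e x)) \<and>
         ofS (e z) = skel_add val (ofS (e x)) (skel_scale scale val (f e) (ofS (e y)))))))"
    using assms
    by (intro definable_conj definable_disj definable_not definable_coef_zero definable_less
        definable_eq definable_scale)
  then show ?thesis by (rule definable_cong) (simp add: skel_shift_def)
qed

lemma definable_in_range:
  assumes "fst z = SkelS"
  shows "definable L0 M (\<lambda>e. ofS (e z) \<in> range (skel_pi val))"
proof (rule definable_cong[OF definable_disj[OF definable_zero definable_not[OF definable_add]]])
  fix e assume "e \<in> envs M"
  then have "ofS (e z) \<in> skel val" using env_Skel assms by fastforce
  then show "ofS (e z) = skel_zero val \<or> \<not> ofS (e z) = skel_add val (ofS (e z)) (ofS (e z)) \<longleftrightarrow>
    ofS (e z) \<in> range (skel_pi val)"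
    by (metis in_range_skel_pi_iff)
qed (use assms in auto)

lemma definable_cancel:
  assumes "fst x = SkelS" "fst y = SkelS"
  shows "definable L0 M (\<lambda>e. skel_cancel (ofS (e x)) (ofS (e y)))"
proof -
  obtain w :: "sort var" where w: "fst w = SkelS" "w \<notin> {x, y}"
    by (rule fresh_var[of "{x, y}" SkelS]) simp_all
  have "definable L0 M (\<lambda>e. (\<not> skel_val (ofS (e x)) < skel_val (ofS (e y)) \<and> \<not> skel_val (ofS (e y)) < skel_val (ofS (e x))) \<and>
    \<not> ofS (e y) = skel_zero val \<and>
    (\<exists>a\<in>univ M (fst w). (\<lambda>e. ofS (e w) = skel_add val (ofS (e x)) (ofS (e y)) \<and>
      ofS (e w) = skel_add val (ofS (e w)) (ofS (e w))) (e(w := a))))"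
    using w assms sorts_L0
    by (intro definable_conj definable_not definable_ex definable_add definable_zero definable_less) auto
  then show ?thesis
  proof (rule definable_cong)
    fix e assume "e \<in> envs M"
    then have "ofS (e x) \<in> skel val" "ofS (e y) \<in> skel val" using env_Skel assms by fastforce+
    then have "skel_add val (ofS (e x)) (ofS (e y)) \<in> skel val" by (rule skel_add_in)
    then have "(\<exists>a\<in>univ M (fst w). (\<lambda>e. ofS (e w) = skel_add val (ofS (e x)) (ofS (e y)) \<and>
      ofS (e w) = skel_add val (ofS (e w)) (ofS (e w))) (e(w := a))) \<longleftrightarrow>
      skel_add val (skel_add val (ofS (e x)) (ofS (e y))) (skel_add val (ofS (e x)) (ofS (e y))) =
        skel_add val (ofS (e x)) (ofS (e y))"
      using w by (auto simp: univ_Skel)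
    then show "((\<not> skel_val (ofS (e x)) < skel_val (ofS (e y)) \<and> \<not> skel_val (ofS (e y)) < skel_val (ofS (e x))) \<and>
    \<not> ofS (e y) = skel_zero val \<and>
    (\<exists>a\<in>univ M (fst w). (\<lambda>e. ofS (e w) = skel_add val (ofS (e x)) (ofS (e y)) \<and>
      ofS (e w) = skel_add val (ofS (e w)) (ofS (e w))) (e(w := a)))) \<longleftrightarrow>
    skel_cancel (ofS (e x)) (ofS (e y))" by (auto simp: skel_cancel_def)
  qed
qed

end

section \<open>Trading a vector for its image in the skeleton\<close>

context valued_reduct
begin

text \<open>
  \<open>red J P\<close>: up to equality on well-sorted assignments, \<open>P\<close> is built without vector quantifiers from
  relations of the skeleton and atoms \<open>z = \<pi>(t)\<close>, with \<open>t\<close> a linear combination of the variables in \<open>J\<close>.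
\<close>

inductive red :: "sort var set \<Rightarrow> ((sort var \<Rightarrow> ('k, 'v, 'g) elem) \<Rightarrow> bool) \<Rightarrow> bool" for J where
  definable: "definable L0 M P \<Longrightarrow> red J P"
| pi: "fst z = SkelS \<Longrightarrow> (\<And>u. u \<in> J \<Longrightarrow> f u \<in> Cf) \<Longrightarrow>
    red J (\<lambda>e. ofS (e z) = skel_pi val (lin J (\<lambda>u. f u e) e))"
| neg: "red J P \<Longrightarrow> red J (\<lambda>e. \<not> P e)"
| conj: "red J P \<Longrightarrow> red J Q \<Longrightarrow> red J (\<lambda>e. P e \<and> Q e)"
| ex: "fst x \<in> sorts L0 \<Longrightarrow> red J P \<Longrightarrow> red J (\<lambda>e. \<exists>a\<in>univ M (fst x). P (e(x := a)))"
| agree: "red J P \<Longrightarrow> (\<And>e. e \<in> envs M \<Longrightarrow> P e = Q e) \<Longrightarrow> red J Q"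

lemma red_mono:
  assumes "red J P" "J \<subseteq> J'" "finite J'"
  shows "red J' P"
  using assms(1)
proof induction
  case (pi z f)
  have "red J' (\<lambda>e. ofS (e z) = skel_pi val (lin J' (\<lambda>u. (if u \<in> J then f u else (\<lambda>e. 0)) e) e))"
    using pi Cf_zero by (intro red.pi) auto
  moreover have "lin J' (\<lambda>u. (if u \<in> J then f u else (\<lambda>e. 0)) e) e = lin J (\<lambda>u. f u e) e" for e
    using lin_mono[OF assms(3,2), of "\<lambda>u. f u e" e] by (simp add: if_distrib[of "\<lambda>f. f e"])
  ultimately show ?case by simp
next
  case (agree P Q)
  then show ?case by (blast intro: red.agree)
qed (auto intro: red.intros)

lemma red_disj: "red J P \<Longrightarrow> red J Q \<Longrightarrow> red J (\<lambda>e. P e \<or> Q e)"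
  using red.neg[OF red.conj[OF red.neg red.neg]] by simp

lemma red_const: "red J (\<lambda>e. c)"
proof -
  \<comment> \<open>A negated contradiction provides truth, as \<open>red\<close> has no
    constants.\<close>
  have *: "red J (\<lambda>e. \<not> (ofS (e (SkelS, 0)) = skel_zero val \<and> \<not> ofS (e (SkelS, 0)) = skel_zero val))"
    by (intro red.neg red.conj red.definable definable_zero) simp_all
  then have "red J (\<lambda>e. True)" by simp
  then show ?thesis using red.neg[OF \<open>red J (\<lambda>e. True)\<close>] by (cases c) simp_all
qed

lemma red_Bex:
  assumes "finite G" "\<And>g. g \<in> G \<Longrightarrow> red J (P g)"
  shows "red J (\<lambda>e. \<exists>g\<in>G. P g e)"
  using assms
proof (induction G rule: finite_induct)
  case (insert g G)
  then show ?case using red_disj[of J "P g" "\<lambda>e. \<exists>g\<in>G. P g e"] by simp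
qed (simp add: red_const)

lemma red_Ball:
  assumes "finite G" "\<And>g. g \<in> G \<Longrightarrow> red J (P g)"
  shows "red J (\<lambda>e. \<forall>g\<in>G. P g e)"
  using red.neg[OF red_Bex[OF assms(1), of J "\<lambda>g e. \<not> P g e"]] assms(2) red.neg by simp

text \<open>A block of existential quantifiers: the part of \<open>d\<close> on \<open>S\<close>
  supplies the witnesses.\<close>

lemma red_ex_comb:
  assumes "finite S" "fst ` S \<subseteq> sorts L0" "red J P"
  shows "red J (\<lambda>e. \<exists>d\<in>envs M. P (comb S d e))"
  using assms(1,2)
proof (induction S rule: finite_induct)
  case empty
  have "red J P" by (rule assms(3))
  then show ?case
    by (rule red.agree) (auto simp: comb_def)
next
  case (insert x S)
  have "red J (\<lambda>e. \<exists>a\<in>univ M (fst x). (\<lambda>e. \<exists>d\<in>envs M. P (comb S d e)) (e(x := a)))"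
    using insert by (intro red.ex) auto
  then show ?case
  proof (rule red.agree)
    fix e assume "e \<in> envs M"
    have 1: "comb S d (e(x := a)) = comb (Set.insert x S) (d(x := a)) e" for d a
      using insert.hyps(2) by (auto simp: comb_def fun_eq_iff)
    have 2: "comb (Set.insert x S) d e = comb S d (e(x := d x))" for d
      using insert.hyps(2) by (auto simp: comb_def fun_eq_iff)
    show "(\<exists>a\<in>univ M (fst x). (\<lambda>e. \<exists>d\<in>envs M. P (comb S d e)) (e(x := a))) \<longleftrightarrow>
      (\<exists>d\<in>envs M. P (comb (Set.insert x S) d e))"
      using upd_envs envsD by (metis 1 2)
  qed
qed

text \<open>Without vectors the only linear combination is 0, so an atom says that \<open>z\<close>
  is the zero class. This is where the removal of vectors ends.\<close>

lemma red_empty: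
  assumes "red {} P"
  shows "definable L0 M P"
  using assms
proof induction
  case (pi z f)
  then show ?case
    using definable_zero[of z] skel_pi_eq_zero_iff[of 0] by (simp add: lin_comb_def)
next
  case (agree P Q)
  then show ?case by (blast intro: definable_cong)
qed (auto intro: definable_not definable_conj definable_ex)

text \<open>Weaker than \<open>depends_on\<close>, since \<open>red\<close> determines a predicate
  on well-sorted assignments only.\<close>

definition envs_depends :: "((sort var \<Rightarrow> ('k, 'v, 'g) elem) \<Rightarrow> bool) \<Rightarrow> sort var set \<Rightarrow> bool" where
  "envs_depends P S \<longleftrightarrow> (\<forall>e\<in>envs M. \<forall>e'\<in>envs M. (\<forall>x\<in>S. e x = e' x) \<longrightarrow> P e = P e')"

lemma envs_dependsD:
  "envs_depends P S \<Longrightarrow> e \<in> envs M \<Longrightarrow> e' \<in> envs M \<Longrightarrow> (\<And>x. x \<in> S \<Longrightarrow> e x = e' x) \<Longrightarrow> P e = P e'"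
  unfolding envs_depends_def by blast

lemma definable_depends:
  assumes "definable L0 M P"
  shows "\<exists>S. finite S \<and> VecS \<notin> fst ` S \<and> envs_depends P S"
proof -
  obtain \<psi> where \<psi>: "wff L0 \<psi>" "\<forall>e\<in>envs M. sat M e \<psi> = P e"
    using assms unfolding definable_def by blast
  have "envs_depends P (free_vars \<psi>)"
    unfolding envs_depends_def using \<psi>(2) depends_on_sat[of M \<psi>] unfolding depends_on_def by blast
  moreover have "VecS \<notin> fst ` free_vars \<psi>" using wff_free_vars[OF \<psi>(1)] sorts_L0(1) by blast
  ultimately show ?thesis using finite_free_vars by blast
qed

lemma red_depends:
  assumes "red J P" "finite J"
  shows "\<exists>S. finite S \<and> VecS \<notin> fst ` S \<and> envs_depends P (S \<union> J)"
  using assms(1)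
proof induction
  case (definable P)
  obtain S where S: "finite S" "VecS \<notin> fst ` S" "envs_depends P S"
    using definable_depends[OF definable] by blast
  have "envs_depends P (S \<union> J)" using S(3) unfolding envs_depends_def by blast
  then show ?case using S(1,2) by blast
next
  case (pi z f)
  define S where "S u = (SOME S. finite S \<and> fst ` S \<subseteq> {FldS} \<and> depends_on (f u) S)" for u
  have S: "finite (S u)" "fst ` S u \<subseteq> {FldS}" "depends_on (f u) (S u)" if "u \<in> J" for u
    using someI_ex[OF Cf_depends[OF pi.hyps(2)[OF that]]] unfolding S_def by blast+
  let ?S = "insert z (\<Union>u\<in>J. S u)"
  have "lin J (\<lambda>u. f u e) e = lin J (\<lambda>u. f u e') e'" if eq: "\<forall>x\<in>?S \<union> J. e x = e' x" for e e'
  proof (rule lin_comb_cong)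
    fix u assume u: "u \<in> J"
    show "f u e = f u e'"
      by (rule depends_onD[OF S(3)[OF u]]) (use eq u in auto)
  qed (use eq in auto)
  then have "envs_depends (\<lambda>e. ofS (e z) = skel_pi val (lin J (\<lambda>u. f u e) e)) (?S \<union> J)"
    unfolding envs_depends_def by (metis UnI1 insertI1)
  moreover have "finite ?S" using assms(2) S(1) by simp
  moreover have "VecS \<notin> fst ` ?S" using S(2) pi.hyps(1) by fastforce
  ultimately show ?case by blast
next
  case (conj P Q)
  then obtain S S' where S: "finite S" "VecS \<notin> fst ` S" "finite S'" "VecS \<notin> fst ` S'"
    "envs_depends P (S \<union> J)" "envs_depends Q (S' \<union> J)" by blast
  have "envs_depends (\<lambda>e. P e \<and> Q e) (S \<union> S' \<union> J)"
    unfolding envs_depends_def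
  proof (intro ballI impI)
    fix e e' assume e: "e \<in> envs M" "e' \<in> envs M" "\<forall>x\<in>S \<union> S' \<union> J. e x = e' x"
    have "P e = P e'" by (rule envs_dependsD[OF S(5) e(1,2)]) (use e(3) in auto)
    moreover have "Q e = Q e'" by (rule envs_dependsD[OF S(6) e(1,2)]) (use e(3) in auto)
    ultimately show "(P e \<and> Q e) = (P e' \<and> Q e')" by simp
  qed
  moreover have "VecS \<notin> fst ` (S \<union> S')" using S(2,4) by (auto simp: image_Un)
  ultimately show ?case using S(1,3) by blast
next
  case (ex x P)
  then obtain S where S: "finite S" "VecS \<notin> fst ` S" "envs_depends P (S \<union> J)" by blast
  have "envs_depends (\<lambda>e. \<exists>a\<in>univ M (fst x). P (e(x := a))) (S \<union> J)"
    unfolding envs_depends_def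
  proof (intro ballI impI bex_cong refl)
    fix e e' a assume e: "e \<in> envs M" "e' \<in> envs M" "\<forall>x\<in>S \<union> J. e x = e' x" "a \<in> univ M (fst x)"
    show "P (e(x := a)) = P (e'(x := a))"
      by (rule envs_dependsD[OF S(3) upd_envs[OF e(1,4)] upd_envs[OF e(2,4)]]) (use e(3) in auto)
  qed
  then show ?case using S(1,2) by blast
next
  case (agree P Q)
  then obtain S where S: "finite S" "VecS \<notin> fst ` S" "envs_depends P (S \<union> J)" by blast
  then have "envs_depends Q (S \<union> J)" using agree.hyps unfolding envs_depends_def by metis
  then show ?case using S(1,2) by blast
next
  case (neg P)
  then show ?case unfolding envs_depends_def by simp
qed

text \<open>
  The substitution \<open>v = c + w\<close>, where \<open>w\<close> is the linear combination of \<open>J'\<close> with coefficients \<open>g\<close> and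
  \<open>val c\<close> is at least the valuation of \<open>v\<close> minus any of the linear combinations given by \<open>T\<close>.  The
  predicate \<open>P'\<close> depends on \<open>c\<close> only through its image in the skeleton, the value of \<open>z\<close>.  Variables in
  \<open>Z\<close> occur bound in \<open>P\<close>, so \<open>z\<close> and the parameters of \<open>g\<close> have to avoid them.
\<close>

definition shift_eq where
  "shift_eq J v T J' g z P P' \<longleftrightarrow> (\<forall>e\<in>envs M. \<forall>c. ofS (e z) = skel_pi val c \<longrightarrow>
    (\<forall>\<kappa>\<in>T. val (c + lin J' (\<lambda>u. g u e) e - lin (J - {v}) \<kappa> e) \<le> val c) \<longrightarrow>
    P (e(v := InV (c + lin J' (\<lambda>u. g u e) e))) = P' e)"

lemma shift_eqD:
  "shift_eq J v T J' g z P P' \<Longrightarrow> e \<in> envs M \<Longrightarrow> ofS (e z) = skel_pi val c \<Longrightarrow>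
    (\<And>\<kappa>. \<kappa> \<in> T \<Longrightarrow> val (c + lin J' (\<lambda>u. g u e) e - lin (J - {v}) \<kappa> e) \<le> val c) \<Longrightarrow>
    P (e(v := InV (c + lin J' (\<lambda>u. g u e) e))) = P' e"
  unfolding shift_eq_def by blast

text \<open>The variables \<open>J'\<close> of which \<open>w\<close> is a combination are left
  open: quantifier elimination takes \<open>J - {v}\<close>, whereas counting with a vector
  parameter replaces some of these variables by copies.\<close>

definition shift_ok where
  "shift_ok J v T Z P \<longleftrightarrow> (\<forall>J' g S z. finite J' \<longrightarrow> fst ` J' \<subseteq> {VecS} \<longrightarrow> v \<notin> J' \<longrightarrow>
    fst z = SkelS \<longrightarrow> z \<notin> Z \<longrightarrow> S \<inter> Z = {} \<longrightarrow> (\<forall>u. g u \<in> Cf \<and> depends_on (g u) S) \<longrightarrow>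
    (\<exists>P'. red ((J - {v}) \<union> J') P' \<and> shift_eq J v T J' g z P P'))"

lemma shift_okD:
  assumes "shift_ok J v T Z P" "finite J'" "fst ` J' \<subseteq> {VecS}" "v \<notin> J'"
    "fst z = SkelS" "z \<notin> Z" "S \<inter> Z = {}" "\<forall>u. g u \<in> Cf \<and> depends_on (g u) S"
  shows "\<exists>P'. red ((J - {v}) \<union> J') P' \<and> shift_eq J v T J' g z P P'"
  using assms unfolding shift_ok_def by simp

text \<open>A larger \<open>T\<close> asks more of \<open>c\<close>, and a larger \<open>Z\<close>
  leaves fewer choices of \<open>z\<close> and \<open>S\<close>. Two predicates can thus be brought
  to the same \<open>T\<close> and \<open>Z\<close>.\<close>

lemma shift_ok_mono:
  assumes "shift_ok J v T Z P" "T \<subseteq> T'" "Z \<subseteq> Z'"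
  shows "shift_ok J v T' Z' P"
  unfolding shift_ok_def
proof (intro allI impI)
  fix J' S :: "sort var set" and z :: "sort var" and g :: "sort var \<Rightarrow> (sort var \<Rightarrow> ('k, 'v, 'g) elem) \<Rightarrow> 'k"
  assume a: "finite J'" "fst ` J' \<subseteq> {VecS}" "v \<notin> J'" "fst z = SkelS" "z \<notin> Z'" "S \<inter> Z' = {}"
    "\<forall>u. g u \<in> Cf \<and> depends_on (g u) S"
  have "z \<notin> Z" "S \<inter> Z = {}" using a(5,6) assms(3) by auto
  then obtain P' where P': "red ((J - {v}) \<union> J') P'" "shift_eq J v T J' g z P P'"
    using shift_okD[OF assms(1) a(1-4) _ _ a(7)] by blast
  have "shift_eq J v T' J' g z P P'"
    using P'(2) assms(2) unfolding shift_eq_def by (meson subsetD)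
  then show "\<exists>P'. red ((J - {v}) \<union> J') P' \<and> shift_eq J v T' J' g z P P'"
    using P'(1) by blast
qed

lemma lin_upd: "x \<notin> J \<Longrightarrow> lin J \<kappa> (e(x := a)) = lin J \<kappa> e"
  by (rule lin_comb_cong) auto

text \<open>After the substitution the argument of \<open>\<pi>\<close> is \<open>f_v c + x\<close>,
  where \<open>x\<close> collects the terms without \<open>c\<close>. If
  \<open>f_v \<noteq> 0\<close>, it is also \<open>f_v\<close> times the difference of
  \<open>v\<close> and the combination with coefficients \<open>- f_u / f_v\<close>. As
  \<open>T\<close> contains these quotients, its value is at most \<open>val c\<close>, which is
  exactly the hypothesis of \<open>skel_pi_shift\<close>.\<close>

lemma red_shift_pi:
  assumes J: "finite J" "v \<in> J" "fst ` J \<subseteq> {VecS}"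
    and f: "fst z0 = SkelS" "\<And>u. u \<in> J \<Longrightarrow> f u \<in> Cf"
  shows "\<exists>T Z. T \<noteq> {} \<and> coef_family L0 M Cf T \<and> finite Z \<and>
    shift_ok J v T Z (\<lambda>e. ofS (e z0) = skel_pi val (lin J (\<lambda>u. f u e) e))"
proof -
  let ?J = "J - {v}"
  obtain T where T: "T \<noteq> {}" "coef_family L0 M Cf T"
    "\<forall>e\<in>envs M. f v e \<noteq> 0 \<longrightarrow> (\<exists>\<kappa>\<in>T. \<forall>u\<in>?J. \<kappa> u = - f u e / f v e)"
    using coef_family_ex[of ?J f "f v"] J f(2) by blast
  have "shift_ok J v T {} (\<lambda>e. ofS (e z0) = skel_pi val (lin J (\<lambda>u. f u e) e))"
    unfolding shift_ok_def
  proof (intro allI impI)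
    fix J' S :: "sort var set" and z :: "sort var" and g :: "sort var \<Rightarrow> (sort var \<Rightarrow> ('k, 'v, 'g) elem) \<Rightarrow> 'k"
    assume J': "finite J'" "fst ` J' \<subseteq> {VecS}" "v \<notin> J'"
      and z: "fst z = SkelS"
      and g: "\<forall>u. g u \<in> Cf \<and> depends_on (g u) S"
    let ?K = "?J \<union> J'"
    \<comment> \<open>The coefficients of \<open>x\<close>: those of the old term on
      \<open>J - {v}\<close> plus those of \<open>f_v w\<close> on \<open>J'\<close>; the two sets
      may overlap.\<close>
    define h where "h u = (\<lambda>e. (if u \<in> ?J then f u else (\<lambda>e. 0)) e +
      f v e * (if u \<in> J' then g u else (\<lambda>e. 0)) e)" for u
    have h: "h u \<in> Cf" for u
      unfolding h_def using J(2) f(2) g Cf_zero by (intro Cf_add Cf_mult) auto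
    obtain z1 :: "sort var" where z1: "fst z1 = SkelS" "z1 \<notin> {z, z0}"
      by (rule fresh_var[of "{z, z0}" SkelS]) simp_all
    then have z1': "z \<noteq> z1" "z0 \<noteq> z1" by auto
    have z1K: "z1 \<notin> ?K" using J J'(2) z1(1) by auto
    have h_upd: "h u (e(z1 := a)) = h u e" for u e a
      using h z1(1) by (intro Cf_upd) auto
    have fv_upd: "f v (e(z1 := a)) = f v e" for e a
      using f(2) J(2) z1(1) by (intro Cf_upd) auto
    have lin_h: "lin ?K (\<lambda>u. h u e) e = lin ?J (\<lambda>u. f u e) e + scale (f v e) (lin J' (\<lambda>u. g u e) e)" for e
    proof -
      have "lin ?K (\<lambda>u. h u e) e = lin ?K (\<lambda>u. if u \<in> ?J then f u e else 0) e +
        scale (f v e) (lin ?K (\<lambda>u. if u \<in> J' then g u e else 0) e)"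
        unfolding h_def lin_add lin_scale by (simp only: if_distrib[of "\<lambda>f. f e"])
      also have "lin ?K (\<lambda>u. if u \<in> ?J then f u e else 0) e = lin ?J (\<lambda>u. f u e) e"
        using J(1) J'(1) by (intro lin_mono) auto
      also have "lin ?K (\<lambda>u. if u \<in> J' then g u e else 0) e = lin J' (\<lambda>u. g u e) e"
        using J(1) J'(1) by (intro lin_mono) auto
      finally show ?thesis .
    qed
    \<comment> \<open>Here \<open>z1\<close> names \<open>\<pi>(x)\<close>, so that the atom becomes
      a skeleton relation between \<open>z0\<close>, \<open>z1\<close> and \<open>z\<close>.\<close>
    define P' where "P' = (\<lambda>e. \<exists>a\<in>univ M (fst z1). (\<lambda>e. ofS (e z1) = skel_pi val (lin ?K (\<lambda>u. h u e) e) \<and>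
      ofS (e z0) = skel_shift (f v e) (ofS (e z1)) (ofS (e z))) (e(z1 := a)))"
    have red: "red ?K P'"
      unfolding P'_def using z1(1) z f J(2) h sorts_L0(2)
      by (intro red.ex red.conj red.pi red.definable definable_shift) auto
    have "(ofS ((e(v := InV (c + w))) z0) = skel_pi val (lin J (\<lambda>u. f u (e(v := InV (c + w)))) (e(v := InV (c + w))))) = P' e"
      if e: "e \<in> envs M" "ofS (e z) = skel_pi val c"
        and le: "\<forall>\<kappa>\<in>T. val (c + w - lin ?J \<kappa> e) \<le> val c"
        and w: "w = lin J' (\<lambda>u. g u e) e" for e c w
    proof -
      let ?x = "lin ?K (\<lambda>u. h u e) e"
      have "P' e \<longleftrightarrow> (\<exists>a\<in>univ M (fst z1). ofS a = skel_pi val ?x \<and> ofS (e z0) = skel_shift (f v e) (ofS a) (ofS (e z)))"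
        unfolding P'_def using z1' by (simp add: lin_upd[OF z1K] h_upd fv_upd)
      also have "\<dots> \<longleftrightarrow> ofS (e z0) = skel_shift (f v e) (skel_pi val ?x) (skel_pi val c)"
        using z1(1) skel_pi_in by (auto simp: univ_Skel e(2))
      also have "skel_shift (f v e) (skel_pi val ?x) (skel_pi val c) = skel_pi val (scale (f v e) c + ?x)"
      proof (rule skel_pi_shift[symmetric], cases "f v e = 0")
        case fv: False
        obtain \<kappa> where \<kappa>: "\<kappa> \<in> T" "\<forall>u\<in>?J. \<kappa> u = - f u e / f v e" using T(3) e(1) fv by blast
        have "lin ?J \<kappa> e = lin ?J (\<lambda>u. (- inverse (f v e)) * f u e) e"
          using \<kappa>(2) by (intro lin_comb_cong) (simp_all add: divide_inverse mult.commute)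
        also have "\<dots> = scale (- inverse (f v e)) (lin ?J (\<lambda>u. f u e) e)" by (rule lin_scale)
        finally have "scale (f v e) c + ?x = scale (f v e) (c + w - lin ?J \<kappa> e)"
          unfolding lin_h w using fv
          by (simp add: scale_right_distrib scale_right_diff_distrib)
        then show "f v e = 0 \<or> val (scale (f v e) c + ?x) \<le> val c"
          using le \<kappa>(1) fv by (simp add: val_scale)
      qed simp
      also have "scale (f v e) c + ?x = lin J (\<lambda>u. f u (e(v := InV (c + w)))) (e(v := InV (c + w)))"
      proof -
        have "f u (e(v := InV (c + w))) = f u e" if "u \<in> J" for u
          using J that f(2) by (intro Cf_upd) auto
        then have "lin J (\<lambda>u. f u (e(v := InV (c + w)))) (e(v := InV (c + w))) = lin J (\<lambda>u. f u e) (e(v := InV (c + w)))"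
          by (intro lin_comb_cong) auto
        also have "\<dots> = scale (f v e) (c + w) + lin ?J (\<lambda>u. f u e) (e(v := InV (c + w)))"
          unfolding lin_comb_def using J(1,2) by (subst sum.remove[of J v]) auto
        also have "lin ?J (\<lambda>u. f u e) (e(v := InV (c + w))) = lin ?J (\<lambda>u. f u e) e"
          by (rule lin_upd) simp
        finally show ?thesis
          by (simp only: lin_h w scale_right_distrib add.assoc add.commute add.left_commute)
      qed
      finally show ?thesis using J(2,3) f(1) by auto
    qed
    then have "shift_eq J v T J' g z (\<lambda>e. ofS (e z0) = skel_pi val (lin J (\<lambda>u. f u e) e)) P'"
      unfolding shift_eq_def by blast
    then show "\<exists>P'. red (?J \<union> J') P' \<and>
      shift_eq J v T J' g z (\<lambda>e. ofS (e z0) = skel_pi val (lin J (\<lambda>u. f u e) e)) P'"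
      using red by blast
  qed
  then show ?thesis using T(1,2) by blast
qed

text \<open>Only atoms put a condition on \<open>T\<close>. Conjunctions merge two families, and a
  quantified variable joins \<open>Z\<close> so that changing it affects neither \<open>z\<close>
  nor the coefficients of \<open>w\<close>.\<close>

lemma red_shift:
  assumes "red J P" and J: "finite J" "v \<in> J" "fst ` J \<subseteq> {VecS}"
  shows "\<exists>T Z. T \<noteq> {} \<and> coef_family L0 M Cf T \<and> finite Z \<and> shift_ok J v T Z P"
  using assms(1)
proof induction
  case (definable P)
  obtain T where T: "T \<noteq> {}" "coef_family L0 M Cf T" using coef_family_nonempty by blast
  obtain S where S: "VecS \<notin> fst ` S" "envs_depends P S"
    using definable_depends[OF definable] by blast
  have v: "fst v = VecS" using J by auto
  then have v: "fst v = VecS" "v \<notin> S" using S(1) by (metis imageI)+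
  have "P (e(v := InV x)) = P e" if "e \<in> envs M" for e x
    using v that by (intro envs_dependsD[OF S(2)] upd_envs) (auto simp: univ_Vec)
  then have "shift_eq J v T J' g z P P" for J' g z
    unfolding shift_eq_def by simp
  then have "shift_ok J v T {} P"
    unfolding shift_ok_def using red.definable[OF definable] by blast
  then show ?case using T by blast
next
  case (pi z f)
  then show ?case using red_shift_pi[OF J] by blast
next
  case (neg P)
  then obtain T Z where TZ: "T \<noteq> {}" "coef_family L0 M Cf T" "finite Z" "shift_ok J v T Z P" by blast
  have "shift_eq J v T J' g z (\<lambda>e. \<not> P e) (\<lambda>e. \<not> P' e)" if "shift_eq J v T J' g z P P'" for J' g z P'
    using that unfolding shift_eq_def by simp
  then have "shift_ok J v T Z (\<lambda>e. \<not> P e)"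
    using TZ(4) red.neg unfolding shift_ok_def by meson
  then show ?case using TZ by blast
next
  case (conj P Q)
  obtain T Z where TZ: "T \<noteq> {}" "coef_family L0 M Cf T" "finite Z" "shift_ok J v T Z P"
    using conj.IH(1) by blast
  obtain T' Z' where TZ': "coef_family L0 M Cf T'" "finite Z'" "shift_ok J v T' Z' Q"
    using conj.IH(2) by blast
  have P: "shift_ok J v (T \<union> T') (Z \<union> Z') P" and Q: "shift_ok J v (T \<union> T') (Z \<union> Z') Q"
    using shift_ok_mono[OF TZ(4)] shift_ok_mono[OF TZ'(3)] by auto
  have "shift_eq J v (T \<union> T') J' g z (\<lambda>e. P e \<and> Q e) (\<lambda>e. P' e \<and> Q' e)"
    if "shift_eq J v (T \<union> T') J' g z P P'" "shift_eq J v (T \<union> T') J' g z Q Q'" for J' g z P' Q'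
    using that unfolding shift_eq_def by simp
  note eq = this
  have "shift_ok J v (T \<union> T') (Z \<union> Z') (\<lambda>e. P e \<and> Q e)"
    unfolding shift_ok_def
  proof (intro allI impI)
    fix J' S :: "sort var set" and z :: "sort var" and g :: "sort var \<Rightarrow> (sort var \<Rightarrow> ('k, 'v, 'g) elem) \<Rightarrow> 'k"
    assume a: "finite J'" "fst ` J' \<subseteq> {VecS}" "v \<notin> J'" "fst z = SkelS" "z \<notin> Z \<union> Z'"
      "S \<inter> (Z \<union> Z') = {}" "\<forall>u. g u \<in> Cf \<and> depends_on (g u) S"
    obtain P' where "red ((J - {v}) \<union> J') P'" "shift_eq J v (T \<union> T') J' g z P P'"
      using shift_okD[OF P a] by blast
    moreover obtain Q' where "red ((J - {v}) \<union> J') Q'" "shift_eq J v (T \<union> T') J' g z Q Q'"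
      using shift_okD[OF Q a] by blast
    ultimately show "\<exists>P'. red ((J - {v}) \<union> J') P' \<and> shift_eq J v (T \<union> T') J' g z (\<lambda>e. P e \<and> Q e) P'"
      using eq red.conj by blast
  qed
  moreover have "T \<union> T' \<noteq> {}" "finite (Z \<union> Z')" "coef_family L0 M Cf (T \<union> T')"
    using TZ(1,3) TZ'(2) coef_family_Un[OF TZ(2) TZ'(1)] by auto
  ultimately show ?case by blast
next
  case (ex x P)
  then obtain T Z where TZ: "T \<noteq> {}" "coef_family L0 M Cf T" "finite Z" "shift_ok J v T Z P" by blast
  have xV: "fst x \<noteq> VecS" using ex.hyps sorts_L0(1) by auto
  let ?Q = "\<lambda>P e. \<exists>a\<in>univ M (fst x). P (e(x := a))"
  have "shift_ok J v T (insert x Z) (?Q P)"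
    unfolding shift_ok_def
  proof (intro allI impI)
    fix J' S :: "sort var set" and z :: "sort var" and g :: "sort var \<Rightarrow> (sort var \<Rightarrow> ('k, 'v, 'g) elem) \<Rightarrow> 'k"
    assume a: "finite J'" "fst ` J' \<subseteq> {VecS}" "v \<notin> J'" "fst z = SkelS" "z \<notin> insert x Z" "S \<inter> insert x Z = {}"
      "\<forall>u. g u \<in> Cf \<and> depends_on (g u) S"
    have "z \<notin> Z" "S \<inter> Z = {}" "x \<notin> S" using a(5,6) by auto
    then obtain P' where P': "red ((J - {v}) \<union> J') P'" "shift_eq J v T J' g z P P'"
      using shift_okD[OF TZ(4) a(1-4) _ _ a(7)] by blast
    have g_upd: "g u (e(x := a)) = g u e" for u e a
      by (rule depends_onD[of "g u" S]) (use a(7) \<open>x \<notin> S\<close> in auto)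
    have notin: "x \<notin> J'" "x \<notin> J - {v}" "x \<noteq> v" using xV a(2) J by auto
    have "shift_eq J v T J' g z (?Q P) (?Q P')"
      unfolding shift_eq_def
    proof (intro ballI allI impI)
      fix e c assume h: "e \<in> envs M" "ofS (e z) = skel_pi val c"
        "\<forall>\<kappa>\<in>T. val (c + lin J' (\<lambda>u. g u e) e - lin (J - {v}) \<kappa> e) \<le> val c"
      have "P ((e(v := InV (c + lin J' (\<lambda>u. g u e) e)))(x := b)) = P' (e(x := b))"
        if b: "b \<in> univ M (fst x)" for b
      proof -
        have "P ((e(x := b))(v := InV (c + lin J' (\<lambda>u. g u (e(x := b))) (e(x := b))))) = P' (e(x := b))"
        proof (rule shift_eqD[OF P'(2)])
          show "ofS ((e(x := b)) z) = skel_pi val c" using h(2) a(5) by simp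
        qed (use h(1,3) b upd_envs in \<open>simp_all add: g_upd lin_upd[OF notin(1)] lin_upd[OF notin(2)]\<close>)
        then show ?thesis
          using notin(3) by (simp add: g_upd lin_upd[OF notin(1)] fun_upd_twist)
      qed
      then show "?Q P (e(v := InV (c + lin J' (\<lambda>u. g u e) e))) = ?Q P' e" by auto
    qed
    then show "\<exists>P'. red ((J - {v}) \<union> J') P' \<and> shift_eq J v T J' g z (?Q P) P'"
      using red.ex[OF ex.hyps(1) P'(1)] by blast
  qed
  then show ?case using TZ by blast
next
  case (agree P Q)
  then obtain T Z where TZ: "T \<noteq> {}" "coef_family L0 M Cf T" "finite Z" "shift_ok J v T Z P" by blast
  have "fst v = VecS" using J by auto
  then have "P (e(v := InV x)) = Q (e(v := InV x))" if "e \<in> envs M" for e x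
    using that by (intro agree.hyps upd_envs) (simp_all add: univ_Vec)
  then have "shift_eq J v T J' g z Q P'" if "shift_eq J v T J' g z P P'" for J' g z P'
    using that unfolding shift_eq_def by simp
  then have "shift_ok J v T Z Q"
    using TZ(4) unfolding shift_ok_def by meson
  then show ?case using TZ by blast
qed

end

section \<open>Elimination of vector quantifiers\<close>

lemma sort_disjoint: "fst ` J \<subseteq> {s} \<Longrightarrow> fst ` S \<subseteq> {t} \<Longrightarrow> s \<noteq> t \<Longrightarrow> J \<inter> S = {}"
  by (metis (no_types, opaque_lifting) disjoint_iff image_eqI singletonD subsetD)

context valued_reduct
begin

lemma finite_val_lin:
  assumes "finite J"
  shows "finite (range (\<lambda>\<kappa>. val (x - lin J \<kappa> e)))"
proof -
  let ?U = "insert x ((\<lambda>u. ofV (e u)) ` J)"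
  have "lin J \<kappa> e \<in> span ?U" for \<kappa>
    unfolding lin_comb_def by (intro span_sum span_scale span_base) auto
  then have "x - lin J \<kappa> e \<in> span ?U" for \<kappa>
    by (intro span_diff) (auto intro: span_base)
  then have "range (\<lambda>\<kappa>. val (x - lin J \<kappa> e)) \<subseteq> val ` span ?U" by blast
  then show ?thesis using finite_val_span[of ?U] assms finite_subset by blast
qed

text \<open>\<open>T\<close> may be infinite, but only finitely many values occur. Maximizing over
  \<open>A\<close> as well yields one combination that beats the competitors of all members of
  \<open>A\<close> simultaneously.\<close>

lemma ex_max_val:
  assumes "finite J" "finite A" "A \<noteq> {}" "T \<noteq> {}"
  shows "\<exists>a\<in>A. \<exists>\<kappa>\<in>T. \<forall>a'\<in>A. \<forall>\<kappa>'\<in>T. val (x - lin J \<kappa>' (h a')) \<le> val (x - lin J \<kappa> (h a))"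
proof -
  let ?D = "\<Union>a\<in>A. (\<lambda>\<kappa>. val (x - lin J \<kappa> (h a))) ` T"
  have "finite ((\<lambda>\<kappa>. val (x - lin J \<kappa> (h a))) ` T)" for a
    by (rule finite_subset[OF _ finite_val_lin[OF assms(1)]]) blast
  then have D: "finite ?D" "?D \<noteq> {}" using assms by auto
  then obtain a \<kappa> where "a \<in> A" "\<kappa> \<in> T" "Max ?D = val (x - lin J \<kappa> (h a))"
    using Max_in[OF D] by auto
  moreover have "val (x - lin J \<kappa>' (h a')) \<le> Max ?D" if "a' \<in> A" "\<kappa>' \<in> T" for a' \<kappa>'
    using that by (intro Max_ge[OF D(1)]) blast
  ultimately show ?thesis by metis
qed

lemma red_cancel:
  assumes "finite J" "fst ` J \<subseteq> {VecS}" "fst z = SkelS" "\<And>u. u \<in> J \<Longrightarrow> f u \<in> Cf"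
  shows "red J (\<lambda>e. skel_cancel (skel_pi val (lin J (\<lambda>u. f u e) e)) (ofS (e z)))"
proof -
  obtain w :: "sort var" where w: "fst w = SkelS" "w \<notin> {z}"
    by (rule fresh_var[of "{z}" SkelS]) simp_all
  have "w \<notin> J" using w(1) assms(2) by auto
  have "red J (\<lambda>e. \<exists>a\<in>univ M (fst w). (\<lambda>e. ofS (e w) = skel_pi val (lin J (\<lambda>u. f u e) e) \<and>
      skel_cancel (ofS (e w)) (ofS (e z))) (e(w := a)))"
    using w assms sorts_L0(2)
    by (intro red.ex red.conj red.pi red.definable definable_cancel) auto
  then show ?thesis
  proof (rule red.agree)
    fix e
    have "lin J (\<lambda>u. f u (e(w := a))) (e(w := a)) = lin J (\<lambda>u. f u e) e" for a
    proof (rule lin_comb_cong)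
      fix u assume "u \<in> J"
      then show "f u (e(w := a)) = f u e" using assms(4) w(1) by (intro Cf_upd) auto
    qed (use \<open>w \<notin> J\<close> in auto)
    then have "(\<exists>a\<in>univ M (fst w). (\<lambda>e. ofS (e w) = skel_pi val (lin J (\<lambda>u. f u e) e) \<and>
      skel_cancel (ofS (e w)) (ofS (e z))) (e(w := a))) \<longleftrightarrow>
      (\<exists>a\<in>univ M (fst w). ofS a = skel_pi val (lin J (\<lambda>u. f u e) e) \<and> skel_cancel (ofS a) (ofS (e z)))"
      using w(2) by auto
    also have "\<dots> \<longleftrightarrow> skel_cancel (skel_pi val (lin J (\<lambda>u. f u e) e)) (ofS (e z))"
      using w(1) skel_pi_in by (auto simp: univ_Skel)
    finally show "(\<exists>a\<in>univ M (fst w). (\<lambda>e. ofS (e w) = skel_pi val (lin J (\<lambda>u. f u e) e) \<and>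
      skel_cancel (ofS (e w)) (ofS (e z))) (e(w := a))) \<longleftrightarrow>
      skel_cancel (skel_pi val (lin J (\<lambda>u. f u e) e)) (ofS (e z))" .
  qed
qed

lemma coef_paramsD:
  assumes "coef_params L0 M Cf T G S"
  shows "finite G" "finite S" "fst ` S \<subseteq> {FldS}" "fst ` S \<subseteq> sorts L0"
    "\<And>g. g \<in> G \<Longrightarrow> \<forall>u. g u \<in> Cf \<and> depends_on (g u) S"
    "T = {\<lambda>u. g u e | g e. g \<in> G \<and> e \<in> envs M}"
  using assms by (auto simp: coef_params_def)

text \<open>The quantifier over \<open>v\<close> becomes quantifiers over \<open>z\<close>, standing
  for \<open>\<pi>(c)\<close>, and over the coefficients of \<open>w\<close>, guarded by the
  optimality of \<open>w\<close>. The guard is reducible: a better competitor w' means that adding w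
  - w' to c raises its value, which the skeleton sees as cancellation. Conversely, under the guard
  any c with \<open>\<pi>(c) = z\<close> gives the witness c + w.\<close>

lemma red_exV:
  assumes "red J P" and J: "finite J" "v \<in> J" "fst ` J \<subseteq> {VecS}"
  shows "red (J - {v}) (\<lambda>e. \<exists>a\<in>univ M VecS. P (e(v := a)))"
proof -
  let ?J = "J - {v}"
  have v: "fst v = VecS" using J by auto
  obtain T Z where T: "T \<noteq> {}" "coef_family L0 M Cf T" "finite Z" "shift_ok J v T Z P"
    using red_shift[OF assms] by blast
  obtain SP where SP: "finite SP" "VecS \<notin> fst ` SP" "envs_depends P (SP \<union> J)"
    using red_depends[OF assms(1,2)] by blast
  obtain G S where S: "S \<inter> (Z \<union> SP) = {}" and GS: "coef_params L0 M Cf T G S"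
    by (rule coef_familyE[OF T(2), of "Z \<union> SP"]) (use T(3) SP(1) in auto)
  note GS = coef_paramsD[OF GS]
  \<comment> \<open>A second set of parameters, disjoint from the first: the guard quantifies over
    all competitors while the coefficients of \<open>w\<close> stay fixed.\<close>
  obtain G' S' where S': "S' \<inter> S = {}" and GS': "coef_params L0 M Cf T G' S'"
    by (rule coef_familyE[OF T(2), of S]) (use GS(2) in auto)
  note GS' = coef_paramsD[OF GS']
  obtain z where z: "fst z = SkelS" "z \<notin> Z \<union> SP"
    by (rule fresh_var[of "Z \<union> SP" SkelS]) (use T(3) SP(1) in auto)
  have JS: "J \<inter> S = {}" "J \<inter> S' = {}"
    using sort_disjoint[OF J(3) GS(3)] sort_disjoint[OF J(3) GS'(3)] by simp_all
  have zJ: "z \<notin> J" using z(1) J(3) by auto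
  have zS: "z \<notin> S" "z \<notin> S'" using z(1) GS(3) GS'(3) by auto
  have Jsub: "finite ?J" "fst ` ?J \<subseteq> {VecS}" using J by auto
  have "\<exists>P'. red ?J P' \<and> shift_eq J v T ?J g z P P'" if "g \<in> G" for g
    using shift_okD[OF T(4) Jsub, of z S g] z S GS(5)[OF that] by auto
  then obtain Q where Q: "\<And>g. g \<in> G \<Longrightarrow> red ?J (Q g)" "\<And>g. g \<in> G \<Longrightarrow> shift_eq J v T ?J g z P (Q g)"
    by metis
  define bad where "bad g g' e \<longleftrightarrow> skel_cancel (skel_pi val (lin ?J (\<lambda>u. g u e - g' u e) e)) (ofS (e z))"
    for g g' e
  define good where "good g e \<longleftrightarrow> (\<forall>g'\<in>G'. \<not> (\<exists>d\<in>envs M. bad g g' (comb S' d e)))" for g e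
  \<comment> \<open>The class \<open>z\<close> must be restricted to the range of
    \<open>\<pi>\<close>, since the classes of \<open>(\<gamma>, 0)\<close> with
    \<open>\<gamma> \<noteq> \<infinity>\<close> come from no \<open>c\<close>.\<close>
  define R where "R e \<longleftrightarrow> (\<exists>d\<in>envs M. (\<lambda>e. ofS (e z) \<in> range (skel_pi val) \<and>
    (\<exists>g\<in>G. good g e \<and> Q g e)) (comb (insert z S) d e))" for e
  have red_bad: "red ?J (bad g g')" if "g \<in> G" "g' \<in> G'" for g g'
    unfolding bad_def using that GS(5) GS'(5) Jsub z(1)
    by (intro red_cancel[where f = "\<lambda>u e. g u e - g' u e"]) (auto intro: Cf_diff)
  have red_good: "red ?J (good g)" if "g \<in> G" for g
    unfolding good_def by (intro red_Ball red.neg red_ex_comb red_bad GS' that)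
  have "red ?J R"
    unfolding R_def using GS(2,4) z(1) sorts_L0(2)
    by (intro red_ex_comb red.conj red_Bex red.definable definable_in_range GS(1) red_good Q(1)) auto
  then show ?thesis
  proof (rule red.agree)
    fix e assume e: "e \<in> envs M"
    have val_bad: "bad g g' (comb S' d e1) \<longleftrightarrow> val c < val (c + lin ?J (\<lambda>u. g u e1) e1 - lin ?J (\<lambda>u. g' u d) e1)"
      if "g \<in> G" "g' \<in> G'" "ofS (e1 z) = skel_pi val c" for g g' d e1 c
    proof -
      have "g u (comb S' d e1) = g u e1" for u
      proof (rule depends_onD[of "g u" S])
        fix x assume "x \<in> S"
        then have "x \<notin> S'" using S' by blast
        then show "comb S' d e1 x = e1 x" by simp
      qed (use GS(5) that in blast)
      moreover have "g' u (comb S' d e1) = g' u d" for u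
        by (rule depends_onD[of "g' u" S']) (use GS'(5) that in auto)
      moreover have "lin ?J \<kappa> (comb S' d e1) = lin ?J \<kappa> e1" for \<kappa>
      proof (rule lin_comb_cong)
        fix u assume "u \<in> ?J"
        then have "u \<notin> S'" using JS(2) by blast
        then show "comb S' d e1 u = e1 u" by simp
      qed simp
      ultimately show ?thesis
        using zS(2) that(3) unfolding bad_def by (simp add: skel_cancel_pi lin_diff add_diff_eq)
    qed
    have good_iff: "good g e1 \<longleftrightarrow> (\<forall>\<kappa>\<in>T. val (c + lin ?J (\<lambda>u. g u e1) e1 - lin ?J \<kappa> e1) \<le> val c)"
      if "g \<in> G" "ofS (e1 z) = skel_pi val c" for g e1 c
    proof -
      have "bad g g' (comb S' d e1) \<longleftrightarrow>
          \<not> val (c + lin ?J (\<lambda>u. g u e1) e1 - lin ?J (\<lambda>u. g' u d) e1) \<le> val c" if "g' \<in> G'" for g' d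
        using val_bad[of g g' e1 c d] \<open>g \<in> G\<close> \<open>ofS (e1 z) = skel_pi val c\<close> that by (simp add: not_le)
      then have "good g e1 \<longleftrightarrow>
          (\<forall>g'\<in>G'. \<forall>d\<in>envs M. val (c + lin ?J (\<lambda>u. g u e1) e1 - lin ?J (\<lambda>u. g' u d) e1) \<le> val c)"
        unfolding good_def by simp
      also have "\<dots> \<longleftrightarrow> (\<forall>\<kappa>\<in>T. val (c + lin ?J (\<lambda>u. g u e1) e1 - lin ?J \<kappa> e1) \<le> val c)"
        unfolding GS'(6) by blast
      finally show ?thesis .
    qed
    have P_eq: "P (e(v := InV x)) = P ((comb (insert z S) d e)(v := InV x))" if "d \<in> envs M" for d x
    proof (rule envs_dependsD[OF SP(3)])
      fix y assume "y \<in> SP \<union> J"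
      then have "y \<notin> insert z S" using z S JS(1) zJ by auto
      then show "(e(v := InV x)) y = ((comb (insert z S) d e)(v := InV x)) y" by simp
    qed (use e that v in \<open>auto intro!: upd_envs comb_envs simp: univ_Vec\<close>)
    show "R e \<longleftrightarrow> (\<exists>a\<in>univ M VecS. P (e(v := a)))"
    proof
      assume "R e"
      then obtain d g where d: "d \<in> envs M" and g: "g \<in> G"
        and R: "ofS (comb (insert z S) d e z) \<in> range (skel_pi val)"
          "good g (comb (insert z S) d e)" "Q g (comb (insert z S) d e)"
        unfolding R_def by blast
      let ?e = "comb (insert z S) d e"
      have e': "?e \<in> envs M" using d e by (rule comb_envs)
      obtain c where c: "ofS (?e z) = skel_pi val c" using R(1) by blast
      have "P (?e(v := InV (c + lin ?J (\<lambda>u. g u ?e) ?e))) = Q g ?e"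
        using shift_eqD[OF Q(2)[OF g] e' c] R(2) good_iff[of g ?e c, OF g c] by blast
      then have "P (e(v := InV (c + lin ?J (\<lambda>u. g u ?e) ?e)))" using R(3) P_eq[OF d] by blast
      then show "\<exists>a\<in>univ M VecS. P (e(v := a))" by (auto simp: univ_Vec)
    next
      assume "\<exists>a\<in>univ M VecS. P (e(v := a))"
      then obtain x where x: "P (e(v := InV x))" by (auto simp: univ_Vec)
      \<comment> \<open>Conversely, the best approximation of the given \<open>x\<close> satisfies
        the guard, with \<open>c\<close> the remainder.\<close>
      obtain \<kappa> where \<kappa>: "\<kappa> \<in> T" "\<And>\<kappa>'. \<kappa>' \<in> T \<Longrightarrow> val (x - lin ?J \<kappa>' e) \<le> val (x - lin ?J \<kappa> e)"
        using ex_max_val[OF Jsub(1) _ _ T(1), of "{e}" x "\<lambda>e. e"] by auto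
      obtain g d where g: "g \<in> G" "d \<in> envs M" "\<kappa> = (\<lambda>u. g u d)" using \<kappa>(1) GS(6) by auto
      define c where "c = x - lin ?J \<kappa> e"
      define d' where "d' = d(z := InS (skel_pi val c))"
      have d': "d' \<in> envs M"
        unfolding d'_def using g(2) z(1) skel_pi_in by (auto intro!: upd_envs simp: univ_Skel)
      let ?e = "comb (insert z S) d' e"
      have e': "?e \<in> envs M" using d' e by (rule comb_envs)
      have ez: "ofS (?e z) = skel_pi val c" by (simp add: d'_def)
      have gu: "g u ?e = \<kappa> u" for u
        unfolding g(3)
        by (rule depends_onD[of "g u" S]) (use GS(5)[OF g(1)] zS(1) in \<open>auto simp: d'_def\<close>)
      have lin: "lin ?J \<kappa>' ?e = lin ?J \<kappa>' e" for \<kappa>'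
      proof (rule lin_comb_cong)
        fix u assume "u \<in> ?J"
        then have "u \<notin> insert z S" using zJ JS(1) by auto
        then show "?e u = e u" by simp
      qed simp
      have cx: "c + lin ?J (\<lambda>u. g u ?e) ?e = x" unfolding gu lin by (simp add: c_def)
      have le: "val (c + lin ?J (\<lambda>u. g u ?e) ?e - lin ?J \<kappa>' ?e) \<le> val c" if "\<kappa>' \<in> T" for \<kappa>'
        unfolding cx unfolding lin using \<kappa>(2)[OF that] by (simp add: c_def)
      have "P (?e(v := InV x)) = Q g ?e"
        using shift_eqD[OF Q(2)[OF g(1)] e' ez le] unfolding cx .
      then have "Q g ?e" using x P_eq[OF d'] by blast
      moreover have "good g ?e" using good_iff[of g ?e c, OF g(1) ez] le by blast
      moreover have "ofS (?e z) \<in> range (skel_pi val)" unfolding ez by blast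
      ultimately show "R e" unfolding R_def using g(1) d' by blast
    qed
  qed
qed

end

section \<open>Counting for reduced predicates\<close>

text \<open>A set cut out by \<open>P\<close> is recovered from a pair \<open>(t, \<gamma>)\<close>
  and one pattern of each \<open>Q g\<close> on the image of \<open>A\<close> under
  \<open>t\<close>. There are at most \<open>K * card A\<close> pairs, and for each of them
  polynomially many choices of patterns because \<open>G\<close> is finite. Letting
  \<open>\<gamma>\<close> depend on \<open>a\<close> permits different assignments to use different
  predicates.\<close>

lemma poly_patterns_reduce:
  assumes G: "finite G" "\<And>g. g \<in> G \<Longrightarrow> poly_patterns M X' (Q g)"
    and red: "\<And>A. A \<subseteq> envs M \<Longrightarrow> finite A \<Longrightarrow> A \<noteq> {} \<Longrightarrow>
      \<exists>I. finite I \<and> card I \<le> K * card A \<and>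
        (\<forall>(t, \<gamma>)\<in>I. \<forall>a\<in>A. t a \<in> envs M \<and> \<gamma> a \<in> G) \<and>
        (\<forall>b\<in>envs M. \<exists>(t, \<gamma>)\<in>I. \<exists>b'\<in>envs M. \<forall>a\<in>A. P (comb X a b) = Q (\<gamma> a) (comb X' (t a) b'))"
  shows "poly_patterns M X P"
proof -
  have "\<exists>d. \<forall>A\<subseteq>envs M. finite A \<longrightarrow> card (patterns M X' (Q g) A) \<le> (card A + 2) ^ d" if "g \<in> G" for g
    using G(2)[OF that] unfolding poly_patterns_def .
  then obtain d where d: "\<And>g A. g \<in> G \<Longrightarrow> A \<subseteq> envs M \<Longrightarrow> finite A \<Longrightarrow>
      card (patterns M X' (Q g) A) \<le> (card A + 2) ^ d g"
    by metis
  \<comment> \<open>The part \<open>K + 1\<close> absorbs the number of pairs, using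
    \<open>K \<le> 2 ^ K\<close>; the sum is the exponent of the product of the pattern
    counts.\<close>
  let ?D = "K + 1 + (\<Sum>g\<in>G. d g)"
  have "card (patterns M X P A) \<le> (card A + 2) ^ ?D" if A: "A \<subseteq> envs M" "finite A" for A
  proof (cases "A = {}")
    \<comment> \<open>The reduction is supplied for nonempty \<open>A\<close> only; here the empty
      set is the one possible pattern.\<close>
    case True
    have "patterns M X P A \<subseteq> {{}}" unfolding True patterns_def by blast
    from card_mono[OF _ this] have "card (patterns M X P A) \<le> 1" by simp
    also have "\<dots> \<le> (card A + 2) ^ ?D" by (rule one_le_power) simp
    finally show ?thesis .
  next
    case False
    obtain I where I: "finite I" "card I \<le> K * card A"
      "\<forall>(t, \<gamma>)\<in>I. \<forall>a\<in>A. t a \<in> envs M \<and> \<gamma> a \<in> G"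
      "\<forall>b\<in>envs M. \<exists>(t, \<gamma>)\<in>I. \<exists>b'\<in>envs M. \<forall>a\<in>A. P (comb X a b) = Q (\<gamma> a) (comb X' (t a) b')"
      using red[OF A False] by blast
    \<comment> \<open>\<open>?F t\<close> consists of the choices of one pattern for each
      \<open>g\<close>, and \<open>?h\<close> keeps those \<open>a\<close> whose image lies in the
      pattern of the predicate assigned to \<open>a\<close>.\<close>
    let ?F = "\<lambda>t. PiE G (\<lambda>g. patterns M X' (Q g) (t ` A))"
    let ?h = "\<lambda>(t, \<gamma>) F. {a \<in> A. t a \<in> F (\<gamma> a)}"
    have finF: "finite (?F t)" for t using G(1) A(2) by (intro finite_PiE finite_patterns finite_imageI)
    have cardF: "card (?F t) \<le> (card A + 2) ^ (\<Sum>g\<in>G. d g)" if "(t, \<gamma>) \<in> I" for t \<gamma>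
    proof -
      have sub: "t ` A \<subseteq> envs M" using I(3) that by auto
      have "card (patterns M X' (Q g) (t ` A)) \<le> (card A + 2) ^ d g" if "g \<in> G" for g
      proof -
        have "card (patterns M X' (Q g) (t ` A)) \<le> (card (t ` A) + 2) ^ d g"
          using A(2) by (intro d that sub) simp
        also have "\<dots> \<le> (card A + 2) ^ d g" using card_image_le[OF A(2), of t] by (intro power_mono) auto
        finally show ?thesis .
      qed
      then have "(\<Prod>g\<in>G. card (patterns M X' (Q g) (t ` A))) \<le> (\<Prod>g\<in>G. (card A + 2) ^ d g)"
        by (intro prod_mono) auto
      then show ?thesis using G(1) by (simp add: card_PiE power_sum)
    qed
    have "patterns M X P A \<subseteq> (\<Union>i\<in>I. ?h i ` ?F (fst i))"
    proof
      fix B assume "B \<in> patterns M X P A"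
      then obtain b where b: "b \<in> envs M" "B = {a \<in> A. P (comb X a b)}" unfolding patterns_def by blast
      then obtain t \<gamma> b' where t: "(t, \<gamma>) \<in> I" "b' \<in> envs M"
        "\<forall>a\<in>A. P (comb X a b) = Q (\<gamma> a) (comb X' (t a) b')" using I(4) by blast
      define F where "F = restrict (\<lambda>g. {a \<in> t ` A. Q g (comb X' a b')}) G"
      have F: "F \<in> ?F t" using t(2) by (auto simp: F_def patterns_def)
      have mem: "t a \<in> F (\<gamma> a) \<longleftrightarrow> P (comb X a b)" if "a \<in> A" for a
      proof -
        have "\<gamma> a \<in> G" using I(3) t(1) that by blast
        then have "F (\<gamma> a) = {a' \<in> t ` A. Q (\<gamma> a) (comb X' a' b')}"
          unfolding F_def by (rule restrict_apply')
        moreover have "t a \<in> t ` A" using that by (rule imageI)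
        ultimately have "t a \<in> F (\<gamma> a) \<longleftrightarrow> Q (\<gamma> a) (comb X' (t a) b')" by simp
        then show ?thesis using t(3)[rule_format, OF that] by (rule trans[OF _ sym])
      qed
      have "B = ?h (t, \<gamma>) F"
        unfolding b(2) prod.case by (intro Collect_cong conj_cong refl mem[symmetric])
      then have "B \<in> ?h (t, \<gamma>) ` ?F (fst (t, \<gamma>))"
        unfolding fst_conv using F by (rule image_eqI)
      with t(1) show "B \<in> (\<Union>i\<in>I. ?h i ` ?F (fst i))" by (rule UN_I)
    qed
    then have "card (patterns M X P A) \<le> card (\<Union>i\<in>I. ?h i ` ?F (fst i))"
      using I(1) finF by (intro card_mono) auto
    also have "\<dots> \<le> (\<Sum>i\<in>I. card (?h i ` ?F (fst i)))" using I(1) by (rule card_UN_le)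
    also have "\<dots> \<le> (\<Sum>i\<in>I. (card A + 2) ^ (\<Sum>g\<in>G. d g))"
    proof (rule sum_mono)
      fix i assume i: "i \<in> I"
      obtain t \<gamma> where t: "i = (t, \<gamma>)" by fastforce
      have "card (?h i ` ?F (fst i)) \<le> card (?F (fst i))" by (rule card_image_le[OF finF])
      also have "\<dots> \<le> (card A + 2) ^ (\<Sum>g\<in>G. d g)" using cardF[of t \<gamma>] i t by simp
      finally show "card (?h i ` ?F (fst i)) \<le> (card A + 2) ^ (\<Sum>g\<in>G. d g)" .
    qed
    also have "\<dots> \<le> (K * card A) * (card A + 2) ^ (\<Sum>g\<in>G. d g)" using I(2) by simp
    also have "\<dots> \<le> ((card A + 2) ^ K * (card A + 2)) * (card A + 2) ^ (\<Sum>g\<in>G. d g)"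
    proof (intro mult_le_mono)
      have "K \<le> 2 ^ K" by (rule less_imp_le[OF less_exp])
      also have "(2::nat) ^ K \<le> (card A + 2) ^ K" by (intro power_mono) auto
      finally show "K \<le> (card A + 2) ^ K" .
    qed auto
    also have "\<dots> = (card A + 2) ^ ?D" by (simp only: power_add power_one_right)
    finally show ?thesis .
  qed
  then show ?thesis unfolding poly_patterns_def by blast
qed

section \<open>Removing vectors from the object side and from the parameter side\<close>

context valued_reduct
begin

text \<open>When all vectors lie on the object side, \<open>c\<close> and the coefficients of
  \<open>w\<close> depend on \<open>a\<close> alone. They are stored in the new variables
  \<open>z\<close> and \<open>S\<close>, which join the object side, so a single pair
  \<open>(t, \<gamma>)\<close> serves every \<open>b\<close>. The induction removes one vector at a
  time until the predicate is definable in the skeleton.\<close>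

lemma red_poly_patterns_closed:
  assumes base: "\<And>P X. definable L0 M P \<Longrightarrow> finite X \<Longrightarrow> poly_patterns M X P"
    and "red J P" "finite J" "fst ` J \<subseteq> {VecS}" "J \<subseteq> X" "finite X"
  shows "poly_patterns M X P"
  using assms(2-)
proof (induction "card J" arbitrary: J P X)
  case 0
  then show ?case using base red_empty by simp
next
  case (Suc n)
  note J = Suc.prems(2,3) and X = Suc.prems(4,5)
  have "J \<noteq> {}" using Suc.hyps(2) by auto
  then obtain v where v: "v \<in> J" by blast
  let ?J = "J - {v}"
  have vV: "fst v = VecS" using J v by auto
  obtain T Z where T: "T \<noteq> {}" "coef_family L0 M Cf T" "finite Z" "shift_ok J v T Z P"
    using red_shift[OF Suc.prems(1) J(1) v J(2)] by blast
  obtain SP where SP: "finite SP" "VecS \<notin> fst ` SP" "envs_depends P (SP \<union> J)"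
    using red_depends[OF Suc.prems(1) J(1)] by blast
  let ?Z = "Z \<union> SP \<union> X"
  have finZ: "finite ?Z" using T(3) SP(1) X(2) by simp
  obtain G S where S: "S \<inter> ?Z = {}" and GS: "coef_params L0 M Cf T G S"
    by (rule coef_familyE[OF T(2) finZ])
  note GS = coef_paramsD[OF GS]
  obtain z where z: "fst z = SkelS" "z \<notin> ?Z" by (rule fresh_var[OF finZ, of SkelS])
  have JS: "J \<inter> S = {}" using sort_disjoint[OF J(2) GS(3)] by simp
  have zS: "z \<notin> S" using z(1) GS(3) by auto
  have Jsub: "finite ?J" "fst ` ?J \<subseteq> {VecS}" using J by auto
  have "\<exists>P'. red ?J P' \<and> shift_eq J v T ?J g z P P'" if "g \<in> G" for g
    using shift_okD[OF T(4) Jsub, of z S g] z S GS(5)[OF that] by auto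
  then obtain Q where Q: "\<And>g. g \<in> G \<Longrightarrow> red ?J (Q g)" "\<And>g. g \<in> G \<Longrightarrow> shift_eq J v T ?J g z P (Q g)"
    by metis
  let ?X = "X \<union> insert z S"
  show ?case
  proof (rule poly_patterns_reduce[where G = G and Q = Q and X' = ?X and K = 1])
    show "poly_patterns M ?X (Q g)" if "g \<in> G" for g
    proof (rule Suc.hyps(1))
      show "n = card ?J" using Suc.hyps(2) J(1) v by simp
    qed (use Q(1)[OF that] Jsub X GS(2) in auto)
    fix A assume A: "A \<subseteq> envs M" "finite A" "A \<noteq> {}"
    have "\<exists>t. \<exists>g\<in>G. t \<in> envs M \<and> (\<forall>b\<in>envs M. P (comb X a b) = Q g (comb ?X t b))" if "a \<in> A" for a
    proof -
      define x where "x = ofV (a v)"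
      have a: "a \<in> envs M" using that A(1) by blast
      obtain \<kappa> where \<kappa>: "\<kappa> \<in> T" "\<And>\<kappa>'. \<kappa>' \<in> T \<Longrightarrow> val (x - lin ?J \<kappa>' a) \<le> val (x - lin ?J \<kappa> a)"
        using ex_max_val[OF Jsub(1) _ _ T(1), of "{a}" x "\<lambda>e. e"] by auto
      obtain g d where g: "g \<in> G" "d \<in> envs M" "\<kappa> = (\<lambda>u. g u d)" using \<kappa>(1) GS(6) by auto
      define c where "c = x - lin ?J \<kappa> a"
      define t where "t = comb S d (a(z := InS (skel_pi val c)))"
      have t: "t \<in> envs M"
        unfolding t_def using a g(2) z(1) skel_pi_in by (auto intro!: upd_envs comb_envs simp: univ_Skel)
      have tX: "t y = a y" if "y \<in> X" for y
      proof -
        have "y \<notin> S" "y \<noteq> z" using that z S by auto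
        then show ?thesis by (simp add: t_def)
      qed
      have "P (comb X a b) = Q g (comb ?X t b)" if b: "b \<in> envs M" for b
      proof -
        let ?e = "comb ?X t b"
        have e': "?e \<in> envs M" using t b by (rule comb_envs)
        have ez: "ofS (?e z) = skel_pi val c" using zS by (simp add: t_def)
        have gu: "g u ?e = \<kappa> u" for u
          unfolding g(3)
        proof (rule depends_onD[of "g u" S])
          show "depends_on (g u) S" using GS(5)[OF g(1)] by blast
        qed (simp add: t_def)
        have lin: "lin ?J \<kappa>' ?e = lin ?J \<kappa>' a" for \<kappa>'
          by (rule lin_comb_cong) (use X(1) tX in \<open>auto simp: comb_def\<close>)
        have cx: "c + lin ?J (\<lambda>u. g u ?e) ?e = x" unfolding gu lin by (simp add: c_def)
        have le: "val (c + lin ?J (\<lambda>u. g u ?e) ?e - lin ?J \<kappa>' ?e) \<le> val c" if "\<kappa>' \<in> T" for \<kappa>'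
          unfolding cx unfolding lin using \<kappa>(2)[OF that] by (simp add: c_def)
        have "P (?e(v := InV x)) = Q g ?e"
          using shift_eqD[OF Q(2)[OF g(1)] e' ez le] unfolding cx .
        moreover have "P (comb X a b) = P (?e(v := InV x))"
        proof (rule envs_dependsD[OF SP(3)])
          fix y assume y: "y \<in> SP \<union> J"
          then have "y \<notin> insert z S" if "y \<notin> X" using that z S GS(3) J(2) X(1) by auto
          then show "comb X a b y = (?e(v := InV x)) y"
            using tX X(1) v env_Vec[OF a vV] by (auto simp: comb_def x_def)
        qed (use a b e' vV in \<open>auto intro!: upd_envs comb_envs simp: univ_Vec\<close>)
        ultimately show ?thesis by simp
      qed
      then show ?thesis using t g(1) by blast
    qed
    then obtain t \<gamma> where t: "\<And>a. a \<in> A \<Longrightarrow> t a \<in> envs M" "\<And>a. a \<in> A \<Longrightarrow> \<gamma> a \<in> G"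
      "\<And>a b. a \<in> A \<Longrightarrow> b \<in> envs M \<Longrightarrow> P (comb X a b) = Q (\<gamma> a) (comb ?X (t a) b)"
      by metis
    have "card A \<ge> 1" using A by (simp add: Suc_leI card_gt_0_iff)
    then show "\<exists>I. finite I \<and> card I \<le> 1 * card A \<and>
        (\<forall>(t, \<gamma>)\<in>I. \<forall>a\<in>A. t a \<in> envs M \<and> \<gamma> a \<in> G) \<and>
        (\<forall>b\<in>envs M. \<exists>(t, \<gamma>)\<in>I. \<exists>b'\<in>envs M. \<forall>a\<in>A. P (comb X a b) = Q (\<gamma> a) (comb ?X (t a) b'))"
      using t by (intro exI[of _ "{(t, \<gamma>)}"]) auto
  qed (rule GS(1))
qed

text \<open>\<open>\<rho>\<close> makes copies outside \<open>Y\<close>, and \<open>\<sigma>\<close>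
  takes a copy back to its original. Reading an assignment through \<open>\<sigma>\<close> thus
  transfers its values to the copies.\<close>

lemma ex_var_shift:
  assumes "finite (Y :: sort var set)"
  obtains \<rho> \<sigma> :: "sort var \<Rightarrow> sort var" where "\<And>x. fst (\<rho> x) = fst x" "\<And>x. fst (\<sigma> x) = fst x"
    "\<And>x. x \<in> Y \<Longrightarrow> \<sigma> x = x" "\<And>x. \<sigma> (\<rho> x) = x" "\<And>x. \<rho> x \<notin> Y"
proof -
  obtain m where m: "\<And>x. x \<in> Y \<Longrightarrow> snd x < m"
    using finite_nat_set_iff_bounded[of "snd ` Y"] assms by auto
  show thesis
  proof (rule that[of "\<lambda>x. (fst x, snd x + m)" "\<lambda>x. if snd x < m then x else (fst x, snd x - m)"])
    show "(fst x, snd x + m) \<notin> Y" for x :: "sort var" using m by force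
  qed (use m in auto)
qed

text \<open>A parameter vector \<open>v\<close> has one value for all \<open>a\<close>, so its
  remainder \<open>c\<close> must not depend on \<open>a\<close>. Maximality over all of
  \<open>A\<close> provides such a \<open>c\<close>, but the optimal \<open>w\<close> is formed with
  the vectors of one particular \<open>a0\<close>. Copies of the object-side vectors carry the
  values of \<open>a0\<close> and join the object side, so that the number of vectors on the
  parameter side drops.\<close>

lemma red_poly_patterns:
  assumes base: "\<And>P X. definable L0 M P \<Longrightarrow> finite X \<Longrightarrow> poly_patterns M X P"
    and "red J P" "finite J" "fst ` J \<subseteq> {VecS}" "finite X"
  shows "poly_patterns M X P"
  using assms(2-)
proof (induction "card (J - X)" arbitrary: J P X)
  case 0
  then have "J \<subseteq> X" by simp
  then show ?case using red_poly_patterns_closed[OF base] 0 by blast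
next
  case (Suc n)
  note J = Suc.prems(2,3) and X = Suc.prems(4)
  have "J - X \<noteq> {}" using Suc.hyps(2) by (metis card.empty nat.distinct(1))
  then obtain v where v: "v \<in> J" "v \<notin> X" by blast
  let ?J = "J - {v}"
  have vV: "fst v = VecS" using J v by auto
  obtain T Z where T: "T \<noteq> {}" "coef_family L0 M Cf T" "finite Z" "shift_ok J v T Z P"
    using red_shift[OF Suc.prems(1) J(1) v(1) J(2)] by blast
  obtain SP where SP: "finite SP" "VecS \<notin> fst ` SP" "envs_depends P (SP \<union> J)"
    using red_depends[OF Suc.prems(1) J(1)] by blast
  let ?Z = "Z \<union> SP \<union> X"
  have finZ: "finite ?Z" using T(3) SP(1) X by simp
  obtain G S where S: "S \<inter> ?Z = {}" and GS: "coef_params L0 M Cf T G S"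
    by (rule coef_familyE[OF T(2) finZ])
  note GS = coef_paramsD[OF GS]
  obtain z where z: "fst z = SkelS" "z \<notin> ?Z" by (rule fresh_var[OF finZ, of SkelS])
  have JS: "J \<inter> S = {}" using sort_disjoint[OF J(2) GS(3)] by simp
  have zJ: "z \<notin> J" using z(1) J(2) by auto
  have zS: "z \<notin> S" using z(1) GS(3) by auto
  obtain \<rho> \<sigma> :: "sort var \<Rightarrow> sort var" where sort: "\<And>x. fst (\<rho> x) = fst x" "\<And>x. fst (\<sigma> x) = fst x"
    and \<sigma>: "\<And>x. x \<in> J \<union> X \<Longrightarrow> \<sigma> x = x" "\<And>x. \<sigma> (\<rho> x) = x" and \<rho>: "\<And>x. \<rho> x \<notin> J \<union> X"
    by (rule ex_var_shift[of "J \<union> X"]) (use J(1) X in auto)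
  \<comment> \<open>Vectors on the parameter side keep their names, as their values are the same for
    every \<open>a\<close>.\<close>
  define \<rho>' where "\<rho>' u = (if u \<in> X then \<rho> u else u)" for u
  have \<sigma>\<rho>': "\<sigma> (\<rho>' u) = u" if "u \<in> ?J" for u using that \<sigma> by (simp add: \<rho>'_def)
  define J' where "J' = \<rho>' ` ?J"
  have J': "finite J'" "fst ` J' \<subseteq> {VecS}" "v \<notin> J'"
  proof -
    show "finite J'" using J(1) by (simp add: J'_def)
    show "fst ` J' \<subseteq> {VecS}" using J(2) sort by (auto simp: J'_def \<rho>'_def)
    show "v \<notin> J'" using \<rho> v(1) by (force simp: J'_def \<rho>'_def)
  qed
  have J'S: "J' \<inter> S = {}" using sort_disjoint[OF J'(2) GS(3)] by simp
  have inj: "inj_on \<rho>' ?J" by (rule inj_on_inverseI[of _ \<sigma>]) (rule \<sigma>\<rho>')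
  have lin_J': "lin J' (\<lambda>w. \<kappa> (\<sigma> w)) e = lin ?J \<kappa> (\<lambda>u. e (\<rho>' u))" for \<kappa> e
    unfolding lin_comb_def J'_def sum.reindex[OF inj] using \<sigma>\<rho>' by (intro sum.cong) auto
  have "\<exists>P'. red (?J \<union> J') P' \<and> shift_eq J v T J' (\<lambda>w. g (\<sigma> w)) z P P'" if "g \<in> G" for g
    using shift_okD[OF T(4) J', of z S "\<lambda>w. g (\<sigma> w)"] z S GS(5)[OF that] by auto
  then obtain Q where Q: "\<And>g. g \<in> G \<Longrightarrow> red (?J \<union> J') (Q g)"
    "\<And>g. g \<in> G \<Longrightarrow> shift_eq J v T J' (\<lambda>w. g (\<sigma> w)) z P (Q g)"
    by metis
  define R where "R = \<rho> ` (?J \<inter> X)"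
  let ?X = "X \<union> R"
  have R: "R \<inter> (J \<union> X) = {}" "fst ` R \<subseteq> {VecS}" using \<rho> J(2) sort by (auto simp: R_def)
  have RS: "R \<inter> S = {}" using sort_disjoint[OF R(2) GS(3)] by simp
  have RSP: "R \<inter> SP = {}" using R(2) SP(2) by force
  have zR: "z \<notin> R" using z(1) R(2) by auto
  define t where "t a0 a = comb R (\<lambda>x. a0 (\<sigma> x)) a" for a0 a :: "sort var \<Rightarrow> ('k, 'v, 'g) elem"
  have t_env: "t a0 a \<in> envs M" if "a0 \<in> envs M" "a \<in> envs M" for a0 a
  proof -
    have "(\<lambda>x. a0 (\<sigma> x)) \<in> envs M" using that(1) sort(2) unfolding envs_def mem_Collect_eq by metis
    then show ?thesis using that(2) unfolding t_def by (rule comb_envs)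
  qed
  show ?case
  proof (rule poly_patterns_reduce[where G = G and Q = Q and X' = ?X and K = "card G"])
    show "poly_patterns M ?X (Q g)" if "g \<in> G" for g
    proof (rule Suc.hyps(1)[OF _ Q(1)[OF that]])
      \<comment> \<open>All copies lie in \<open>?X\<close>, so exactly \<open>v\<close> disappears
        from the parameter side.\<close>
      have "?J \<union> J' - ?X = (J - X) - {v}"
        using \<rho> by (auto simp: J'_def \<rho>'_def R_def)
      then show "n = card (?J \<union> J' - ?X)" using Suc.hyps(2) J(1) v by simp
    qed (use J J' X in \<open>auto simp: R_def\<close>)
    fix A assume A: "A \<subseteq> envs M" "finite A" "A \<noteq> {}"
    \<comment> \<open>One pair for each \<open>a0\<close> that may attain the maximum and each
      coefficient vector \<open>g\<close>.\<close>
    let ?I = "(\<lambda>(a0, g). (t a0, \<lambda>_. g)) ` (A \<times> G)"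
    have main: "\<exists>a0\<in>A. \<exists>g\<in>G. \<exists>b'\<in>envs M. \<forall>a\<in>A. P (comb X a b) = Q g (comb ?X (t a0 a) b')"
      if b: "b \<in> envs M" for b
    proof -
      define x where "x = ofV (b v)"
      obtain a0 \<kappa> where \<kappa>: "a0 \<in> A" "\<kappa> \<in> T" "\<And>a \<kappa>'. a \<in> A \<Longrightarrow> \<kappa>' \<in> T \<Longrightarrow>
          val (x - lin ?J \<kappa>' (comb X a b)) \<le> val (x - lin ?J \<kappa> (comb X a0 b))"
        using ex_max_val[OF _ A(2,3) T(1), of ?J x "\<lambda>a. comb X a b"] J(1) by auto
      obtain g d where g: "g \<in> G" "d \<in> envs M" "\<kappa> = (\<lambda>u. g u d)" using \<kappa>(2) GS(6) by auto
      define c where "c = x - lin ?J \<kappa> (comb X a0 b)"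
      \<comment> \<open>Now \<open>\<pi>(c)\<close> and the coefficients go to the parameter side:
        they depend on \<open>b\<close> and \<open>A\<close>, not on the individual
        \<open>a\<close>.\<close>
      define b' where "b' = comb S d (b(z := InS (skel_pi val c)))"
      have b': "b' \<in> envs M"
        unfolding b'_def using b g(2) z(1) skel_pi_in by (auto intro!: upd_envs comb_envs simp: univ_Skel)
      have b'_eq: "b' y = b y" if "y \<notin> S" "y \<noteq> z" for y using that by (simp add: b'_def)
      have "P (comb X a b) = Q g (comb ?X (t a0 a) b')" if a: "a \<in> A" for a
      proof -
        let ?e = "comb ?X (t a0 a) b'"
        have e': "?e \<in> envs M" using t_env a \<kappa>(1) A(1) b' by (intro comb_envs) auto
        have ez: "ofS (?e z) = skel_pi val c" using z zR zS by (simp add: b'_def)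
        have gu: "g u ?e = \<kappa> u" for u
          unfolding g(3)
        proof (rule depends_onD[of "g u" S])
          show "depends_on (g u) S" using GS(5)[OF g(1)] by blast
          fix y assume "y \<in> S"
          then have "y \<notin> ?X" using RS S by auto
          then show "?e y = d y" using \<open>y \<in> S\<close> by (simp add: b'_def)
        qed
        have e_J: "?e u = comb X a b u" if "u \<in> ?J" for u
        proof -
          have "u \<notin> R" "u \<notin> S" "u \<noteq> z" using that R(1) JS zJ by auto
          then show ?thesis using b'_eq[of u] by (simp add: comb_def t_def)
        qed
        have e_\<rho>': "?e (\<rho>' u) = comb X a0 b u" if u: "u \<in> ?J" for u
        proof (cases "u \<in> X")
          case True
          then have "\<rho> u \<in> R" using u by (auto simp: R_def)
          then show ?thesis using True \<sigma>(2) by (simp add: \<rho>'_def t_def)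
        next
          case False
          then show ?thesis using e_J[OF u] by (simp add: \<rho>'_def)
        qed
        have lin: "lin ?J \<kappa>' ?e = lin ?J \<kappa>' (comb X a b)" for \<kappa>'
          by (rule lin_comb_cong) (use e_J in auto)
        have "lin J' (\<lambda>w. g (\<sigma> w) ?e) ?e = lin ?J \<kappa> (comb X a0 b)"
          unfolding gu lin_J' by (rule lin_comb_cong) (use e_\<rho>' in auto)
        then have cx: "c + lin J' (\<lambda>w. g (\<sigma> w) ?e) ?e = x" by (simp add: c_def)
        have le: "val (c + lin J' (\<lambda>w. g (\<sigma> w) ?e) ?e - lin ?J \<kappa>' ?e) \<le> val c" if "\<kappa>' \<in> T" for \<kappa>'
          unfolding cx unfolding lin using \<kappa>(3)[OF a that] by (simp add: c_def)
        have "P (?e(v := InV x)) = Q g ?e"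
          using shift_eqD[OF Q(2)[OF g(1)] e' ez le] unfolding cx .
        moreover have "P (comb X a b) = P (?e(v := InV x))"
        proof (rule envs_dependsD[OF SP(3)])
          fix y assume y: "y \<in> SP \<union> J"
          show "comb X a b y = (?e(v := InV x)) y"
          proof (cases "y = v")
            case True
            then show ?thesis using v(2) env_Vec[OF b vV] by (simp add: x_def)
          next
            case False
            show ?thesis
            proof (cases "y \<in> J")
              case True
              then show ?thesis using e_J[of y] False by simp
            next
              case notJ: False
              then have "y \<notin> R" "y \<notin> S" "y \<noteq> z" using y RSP S z by auto
              then show ?thesis using b'_eq[of y] False by (simp add: comb_def t_def)
            qed
          qed
        qed (use a A(1) b e' vV in \<open>auto intro!: upd_envs comb_envs simp: univ_Vec\<close>)
        ultimately show ?thesis by simp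
      qed
      then show ?thesis using \<kappa>(1) g(1) b' by blast
    qed
    have ex: "\<exists>(t, \<gamma>)\<in>?I. \<exists>b'\<in>envs M. \<forall>a\<in>A. P (comb X a b) = Q (\<gamma> a) (comb ?X (t a) b')"
      if "b \<in> envs M" for b
    proof -
      obtain a0 g b' where *: "a0 \<in> A" "g \<in> G" "b' \<in> envs M"
        "\<forall>a\<in>A. P (comb X a b) = Q g (comb ?X (t a0 a) b')"
        using main[OF \<open>b \<in> envs M\<close>] by blast
      show ?thesis
        by (rule bexI[of _ "(t a0, \<lambda>_. g)"]) (use * in auto)
    qed
    show "\<exists>I. finite I \<and> card I \<le> card G * card A \<and>
        (\<forall>(t, \<gamma>)\<in>I. \<forall>a\<in>A. t a \<in> envs M \<and> \<gamma> a \<in> G) \<and>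
        (\<forall>b\<in>envs M. \<exists>(t, \<gamma>)\<in>I. \<exists>b'\<in>envs M. \<forall>a\<in>A. P (comb X a b) = Q (\<gamma> a) (comb ?X (t a) b'))"
    proof (intro exI[of _ ?I] conjI)
      show "card ?I \<le> card G * card A"
        using card_image_le[of "A \<times> G"] A(2) GS(1) by (simp add: card_cartesian_product mult.commute)
      show "\<forall>(t, \<gamma>)\<in>?I. \<forall>a\<in>A. t a \<in> envs M \<and> \<gamma> a \<in> G"
        using t_env A(1) by auto
      show "finite ?I" using A(2) GS(1) by simp
    qed (use ex in blast)
  qed (rule GS(1))
qed

end

section \<open>Formulas are reduced\<close>

text \<open>Substitution is an existential quantifier over the graph of \<open>F\<close>; the last
  hypothesis says that \<open>F\<close> does not read \<open>x\<close>.\<close>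

lemma definable_subst:
  assumes "fst x \<in> sorts L" "definable L M (\<lambda>e. e x = F e)" "definable L M R"
    and "\<And>e. e \<in> envs M \<Longrightarrow> F e \<in> univ M (fst x)" "\<And>e a. F (e(x := a)) = F e"
  shows "definable L M (\<lambda>e. R (e(x := F e)))"
proof (rule definable_cong[OF definable_ex[OF assms(1) definable_conj[OF assms(2,3)]]])
  fix e assume "e \<in> envs M"
  then show "(\<exists>a\<in>univ M (fst x). (e(x := a)) x = F (e(x := a)) \<and> R (e(x := a))) = R (e(x := F e))"
    using assms(4,5) by simp
qed

lemma eval_tm_upd: "x \<notin> tm_vars t \<Longrightarrow> eval_tm M (e(x := a)) t = eval_tm M e t"
  by (rule depends_onD[OF depends_on_eval_tm]) auto

lemma has_sort_sublang:
  assumes "sorts L0 \<subseteq> sorts L" "funs L0 \<subseteq> funs L" "farity L0 = farity L"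
  shows "has_sort L0 t s \<Longrightarrow> has_sort L t s"
proof (induction rule: has_sort.induct)
  case (App f ts)
  have "list_all2 (has_sort L) ts (fst (farity L f))"
    using App.IH unfolding assms(3) by (rule list_all2_mono) blast
  then show ?case using has_sort.App[of f L ts] App.hyps assms(2,3) by auto
qed (use assms in \<open>auto intro: has_sort.Var\<close>)

lemma NIP_sublang:
  assumes sub: "sorts L0 \<subseteq> sorts L" "funs L0 \<subseteq> funs L" "farity L0 = farity L"
    "rels L0 \<subseteq> rels L" "rarity L0 = rarity L"
    and "NIP L M"
  shows "NIP L0 M"
proof -
  note sort = has_sort_sublang[OF sub(1-3)]
  have wff: "wff L \<phi>" if "wff L0 \<phi>" for \<phi>
    using that
  proof (induction \<phi>)
    case (Rel r ts)
    then show ?case using sub(4,5) sort by (auto elim: list_all2_mono)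
  qed (use sub(1) sort in auto)
  have "partitioned_formula L \<phi> xs ys" if "partitioned_formula L0 \<phi> xs ys" for \<phi> xs ys
    using that wff sub(1) unfolding partitioned_formula_def by blast
  then show ?thesis using assms(6) unfolding NIP_def by blast
qed

lemma definable_Eq:
  "has_sort L t s \<Longrightarrow> has_sort L u s \<Longrightarrow> definable L M (\<lambda>e. eval_tm M e t = eval_tm M e u)"
  by (rule definableI[of _ "Eq t u"]) auto

lemma definable_Rel:
  "r \<in> rels L \<Longrightarrow> list_all2 (has_sort L) ts (rarity L r) \<Longrightarrow>
    definable L M (\<lambda>e. rint M r (map (eval_tm M e) ts))"
  by (rule definableI[of _ "Rel r ts"]) auto

lemma has_sort_Var: "fst x \<in> sorts L \<Longrightarrow> has_sort L (Var x) (fst x)"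
  by (metis has_sort.Var prod.collapse)

lemma has_sort_App:
  "f \<in> funs L \<Longrightarrow> farity L f = (ss, s) \<Longrightarrow> list_all2 (has_sort L) ts ss \<Longrightarrow> has_sort L (App f ts) s"
  by (metis fst_conv has_sort.App snd_conv)

section \<open>Terms as linear combinations or as reducible graphs\<close>

context valued_reduct
begin

definition reducible :: "((sort var \<Rightarrow> ('k, 'v, 'g) elem) \<Rightarrow> bool) \<Rightarrow> bool" where
  "reducible P \<longleftrightarrow> (\<exists>J. finite J \<and> fst ` J \<subseteq> {VecS} \<and> red J P)"

lemma reducible_definable: "definable L0 M P \<Longrightarrow> reducible P"
  unfolding reducible_def using red.definable by (intro exI[of _ "{}"]) auto

lemma reducible_agree:
  assumes "reducible P" "\<And>e. e \<in> envs M \<Longrightarrow> P e = Q e"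
  shows "reducible Q"
proof -
  obtain J where J: "finite J" "fst ` J \<subseteq> {VecS}" "red J P"
    using assms(1) unfolding reducible_def by blast
  have "red J Q" by (rule red.agree[OF J(3) assms(2)])
  then show ?thesis using J(1,2) unfolding reducible_def by blast
qed

lemma reducible_not: "reducible P \<Longrightarrow> reducible (\<lambda>e. \<not> P e)"
  unfolding reducible_def using red.neg by blast

lemma reducible_conj:
  assumes "reducible P" "reducible Q"
  shows "reducible (\<lambda>e. P e \<and> Q e)"
proof -
  obtain J J' where J: "finite J" "fst ` J \<subseteq> {VecS}" "red J P" "finite J'" "fst ` J' \<subseteq> {VecS}" "red J' Q"
    using assms unfolding reducible_def by blast
  have "red (J \<union> J') (\<lambda>e. P e \<and> Q e)"
    using J by (intro red.conj red_mono[OF J(3)] red_mono[OF J(6)]) auto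
  moreover have "finite (J \<union> J')" "fst ` (J \<union> J') \<subseteq> {VecS}" using J by auto
  ultimately show ?thesis unfolding reducible_def by blast
qed

lemma reducible_ex:
  assumes "fst x \<in> insert VecS (sorts L0)" "reducible P"
  shows "reducible (\<lambda>e. \<exists>a\<in>univ M (fst x). P (e(x := a)))"
proof -
  obtain J where J: "finite J" "fst ` J \<subseteq> {VecS}" "red J P"
    using assms(2) unfolding reducible_def by blast
  show ?thesis
  proof (cases "fst x = VecS")
    case True
    have "red (insert x J) P" using J by (intro red_mono[OF J(3)]) auto
    then have "red (insert x J - {x}) (\<lambda>e. \<exists>a\<in>univ M VecS. P (e(x := a)))"
      using J True by (intro red_exV) auto
    then show ?thesis
      unfolding reducible_def True using J by (intro exI[of _ "insert x J - {x}"]) auto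
  next
    case False
    then have "fst x \<in> sorts L0" using assms(1) by simp
    from red.ex[OF this J(3)] show ?thesis unfolding reducible_def using J(1,2) by blast
  qed
qed

definition vec_tm :: "(sort, 'f) tm \<Rightarrow> bool" where
  "vec_tm t \<longleftrightarrow> (\<exists>J f. finite J \<and> fst ` J \<subseteq> {VecS} \<and> (\<forall>u\<in>J. f u \<in> Cf) \<and>
    (\<forall>e\<in>envs M. eval_tm M e t = InV (lin J (\<lambda>u. f u e) e)))"

definition coef_tm :: "(sort, 'f) tm \<Rightarrow> bool" where
  "coef_tm t \<longleftrightarrow> (\<exists>f\<in>Cf. \<forall>e\<in>envs M. eval_tm M e t = InK (f e))"

text \<open>A term such as \<open>val(t)\<close> contains vectors and is no term of the reduct, so
  terms of the other sorts are represented by their graphs.\<close>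

definition graph_tm :: "(sort, 'f) tm \<Rightarrow> sort \<Rightarrow> bool" where
  "graph_tm t s \<longleftrightarrow> s \<in> sorts L0 \<and> (\<forall>e\<in>envs M. eval_tm M e t \<in> univ M s) \<and>
    (\<forall>z. fst z = s \<longrightarrow> z \<notin> tm_vars t \<longrightarrow> reducible (\<lambda>e. e z = eval_tm M e t))"

lemma vec_tmI:
  assumes "finite J" "fst ` J \<subseteq> {VecS}" "\<And>u. u \<in> J \<Longrightarrow> f u \<in> Cf"
    and "\<And>e. e \<in> envs M \<Longrightarrow> eval_tm M e t = InV (lin J (\<lambda>u. f u e) e)"
  shows "vec_tm t"
  unfolding vec_tm_def by (rule exI[of _ J], rule exI[of _ f]) (simp add: assms)

lemma vec_tm_Var:
  assumes "fst v = VecS"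
  shows "vec_tm (Var v)"
proof -
  have "eval_tm M e (Var v) = InV (lin {v} (\<lambda>u. 1) e)" if "e \<in> envs M" for e
    using env_Vec[OF that assms] by (simp add: lin_comb_def)
  then show ?thesis
    using Cf_one assms by (intro vec_tmI[of "{v}" "\<lambda>u e. 1"]) simp_all
qed

lemma vec_tm_zero:
  assumes "\<And>e. eval_tm M e t = InV 0"
  shows "vec_tm t"
  by (rule vec_tmI[of "{}" "\<lambda>u e. 0"]) (simp_all add: assms lin_comb_def)

lemma vec_tm_add:
  assumes "vec_tm t" "vec_tm u"
    and "\<And>e. eval_tm M e w = InV (ofV (eval_tm M e t) + ofV (eval_tm M e u))"
  shows "vec_tm w"
proof -
  obtain J f where J: "finite J" "fst ` J \<subseteq> {VecS}" "\<forall>u\<in>J. f u \<in> Cf"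
    "\<forall>e\<in>envs M. eval_tm M e t = InV (lin J (\<lambda>u. f u e) e)" using assms(1) unfolding vec_tm_def by blast
  obtain J' f' where J': "finite J'" "fst ` J' \<subseteq> {VecS}" "\<forall>u\<in>J'. f' u \<in> Cf"
    "\<forall>e\<in>envs M. eval_tm M e u = InV (lin J' (\<lambda>u. f' u e) e)" using assms(2) unfolding vec_tm_def by blast
  let ?f = "\<lambda>u e. (if u \<in> J then f u else (\<lambda>e. 0)) e + (if u \<in> J' then f' u else (\<lambda>e. 0)) e"
  have "lin (J \<union> J') (\<lambda>u. ?f u e) e = lin J (\<lambda>u. f u e) e + lin J' (\<lambda>u. f' u e) e" for e
    unfolding lin_add using J(1) J'(1) lin_mono[of "J \<union> J'" J "\<lambda>u. f u e" e] lin_mono[of "J \<union> J'" J' "\<lambda>u. f' u e" e]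
    by (simp add: if_distrib[of "\<lambda>f. f e"])
  moreover have "\<forall>u\<in>J \<union> J'. ?f u \<in> Cf"
    using J(3) J'(3) Cf_zero by (intro ballI Cf_add) auto
  ultimately show ?thesis
    using J J' assms(3) by (intro vec_tmI[of "J \<union> J'" ?f]) (simp_all add: image_Un)
qed

lemma vec_tm_scale:
  assumes "vec_tm t" "h \<in> Cf"
    and "\<And>e. e \<in> envs M \<Longrightarrow> eval_tm M e w = InV (scale (h e) (ofV (eval_tm M e t)))"
  shows "vec_tm w"
proof -
  obtain J f where J: "finite J" "fst ` J \<subseteq> {VecS}" "\<forall>u\<in>J. f u \<in> Cf"
    "\<forall>e\<in>envs M. eval_tm M e t = InV (lin J (\<lambda>u. f u e) e)" using assms(1) unfolding vec_tm_def by blast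
  show ?thesis
    using J assms(2,3) Cf_mult
    by (intro vec_tmI[of J "\<lambda>u e. h e * f u e"]) (simp_all add: lin_scale)
qed

lemma graph_tm_Var:
  assumes "fst x \<in> sorts L0"
  shows "graph_tm (Var x) (fst x)"
  unfolding graph_tm_def
proof (intro conjI allI impI ballI)
  fix z :: "sort var" assume "fst z = fst x"
  then have "definable L0 M (\<lambda>e. eval_tm M e (Var z) = eval_tm M e (Var x))"
    using assms has_sort_Var[of z L0] has_sort_Var[of x L0] by (intro definable_Eq) auto
  then show "reducible (\<lambda>e. e z = eval_tm M e (Var x))" by (simp add: reducible_definable)
qed (use assms in \<open>auto intro: envsD\<close>)

lemma graph_tm_pi:
  assumes "vec_tm t" "\<And>e. eval_tm M e w = InS (skel_pi val (ofV (eval_tm M e t)))"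
  shows "graph_tm w SkelS"
  unfolding graph_tm_def
proof (intro conjI allI impI ballI)
  obtain J f where J: "finite J" "fst ` J \<subseteq> {VecS}" "\<forall>u\<in>J. f u \<in> Cf"
    "\<forall>e\<in>envs M. eval_tm M e t = InV (lin J (\<lambda>u. f u e) e)" using assms(1) unfolding vec_tm_def by blast
  fix z :: "sort var" assume z: "fst z = SkelS"
  have "red J (\<lambda>e. ofS (e z) = skel_pi val (lin J (\<lambda>u. f u e) e))" using z J(3) by (intro red.pi) auto
  then have "reducible (\<lambda>e. ofS (e z) = skel_pi val (lin J (\<lambda>u. f u e) e))"
    unfolding reducible_def using J(1,2) by blast
  then show "reducible (\<lambda>e. e z = eval_tm M e w)"
  proof (rule reducible_agree)
    fix e assume "e \<in> envs M"
    then show "(ofS (e z) = skel_pi val (lin J (\<lambda>u. f u e) e)) = (e z = eval_tm M e w)"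
      using env_Skel[OF _ z] J(4) assms(2) by fastforce
  qed
qed (use sorts_L0(2) skel_pi_in assms(2) in \<open>auto simp: univ_Skel\<close>)

lemma reducible_subst:
  assumes "graph_tm t (fst x)" "x \<notin> tm_vars t" "reducible R"
  shows "reducible (\<lambda>e. R (e(x := eval_tm M e t)))"
proof -
  have t: "fst x \<in> sorts L0" "\<And>e. e \<in> envs M \<Longrightarrow> eval_tm M e t \<in> univ M (fst x)"
    "reducible (\<lambda>e. e x = eval_tm M e t)"
    using assms(1,2) unfolding graph_tm_def by blast+
  have "reducible (\<lambda>e. \<exists>a\<in>univ M (fst x). (\<lambda>e. e x = eval_tm M e t \<and> R e) (e(x := a)))"
    using t(1) by (intro reducible_ex reducible_conj t(3) assms(3)) simp
  then show ?thesis
    by (rule reducible_agree) (use t(2) in \<open>auto simp: eval_tm_upd[OF assms(2)]\<close>)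
qed

text \<open>Fresh variables stand for the two terms and are replaced through the graphs.
  \<open>Z\<close> holds the variables that \<open>H\<close> reads by itself, so that the fresh ones
  do not interfere.\<close>

lemma reducible_binary:
  assumes t: "graph_tm t s" "graph_tm t' s'" and Z: "finite Z"
    and H: "\<And>x x'. fst x = s \<Longrightarrow> fst x' = s' \<Longrightarrow> reducible (\<lambda>e. H e (e x) (e x'))"
    "\<And>e x a b c. x \<notin> Z \<Longrightarrow> H (e(x := a)) b c = H e b c"
  shows "reducible (\<lambda>e. H e (eval_tm M e t) (eval_tm M e t'))"
proof -
  let ?Z = "Z \<union> tm_vars t \<union> tm_vars t'"
  have finZ: "finite ?Z" using Z finite_tm_vars by blast
  obtain x where x: "fst x = s" "x \<notin> ?Z" by (rule fresh_var[OF finZ])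
  obtain x' where x': "fst x' = s'" "x' \<notin> insert x ?Z" by (rule fresh_var[OF finite.insertI[OF finZ]])
  have "reducible (\<lambda>e. (\<lambda>e. (\<lambda>e. H e (e x) (e x')) (e(x := eval_tm M e t))) (e(x' := eval_tm M e t')))"
    using x x' t by (intro reducible_subst H(1)) auto
  moreover have "x' \<noteq> x" "x \<notin> Z" "x' \<notin> Z" "x' \<notin> tm_vars t" using x x' by auto
  ultimately show ?thesis by (simp add: H(2) eval_tm_upd)
qed

lemma reducible_unary:
  assumes t: "graph_tm t s" and Z: "finite Z"
    and H: "\<And>x. fst x = s \<Longrightarrow> reducible (\<lambda>e. H e (e x))"
    "\<And>e x a b. x \<notin> Z \<Longrightarrow> H (e(x := a)) b = H e b"
  shows "reducible (\<lambda>e. H e (eval_tm M e t))"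
  using reducible_binary[OF t t Z, of "\<lambda>e a b. H e a"] H by simp

lemma reducible_Eq:
  assumes "graph_tm t s" "graph_tm u s"
  shows "reducible (\<lambda>e. eval_tm M e t = eval_tm M e u)"
proof (rule reducible_binary[OF assms, of "{}" "\<lambda>e a b. a = b"])
  fix x x' :: "sort var" assume "fst x = s" "fst x' = s"
  then show "reducible (\<lambda>e. e x = e x')"
    using definable_Eq[of L0 "Var x" s "Var x'" M] has_sort_Var[of x L0] has_sort_Var[of x' L0] assms(1)
    by (intro reducible_definable) (auto simp: graph_tm_def)
qed auto

lemma graph_tm_fun0:
  assumes "is_structure L0 M" "f \<in> funs L0" "farity L0 f = ([], s)" "s \<in> sorts L0"
  shows "graph_tm (App f []) s"
  unfolding graph_tm_def
proof (intro conjI allI impI ballI)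
  fix z :: "sort var" assume "fst z = s"
  then have "definable L0 M (\<lambda>e. eval_tm M e (Var z) = eval_tm M e (App f []))"
    using assms has_sort_Var[of z L0] has_sort_App[OF assms(2,3), of "[]"] by (intro definable_Eq) auto
  then show "reducible (\<lambda>e. e z = eval_tm M e (App f []))" by (simp add: reducible_definable)
qed (use assms in \<open>auto simp: is_structure_def\<close>)

text \<open>Stated for any \<open>w\<close> with the right value and not just for an application of
  \<open>f\<close>: this covers \<open>val\<close> and \<open>\<infinity>\<close>, which are values
  of \<open>val_S\<close> although they are not symbols of the reduct.\<close>

lemma graph_tm_fun1:
  assumes "is_structure L0 M" "f \<in> funs L0" "farity L0 f = ([s1], s)" "s \<in> sorts L0"
    and t: "graph_tm t s1" and w: "\<And>e. e \<in> envs M \<Longrightarrow> eval_tm M e w = fint M f [eval_tm M e t]"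
  shows "graph_tm w s"
  unfolding graph_tm_def
proof (intro conjI allI impI ballI)
  show "eval_tm M e w \<in> univ M s" if "e \<in> envs M" for e
    using assms(1-3) t that unfolding w[OF that] is_structure_def graph_tm_def by fastforce
  fix z :: "sort var" assume z: "fst z = s"
  have "reducible (\<lambda>e. e z = fint M f [eval_tm M e t])"
  proof (rule reducible_unary[OF t, of "{z}" "\<lambda>e a. e z = fint M f [a]"])
    fix x :: "sort var" assume "fst x = s1"
    then have "definable L0 M (\<lambda>e. eval_tm M e (Var z) = eval_tm M e (App f [Var x]))"
      using assms z has_sort_Var[of z L0] has_sort_Var[of x L0] has_sort_App[OF assms(2,3), of "[Var x]"]
      by (intro definable_Eq) (auto simp: graph_tm_def)
    then show "reducible (\<lambda>e. e z = fint M f [e x])" by (simp add: reducible_definable)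
  qed auto
  then show "reducible (\<lambda>e. e z = eval_tm M e w)" by (rule reducible_agree) (simp add: w)
qed (rule assms(4))

lemma graph_tm_fun2:
  assumes "is_structure L0 M" "f \<in> funs L0" "farity L0 f = ([s1, s2], s)" "s \<in> sorts L0"
    and t: "graph_tm t s1" "graph_tm u s2"
  shows "graph_tm (App f [t, u]) s"
  unfolding graph_tm_def
proof (intro conjI allI impI ballI)
  show "eval_tm M e (App f [t, u]) \<in> univ M s" if "e \<in> envs M" for e
    using assms(1-3) t that unfolding is_structure_def graph_tm_def by fastforce
  fix z :: "sort var" assume z: "fst z = s"
  have "reducible (\<lambda>e. e z = fint M f [eval_tm M e t, eval_tm M e u])"
  proof (rule reducible_binary[OF t, of "{z}" "\<lambda>e a b. e z = fint M f [a, b]"])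
    fix x x' :: "sort var" assume "fst x = s1" "fst x' = s2"
    then have "definable L0 M (\<lambda>e. eval_tm M e (Var z) = eval_tm M e (App f [Var x, Var x']))"
      using assms z has_sort_Var[of z L0] has_sort_Var[of x L0] has_sort_Var[of x' L0]
        has_sort_App[OF assms(2,3), of "[Var x, Var x']"]
      by (intro definable_Eq) (auto simp: graph_tm_def)
    then show "reducible (\<lambda>e. e z = fint M f [e x, e x'])" by (simp add: reducible_definable)
  qed auto
  then show "reducible (\<lambda>e. e z = eval_tm M e (App f [t, u]))" by simp
qed (rule assms(4))

text \<open>Equality of vectors is not expressible in the reduct; it is traded for
  \<open>\<pi>(t - u)\<close> being the zero class.\<close>

lemma reducible_vec_Eq:
  assumes "vec_tm t" "vec_tm u"
  shows "reducible (\<lambda>e. eval_tm M e t = eval_tm M e u)"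
proof -
  obtain J f where J: "finite J" "fst ` J \<subseteq> {VecS}" "\<forall>u\<in>J. f u \<in> Cf"
    "\<forall>e\<in>envs M. eval_tm M e t = InV (lin J (\<lambda>u. f u e) e)" using assms(1) unfolding vec_tm_def by blast
  obtain J' f' where J': "finite J'" "fst ` J' \<subseteq> {VecS}" "\<forall>u\<in>J'. f' u \<in> Cf"
    "\<forall>e\<in>envs M. eval_tm M e u = InV (lin J' (\<lambda>u. f' u e) e)" using assms(2) unfolding vec_tm_def by blast
  define h where "h u e = (if u \<in> J then f u else (\<lambda>e. 0)) e - (if u \<in> J' then f' u else (\<lambda>e. 0)) e" for u e
  have lin_h: "lin (J \<union> J') (\<lambda>u. h u e) e = lin J (\<lambda>u. f u e) e - lin J' (\<lambda>u. f' u e) e" for e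
    unfolding h_def lin_diff using J(1) J'(1) lin_mono[of "J \<union> J'" J "\<lambda>u. f u e" e] lin_mono[of "J \<union> J'" J' "\<lambda>u. f' u e" e]
    by (simp add: if_distrib[of "\<lambda>f. f e"])
  have h: "h u \<in> Cf" for u
    unfolding h_def using J(3) J'(3) Cf_zero by (intro Cf_diff) auto
  obtain z :: "sort var" where z: "fst z = SkelS" by (metis fst_conv)
  have zJ: "z \<notin> J \<union> J'" using z J(2) J'(2) by auto
  have "red (J \<union> J') (\<lambda>e. \<exists>a\<in>univ M (fst z). (\<lambda>e. ofS (e z) = skel_pi val (lin (J \<union> J') (\<lambda>u. h u e) e) \<and>
    ofS (e z) = skel_zero val) (e(z := a)))"
    using z sorts_L0(2) h by (intro red.ex red.conj red.pi red.definable definable_zero) auto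
  then have "reducible (\<lambda>e. \<exists>a\<in>univ M (fst z). (\<lambda>e. ofS (e z) = skel_pi val (lin (J \<union> J') (\<lambda>u. h u e) e) \<and>
    ofS (e z) = skel_zero val) (e(z := a)))"
    unfolding reducible_def using J J' by (intro exI[of _ "J \<union> J'"]) auto
  then show ?thesis
  proof (rule reducible_agree)
    fix e assume e: "e \<in> envs M"
    have "h u (e(z := a)) = h u e" for u a using h z by (intro Cf_upd) auto
    then have "(\<exists>a\<in>univ M (fst z). (\<lambda>e. ofS (e z) = skel_pi val (lin (J \<union> J') (\<lambda>u. h u e) e) \<and>
        ofS (e z) = skel_zero val) (e(z := a))) \<longleftrightarrow>
      (\<exists>a\<in>univ M (fst z). ofS a = skel_pi val (lin (J \<union> J') (\<lambda>u. h u e) e) \<and> ofS a = skel_zero val)"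
      by (simp add: lin_upd[OF zJ])
    also have "\<dots> \<longleftrightarrow> skel_pi val (lin (J \<union> J') (\<lambda>u. h u e) e) = skel_zero val"
      using z skel_zero_in by (auto simp: univ_Skel)
    also have "\<dots> \<longleftrightarrow> eval_tm M e t = eval_tm M e u"
      using e J(4) J'(4) by (simp add: skel_pi_eq_zero_iff lin_h)
    finally show "(\<exists>a\<in>univ M (fst z). (\<lambda>e. ofS (e z) = skel_pi val (lin (J \<union> J') (\<lambda>u. h u e) e) \<and>
        ofS (e z) = skel_zero val) (e(z := a))) \<longleftrightarrow> eval_tm M e t = eval_tm M e u" .
  qed
qed

lemma reducible_sat:
  assumes L: "sorts L \<subseteq> insert VecS (sorts L0)" "rarity L = rsym_arity"
    and L0: "ValS \<in> sorts L0" "rels L0 = UNIV" "rarity L0 = rsym_arity"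
    and tm: "\<And>t s. has_sort L t s \<Longrightarrow> if s = VecS then vec_tm t else graph_tm t s"
    and "wff L \<phi>"
  shows "reducible (\<lambda>e. sat M e \<phi>)"
  using assms(7)
proof (induction \<phi>)
  case (Eq t u)
  then obtain s where "has_sort L t s" "has_sort L u s" by auto
  then show ?case
    using tm[of t s] tm[of u s] reducible_vec_Eq[of t u] reducible_Eq[of t s u] by (cases "s = VecS") auto
next
  case (Rel r ts)
  then have "list_all2 (has_sort L) ts [ValS, ValS]"
    using L(2) by (cases r) simp
  then obtain t u where ts: "ts = [t, u]" and tu: "has_sort L t ValS" "has_sort L u ValS"
    by (auto simp: list_all2_Cons2)
  have "graph_tm t ValS" "graph_tm u ValS" using tm tu by fastforce+
  then have "reducible (\<lambda>e. rint M r [eval_tm M e t, eval_tm M e u])"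
  proof (rule reducible_binary[of t ValS u ValS "{}" "\<lambda>e a b. rint M r [a, b]"])
    fix x x' :: "sort var" assume "fst x = ValS" "fst x' = ValS"
    then show "reducible (\<lambda>e. rint M r [e x, e x'])"
      using definable_Rel[of r L0 "[Var x, Var x']" M] has_sort_Var[of x L0] has_sort_Var[of x' L0] L0
      by (intro reducible_definable) (cases r, simp)
  qed auto
  then show ?case by (simp add: ts)
next
  case (Exi x \<phi>)
  then show ?case using reducible_ex[of x] L(1) by auto
qed (auto intro: reducible_not reducible_conj)

theorem NIP_iff_NIP_reduct:
  assumes sub: "sorts L0 \<subseteq> sorts L" "funs L0 \<subseteq> funs L" "farity L0 = farity L"
      "rels L0 = UNIV" "rels L = UNIV" "rarity L0 = rsym_arity" "rarity L = rsym_arity"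
    and L: "sorts L \<subseteq> insert VecS (sorts L0)" "ValS \<in> sorts L0"
    and tm: "\<And>t s. has_sort L t s \<Longrightarrow> if s = VecS then vec_tm t else graph_tm t s"
  shows "NIP L M \<longleftrightarrow> NIP L0 M"
proof
  assume NIP: "NIP L0 M"
  have base: "poly_patterns M X P" if P: "definable L0 M P" for P X
  proof -
    obtain \<psi> where \<psi>: "wff L0 \<psi>" "\<And>e. e \<in> envs M \<Longrightarrow> sat M e \<psi> = P e"
      using P unfolding definable_def by blast
    show ?thesis by (rule poly_patterns_cong[OF \<psi>(2) NIP_imp_poly_patterns[OF NIP \<psi>(1)]])
  qed
  show "NIP L M"
  proof (rule poly_patterns_imp_NIP)
    show "univ M s \<noteq> {}" for s unfolding univ_M by (rule sort_carrier_nonempty)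
    fix \<phi> and X :: "sort var set" assume "wff L \<phi>" "finite X"
    then have "reducible (\<lambda>e. sat M e \<phi>)"
      by (intro reducible_sat[OF L(1) sub(7) L(2) sub(4,6) tm])
    then obtain J where "finite J" "fst ` J \<subseteq> {VecS}" "red J (\<lambda>e. sat M e \<phi>)"
      unfolding reducible_def by blast
    then show "poly_patterns M X (\<lambda>e. sat M e \<phi>)"
      using \<open>finite X\<close> by (intro red_poly_patterns[OF base])
  qed
qed (use NIP_sublang[of L0 L] sub in simp)

end

section \<open>Fixed base field\<close>

text \<open>Constant coefficients need no parameters; this matters because the reduct with fixed
  base field has no field sort to quantify over.\<close>

lemma coef_family_singleton:
  assumes "envs M \<noteq> {}" "\<And>k. (\<lambda>e. k) \<in> Cf"
  shows "coef_family L M Cf {\<kappa>}"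
proof -
  have "coef_params L M Cf {\<kappa>} {\<lambda>u e. \<kappa> u} {}"
    using assms by (auto simp: coef_params_def depends_on_def)
  then show ?thesis
    unfolding coef_family_def by blast
qed

context valued_vector_space
begin

lemma envs_nonempty:
  assumes "univ M = sort_carrier val"
  shows "envs M \<noteq> {}"
proof -
  have "(\<lambda>x. SOME a. a \<in> univ M (fst x)) \<in> envs M"
    by (simp add: envs_def assms some_in_eq sort_carrier_nonempty)
  then show ?thesis by blast
qed

lemma definable_Skel_eq:
  assumes "fst z = SkelS" "has_sort L t SkelS" "SkelS \<in> sorts L" "univ M = sort_carrier val"
    and "\<And>e. eval_tm M e t = InS (F e)"
  shows "definable L M (\<lambda>e. ofS (e z) = F e)"
proof (rule definable_cong[OF definable_Eq[of L "Var z" SkelS t]])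
  show "has_sort L (Var z) SkelS"
    using has_sort_Var[of z L] assms(1,3) by simp
  show "(eval_tm M e (Var z) = eval_tm M e t) = (ofS (e z) = F e)" if "e \<in> envs M" for e
    using envsD[OF that, of z] assms(1,4) by (auto simp: assms(5))
qed (rule assms(2))

lemma struct_SK_simps:
  "univ (struct_SK scale val) = sort_carrier val"
  "fint (struct_SK scale val) = fsym_SK_int scale val"
  "rint (struct_SK scale val) = rsym_int"
  by (simp_all add: struct_SK_def)

lemma L_SK_simps:
  "sorts L_SK = {VecS, ValS, SkelS}" "funs L_SK = UNIV" "rels L_SK = UNIV"
  "farity L_SK = fsym_SK_arity" "rarity L_SK = rsym_arity"
  "sorts L_SK_skel = {ValS, SkelS}"
  "funs L_SK_skel = {SAdd_SK, SZero_SK, SVal_SK} \<union> range SScal_SK" "rels L_SK_skel = UNIV"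
  "farity L_SK_skel = fsym_SK_arity" "rarity L_SK_skel = rsym_arity"
  by (simp_all add: L_SK_def L_SK_skel_def)

lemma valued_reduct_SK:
  "valued_reduct scale val L_SK_skel (struct_SK scale val) (range (\<lambda>k e. k))"
proof (intro valued_reduct.intro valued_reduct_axioms.intro valued_vector_space_axioms)
  let ?L = "L_SK_skel :: (sort, 'a fsym_SK, rsym) lang" and ?M = "struct_SK scale val"
  have var: "has_sort ?L (Var x) SkelS" if "fst x = SkelS" for x
    using has_sort_Var[of x ?L] that by (simp add: L_SK_simps)
  show "\<exists>S. finite S \<and> fst ` S \<subseteq> {FldS} \<and> depends_on f S"
    if "f \<in> range (\<lambda>k e. k)" for f :: "(sort var \<Rightarrow> ('a, 'b, 'c) elem) \<Rightarrow> 'a"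
    using that by (intro exI[of _ "{}"]) (auto simp: depends_on_def)
  show "definable ?L ?M (\<lambda>e. f e = 0)"
    if "f \<in> range (\<lambda>k e. k)" for f
  proof -
    have zero: "has_sort ?L (App SZero_SK []) SkelS"
      by (rule has_sort_App[of _ _ "[]"]) (auto simp: L_SK_simps)
    \<comment> \<open>An equation of a constant with itself stands for truth, and its negation
      covers a nonzero \<open>f\<close>.\<close>
    have "definable ?L ?M (\<lambda>e. eval_tm ?M e (App SZero_SK []) = eval_tm ?M e (App SZero_SK []))"
      using zero zero by (rule definable_Eq)
    then have T: "definable ?L ?M (\<lambda>e. True)" by simp
    obtain k where "f = (\<lambda>e. k)" using \<open>f \<in> _\<close> by blast
    then show ?thesis using T definable_not[OF T] by (cases "k = 0") simp_all
  qed
  show "definable ?L ?M (\<lambda>e. ofS (e z') = skel_scale scale val (f e) (ofS (e z)))"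
    if "f \<in> range (\<lambda>k e. k)" and z: "fst z = SkelS" "fst z' = SkelS" for f z z'
  proof -
    obtain k where k: "f = (\<lambda>e. k)" using \<open>f \<in> _\<close> by blast
    have "has_sort ?L (App (SScal_SK k) [Var z]) SkelS"
      using var[OF z(1)] by (intro has_sort_App[of _ _ "[SkelS]"]) (auto simp: L_SK_simps)
    then show ?thesis
      unfolding k by (rule definable_Skel_eq[OF z(2)]) (simp_all add: L_SK_simps struct_SK_simps)
  qed
  show "definable ?L ?M (\<lambda>e. ofS (e z) = skel_add val (ofS (e x)) (ofS (e y)))"
    if z: "fst z = SkelS" "fst x = SkelS" "fst y = SkelS" for x y z
  proof -
    have "has_sort ?L (App SAdd_SK [Var x, Var y]) SkelS"
      using var[OF z(2)] var[OF z(3)]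
      by (intro has_sort_App[of _ _ "[SkelS, SkelS]"]) (simp_all add: L_SK_simps)
    then show ?thesis by (rule definable_Skel_eq[OF z(1)]) (simp_all add: L_SK_simps struct_SK_simps)
  qed
  show "definable ?L ?M (\<lambda>e. ofS (e z) = skel_zero val)" if z: "fst z = SkelS" for z
  proof -
    have "has_sort ?L (App SZero_SK []) SkelS"
      by (intro has_sort_App[of _ _ "[]"]) (auto simp: L_SK_simps)
    then show ?thesis by (rule definable_Skel_eq[OF z]) (simp_all add: L_SK_simps struct_SK_simps)
  qed
  show "definable ?L ?M (\<lambda>e. skel_val (ofS (e x)) < skel_val (ofS (e y)))"
    if xy: "fst x = SkelS" "fst y = SkelS" for x y
  proof -
    have SVal: "has_sort ?L (App SVal_SK [Var x]) ValS" if "fst x = SkelS" for x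
      using var[OF that] by (intro has_sort_App[of _ _ "[SkelS]"]) (auto simp: L_SK_simps)
    have "definable ?L ?M (\<lambda>e. rint ?M Less (map (eval_tm ?M e) [App SVal_SK [Var x], App SVal_SK [Var y]]))"
      using SVal[OF xy(1)] SVal[OF xy(2)] by (intro definable_Rel) (simp_all add: L_SK_simps)
    then show ?thesis by (simp add: struct_SK_simps)
  qed
  show "\<exists>T. T \<noteq> {} \<and> coef_family ?L ?M (range (\<lambda>k e. k)) T \<and>
      (\<forall>e\<in>envs ?M. h e \<noteq> 0 \<longrightarrow> (\<exists>\<kappa>\<in>T. \<forall>u\<in>J. \<kappa> u = - F u e / h e))"
    if F: "\<And>u. u \<in> J \<Longrightarrow> F u \<in> range (\<lambda>k e. k)" and h: "h \<in> range (\<lambda>k e. k)"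
    for J :: "sort var set" and F h
  proof -
    have "\<forall>u\<in>J. \<exists>k. F u = (\<lambda>e. k)" using F by blast
    then obtain k where k: "\<And>u. u \<in> J \<Longrightarrow> F u = (\<lambda>e. k u)" by metis
    obtain k0 where k0: "h = (\<lambda>e. k0)" using h by blast
    \<comment> \<open>All quotients are constants, so one coefficient vector is enough; for
      \<open>k0 = 0\<close> nothing is asked of it.\<close>
    have "coef_family ?L ?M (range (\<lambda>k e. k)) {\<lambda>u. - k u / k0}"
      by (rule coef_family_singleton[OF envs_nonempty]) (auto simp: struct_SK_simps)
    then show ?thesis
      using k k0 by (intro exI[of _ "{\<lambda>u. - k u / k0}"]) simp
  qed
qed (auto simp: struct_SK_simps L_SK_simps)

lemma NIP_SK_iff: "NIP L_SK (struct_SK scale val) \<longleftrightarrow> NIP L_SK_skel (struct_SK scale val)"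
proof -
  interpret valued_reduct scale val L_SK_skel "struct_SK scale val" "range (\<lambda>k e. k)"
    by (rule valued_reduct_SK)
  have "if s = VecS then vec_tm t else graph_tm t s" if "has_sort L_SK t s" for t s
    using that
  proof (induction rule: has_sort.induct)
    case (Var s n)
    then show ?case
      using vec_tm_Var[of "(s, n)"] graph_tm_Var[of "(s, n)"] by (auto simp: L_SK_simps)
  next
    case (App f ts)
    have fun1: "graph_tm (App g [t]) s" if "g \<in> funs L_SK_skel" "fsym_SK_arity g = ([s1], s)"
      "s = ValS \<or> s = SkelS" "graph_tm t s1" for g t s1 s
      by (rule graph_tm_fun1[OF is_structure_SK_skel, of g s1 s t]) (use that in \<open>simp_all add: L_SK_simps\<close>)
    have pi: "graph_tm (App Pi_SK [t]) SkelS" if "vec_tm t" for t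
      by (rule graph_tm_pi[OF that]) (simp add: struct_SK_simps)
    show ?case
    proof (cases f)
      case VAdd_SK
      with App.IH obtain t u where "ts = [t, u]" "vec_tm t" "vec_tm u"
        by (auto simp: L_SK_simps list_all2_Cons2)
      then show ?thesis
        using vec_tm_add[of t u "App f ts"] VAdd_SK by (simp add: L_SK_simps struct_SK_simps)
    next
      case VZero_SK
      then show ?thesis using vec_tm_zero[of "App f ts"] by (simp add: L_SK_simps struct_SK_simps)
    next
      case (VScal_SK k)
      with App.IH obtain t where "ts = [t]" "vec_tm t"
        by (auto simp: L_SK_simps list_all2_Cons2)
      then show ?thesis
        using vec_tm_scale[of t "\<lambda>e. k" "App f ts"] VScal_SK by (simp add: L_SK_simps struct_SK_simps)
    next
      \<comment> \<open>The sublanguage has no symbol for \<open>\<infinity>\<close>, but it is the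
        value of the zero class.\<close>
      case Inf_SK
      then have "ts = []" using App.IH by (simp add: L_SK_simps)
      have zero: "graph_tm (App SZero_SK []) SkelS"
        by (rule graph_tm_fun0[OF is_structure_SK_skel]) (simp_all add: L_SK_simps)
      have "graph_tm (App f ts) ValS"
        by (rule graph_tm_fun1[OF is_structure_SK_skel, of SVal_SK SkelS _ "App SZero_SK []"])
          (simp_all add: L_SK_simps zero Inf_SK struct_SK_simps skel_val_zero)
      then show ?thesis using Inf_SK by (simp add: L_SK_simps)
    next
      \<comment> \<open>The valuation factors through \<open>\<pi>\<close>.\<close>
      case Val_SK
      with App.IH obtain t where t: "ts = [t]" "vec_tm t"
        by (auto simp: L_SK_simps list_all2_Cons2)
      have "graph_tm (App f ts) ValS"
        by (rule graph_tm_fun1[OF is_structure_SK_skel, of SVal_SK SkelS _ "App Pi_SK [t]"])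
          (simp_all add: L_SK_simps pi t Val_SK struct_SK_simps skel_val_pi)
      then show ?thesis using Val_SK by (simp add: L_SK_simps)
    next
      case SAdd_SK
      with App.IH obtain t u where "ts = [t, u]" "graph_tm t SkelS" "graph_tm u SkelS"
        by (auto simp: L_SK_simps list_all2_Cons2)
      then show ?thesis
        using graph_tm_fun2[OF is_structure_SK_skel, of SAdd_SK SkelS SkelS SkelS t u] SAdd_SK
        by (simp add: L_SK_simps)
    next
      case SZero_SK
      then show ?thesis
        using graph_tm_fun0[OF is_structure_SK_skel, of SZero_SK SkelS] App.IH by (simp add: L_SK_simps)
    next
      case (SScal_SK k)
      with App.IH obtain t where "ts = [t]" "graph_tm t SkelS"
        by (auto simp: L_SK_simps list_all2_Cons2)
      then show ?thesis using fun1[of "SScal_SK k" SkelS SkelS t] SScal_SK by (simp add: L_SK_simps)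
    next
      case SVal_SK
      with App.IH obtain t where "ts = [t]" "graph_tm t SkelS"
        by (auto simp: L_SK_simps list_all2_Cons2)
      then show ?thesis using fun1[of SVal_SK SkelS ValS t] SVal_SK by (simp add: L_SK_simps)
    next
      case Pi_SK
      with App.IH obtain t where "ts = [t]" "vec_tm t"
        by (auto simp: L_SK_simps list_all2_Cons2)
      then show ?thesis using pi Pi_SK by (simp add: L_SK_simps)
    qed
  qed
  then show ?thesis
    by (intro NIP_iff_NIP_reduct) (auto simp: L_SK_simps)
qed

end

section \<open>Variable base field\<close>

text \<open>Integer polynomials in the field variables, as functions. They include the values of
  field terms; differences are needed to subtract linear combinations.\<close>

inductive_set poly_coefs :: "((sort var \<Rightarrow> ('k::field, 'v, 'g) elem) \<Rightarrow> 'k) set" where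
  var: "fst x = FldS \<Longrightarrow> (\<lambda>e. ofK (e x)) \<in> poly_coefs"
| zero: "(\<lambda>e. 0) \<in> poly_coefs"
| one: "(\<lambda>e. 1) \<in> poly_coefs"
| diff: "f \<in> poly_coefs \<Longrightarrow> g \<in> poly_coefs \<Longrightarrow> (\<lambda>e. f e - g e) \<in> poly_coefs"
| mult: "f \<in> poly_coefs \<Longrightarrow> g \<in> poly_coefs \<Longrightarrow> (\<lambda>e. f e * g e) \<in> poly_coefs"

lemma depends_on_binary:
  fixes f :: "('a \<Rightarrow> 'b) \<Rightarrow> 'c" and g :: "('a \<Rightarrow> 'b) \<Rightarrow> 'd"
  assumes "depends_on f S" "depends_on g S'"
  shows "depends_on (\<lambda>e. h (f e) (g e)) (S \<union> S')"
  unfolding depends_on_def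
proof (intro allI impI)
  fix e e' :: "'a \<Rightarrow> 'b" assume "\<forall>x\<in>S \<union> S'. e x = e' x"
  then have "f e = f e'" "g e = g e'"
    using depends_onD[OF assms(1), of e e'] depends_onD[OF assms(2), of e e'] by blast+
  then show "h (f e) (g e) = h (f e') (g e')" by simp
qed

lemma poly_coefs_depends:
  "f \<in> poly_coefs \<Longrightarrow> \<exists>S. finite S \<and> fst ` S \<subseteq> {FldS} \<and> depends_on f S"
proof (induction rule: poly_coefs.induct)
  case (var x)
  then show ?case by (intro exI[of _ "{x}"]) (simp add: depends_on_def)
next
  case (diff f g)
  then obtain S S' where "finite S" "fst ` S \<subseteq> {FldS}" "depends_on f S"
    "finite S'" "fst ` S' \<subseteq> {FldS}" "depends_on g S'" by blast
  then show ?case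
    using depends_on_binary[of f S g S' minus] by (intro exI[of _ "S \<union> S'"]) (simp add: image_Un)
next
  case (mult f g)
  then obtain S S' where "finite S" "fst ` S \<subseteq> {FldS}" "depends_on f S"
    "finite S'" "fst ` S' \<subseteq> {FldS}" "depends_on g S'" by blast
  then show ?case
    using depends_on_binary[of f S g S' times] by (intro exI[of _ "S \<union> S'"]) (simp add: image_Un)
qed (intro exI[of _ "{}"], simp add: depends_on_def)+

lemma coef_family_all:
  fixes M :: "(sort, 'f, 'r, ('k::field, 'v, 'g) elem) struct"
  assumes "finite J" "FldS \<in> sorts L" "univ M FldS = range InK" "envs M \<noteq> {}"
  shows "coef_family L M poly_coefs {\<kappa>. \<forall>u. u \<notin> J \<longrightarrow> \<kappa> u = 0}"
  unfolding coef_family_def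
proof (intro allI impI)
  fix Z :: "sort var set" assume "finite Z"
  obtain m where m: "\<And>x. x \<in> Z \<Longrightarrow> snd x < m"
    using finite_nat_set_iff_bounded[of "snd ` Z"] \<open>finite Z\<close> by auto
  obtain idx :: "sort var \<Rightarrow> nat" where idx: "inj_on idx J"
    using finite_imp_inj_to_nat_seg[OF assms(1)] by blast
  \<comment> \<open>Numbers from \<open>m\<close> on avoid every variable in
    \<open>Z\<close>.\<close>
  define y where "y u = (FldS, m + idx u)" for u
  have y: "inj_on y J" using idx by (auto simp: y_def inj_on_def)
  define g :: "sort var \<Rightarrow> (sort var \<Rightarrow> ('k, 'v, 'g) elem) \<Rightarrow> 'k" where "g = (\<lambda>u. if u \<in> J then (\<lambda>e. ofK (e (y u))) else (\<lambda>e. 0 :: 'k))"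
  have g: "g u \<in> poly_coefs" "depends_on (g u) (y ` J)" for u
    by (auto simp: g_def y_def depends_on_def intro: poly_coefs.intros)
  have ex: "\<exists>e\<in>envs M. \<kappa> = (\<lambda>u. g u e)" if \<kappa>: "\<forall>u. u \<notin> J \<longrightarrow> \<kappa> u = 0" for \<kappa>
  proof -
    obtain e0 where e0: "e0 \<in> envs M" using assms(4) by blast
    define e where "e = comb (y ` J) (\<lambda>x. InK (\<kappa> (the_inv_into J y x))) e0"
    have "e x \<in> univ M (fst x)" for x
      using envsD[OF e0, of x] assms(3) by (auto simp: e_def comb_def y_def)
    then have "e \<in> envs M" unfolding envs_def by blast
    moreover have "g u e = \<kappa> u" for u
      using \<kappa> y by (simp add: g_def e_def the_inv_into_f_f)
    ultimately show ?thesis by (metis ext)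
  qed
  have "{\<kappa>. \<forall>u. u \<notin> J \<longrightarrow> \<kappa> u = 0} = {\<lambda>u. g' u e | g' e. g' \<in> {g} \<and> e \<in> envs M}"
  proof (intro equalityI subsetI)
    fix \<kappa> :: "sort var \<Rightarrow> 'k" assume "\<kappa> \<in> {\<kappa>. \<forall>u. u \<notin> J \<longrightarrow> \<kappa> u = 0}"
    then show "\<kappa> \<in> {\<lambda>u. g' u e | g' e. g' \<in> {g} \<and> e \<in> envs M}" using ex[of \<kappa>] by blast
  qed (auto simp: g_def)
  moreover have "fst ` y ` J \<subseteq> {FldS} \<inter> sorts L" using assms(2) by (auto simp: y_def)
  ultimately have "coef_params L M poly_coefs {\<kappa>. \<forall>u. u \<notin> J \<longrightarrow> \<kappa> u = 0} {g} (y ` J)"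
    unfolding coef_params_def using g assms(1) by simp
  moreover have "y ` J \<inter> Z = {}" using m by (force simp: y_def)
  ultimately show "\<exists>G S. S \<inter> Z = {} \<and> coef_params L M poly_coefs {\<kappa>. \<forall>u. u \<notin> J \<longrightarrow> \<kappa> u = 0} G S"
    by blast
qed

context valued_vector_space
begin

lemma struct_S_simps:
  "univ (struct_S scale val) = sort_carrier val"
  "fint (struct_S scale val) = fsym_S_int scale val"
  "rint (struct_S scale val) = rsym_int"
  by (simp_all add: struct_S_def)

lemma L_S_simps:
  "sorts L_S = UNIV" "funs L_S = UNIV" "rels L_S = UNIV"
  "farity L_S = fsym_S_arity" "rarity L_S = rsym_arity"
  "sorts L_S_skel = {FldS, ValS, SkelS}"
  "funs L_S_skel = {SAdd_S, SZero_S, SScal_S, SVal_S, KAdd_S, KMul_S, KZero_S, KOne_S}"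
  "rels L_S_skel = UNIV" "farity L_S_skel = fsym_S_arity" "rarity L_S_skel = rsym_arity"
  by (simp_all add: L_S_def L_S_skel_def)

lemma env_Fld_S: "e \<in> envs (struct_S scale val) \<Longrightarrow> fst x = FldS \<Longrightarrow> e x = InK (ofK (e x))"
  using envsD[of e "struct_S scale val" x] by (auto simp: struct_S_simps)

lemma has_sort_AppI:
  "f \<in> funs L \<Longrightarrow> list_all2 (has_sort L) ts (fst (farity L f)) \<Longrightarrow> snd (farity L f) = s \<Longrightarrow>
    has_sort L (App f ts) s"
  using has_sort.App by metis

lemma has_sort_S_skel:
  "has_sort L_S_skel t FldS \<Longrightarrow> has_sort L_S_skel u FldS \<Longrightarrow> has_sort L_S_skel (App KAdd_S [t, u]) FldS"
  "has_sort L_S_skel t FldS \<Longrightarrow> has_sort L_S_skel u FldS \<Longrightarrow> has_sort L_S_skel (App KMul_S [t, u]) FldS"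
  "has_sort L_S_skel (App KZero_S []) FldS" "has_sort L_S_skel (App KOne_S []) FldS"
  "has_sort L_S_skel t FldS \<Longrightarrow> has_sort L_S_skel c SkelS \<Longrightarrow> has_sort L_S_skel (App SScal_S [t, c]) SkelS"
  "has_sort L_S_skel c SkelS \<Longrightarrow> has_sort L_S_skel d SkelS \<Longrightarrow> has_sort L_S_skel (App SAdd_S [c, d]) SkelS"
  "has_sort L_S_skel (App SZero_S []) SkelS"
  "has_sort L_S_skel c SkelS \<Longrightarrow> has_sort L_S_skel (App SVal_S [c]) ValS"
proof -
qed (rule has_sort_AppI; simp add: L_S_simps)+

lemma has_sort_S_skel_Var:
  "fst x = FldS \<Longrightarrow> has_sort L_S_skel (Var x) FldS"
  "fst x = SkelS \<Longrightarrow> has_sort L_S_skel (Var x) SkelS"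
  using has_sort_Var[of x L_S_skel] by (simp_all add: L_S_simps)

text \<open>\<open>f\<close> and \<open>g\<close> are functions and not terms, so they replace fresh
  field variables by means of their definable graphs. The graphs are required only for variables off
  a finite set, which leaves room for the fresh ones.\<close>

lemma definable_S_coef_binary:
  assumes f: "f \<in> poly_coefs" "\<exists>Z. finite Z \<and> (\<forall>y. fst y = FldS \<longrightarrow> y \<notin> Z \<longrightarrow>
      definable L_S_skel (struct_S scale val) (\<lambda>e. e y = InK (f e)))"
    and g: "g \<in> poly_coefs" "\<exists>Z. finite Z \<and> (\<forall>y. fst y = FldS \<longrightarrow> y \<notin> Z \<longrightarrow>
      definable L_S_skel (struct_S scale val) (\<lambda>e. e y = InK (g e)))"
    and H: "finite Y" "\<And>y y'. fst y = FldS \<Longrightarrow> fst y' = FldS \<Longrightarrow> 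
      definable L_S_skel (struct_S scale val) (\<lambda>e. H e (ofK (e y)) (ofK (e y')))"
      "\<And>e y a b c. y \<notin> Y \<Longrightarrow> H (e(y := a)) b c = H e b c"
  shows "definable L_S_skel (struct_S scale val) (\<lambda>e. H e (f e) (g e))"
proof -
  let ?M = "struct_S scale val" and ?L = L_S_skel
  obtain Z where Z: "finite Z" "\<forall>y. fst y = FldS \<longrightarrow> y \<notin> Z \<longrightarrow> definable ?L ?M (\<lambda>e. e y = InK (f e))"
    using f(2) by (elim exE conjE)
  obtain Z' where Z': "finite Z'" "\<forall>y. fst y = FldS \<longrightarrow> y \<notin> Z' \<longrightarrow> definable ?L ?M (\<lambda>e. e y = InK (g e))"
    using g(2) by (elim exE conjE)
  obtain S where S: "finite S" "depends_on f S" using poly_coefs_depends[OF f(1)] by blast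
  obtain S' where S': "finite S'" "depends_on g S'" using poly_coefs_depends[OF g(1)] by blast
  let ?Z = "Y \<union> Z \<union> Z' \<union> S \<union> S'"
  have fin: "finite ?Z" using H(1) Z(1) Z'(1) S(1) S'(1) by simp
  obtain y where y: "fst y = FldS" "y \<notin> ?Z" by (rule fresh_var[OF fin])
  obtain y' where y': "fst y' = FldS" "y' \<notin> insert y ?Z" by (rule fresh_var[OF finite.insertI[OF fin]])
  have f_upd: "f (e(x := a)) = f e" if "x \<notin> S" for e x a
    by (rule depends_onD[OF S(2)]) (use that in auto)
  have g_upd: "g (e(x := a)) = g e" if "x \<notin> S'" for e x a
    by (rule depends_onD[OF S'(2)]) (use that in auto)
  define R where "R = (\<lambda>e. H e (ofK (e y)) (ofK (e y')))"
  have R: "definable ?L ?M R" unfolding R_def by (rule H(2)[OF y(1) y'(1)])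
  have "definable ?L ?M (\<lambda>e. R (e(y := InK (f e))))"
    by (rule definable_subst[OF _ _ R]) (use y Z(2) f_upd in \<open>simp_all add: L_S_simps struct_S_simps\<close>)
  from definable_subst[OF _ _ this, of y' "\<lambda>e. InK (g e)"]
  have "definable ?L ?M (\<lambda>e. R (e(y' := InK (g e), y := InK (f (e(y' := InK (g e)))))))"
    using y' Z'(2) g_upd by (simp add: L_S_simps struct_S_simps)
  moreover have "y' \<noteq> y" "y \<notin> Y" "y' \<notin> Y" "y' \<notin> S" using y y' by auto
  ultimately show ?thesis by (simp add: R_def H(3) f_upd)
qed

lemma definable_S_coef:
  "f \<in> poly_coefs \<Longrightarrow> \<exists>Z. finite Z \<and> (\<forall>y. fst y = FldS \<longrightarrow> y \<notin> Z \<longrightarrow>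
    definable L_S_skel (struct_S scale val) (\<lambda>e. e y = InK (f e)))"
proof (induction rule: poly_coefs.induct)
  case (var x)
  have "definable L_S_skel (struct_S scale val) (\<lambda>e. e y = InK (ofK (e x)))" if y: "fst y = FldS" for y
  proof (rule definable_cong[OF definable_Eq[of L_S_skel "Var y" FldS "Var x"]])
    fix e assume "e \<in> envs (struct_S scale val)"
    then show "(eval_tm (struct_S scale val) e (Var y) = eval_tm (struct_S scale val) e (Var x)) \<longleftrightarrow>
      e y = InK (ofK (e x))"
      using env_Fld_S[of e x] var by auto
  qed (use y var has_sort_S_skel_Var in auto)
  then show ?case by blast
next
  case zero
  have "definable L_S_skel (struct_S scale val) (\<lambda>e. e y = InK 0)" if y: "fst y = FldS" for y
    using definable_Eq[OF has_sort_S_skel_Var(1)[OF y] has_sort_S_skel(3), of "struct_S scale val"]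
    by (simp add: struct_S_simps)
  then show ?case by blast
next
  case one
  have "definable L_S_skel (struct_S scale val) (\<lambda>e. e y = InK 1)" if y: "fst y = FldS" for y
    using definable_Eq[OF has_sort_S_skel_Var(1)[OF y] has_sort_S_skel(4), of "struct_S scale val"]
    by (simp add: struct_S_simps)
  then show ?case by blast
next
  case (diff f g)
  have "definable L_S_skel (struct_S scale val) (\<lambda>e. e y = InK (f e - g e))" if y: "fst y = FldS" for y
  proof (rule definable_S_coef_binary[where H = "\<lambda>e a b. e y = InK (a - b)" and Y = "{y}"])
    fix x x' :: "sort var" assume x: "fst x = FldS" "fst x' = FldS"
    show "definable L_S_skel (struct_S scale val) (\<lambda>e. e y = InK (ofK (e x) - ofK (e x')))"
    \<comment> \<open>Subtraction is not a symbol of the field sort; \<open>y = x - x'\<close> is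
      written as \<open>y + x' = x\<close>.\<close>
    proof (rule definable_cong[OF definable_Eq[of L_S_skel "App KAdd_S [Var y, Var x']" FldS "Var x"]])
      fix e assume e: "e \<in> envs (struct_S scale val)"
      obtain a b c where "e x = InK a" "e x' = InK b" "e y = InK c"
        using env_Fld_S[OF e] x y by blast
      then show "(eval_tm (struct_S scale val) e (App KAdd_S [Var y, Var x']) = eval_tm (struct_S scale val) e (Var x)) \<longleftrightarrow>
        e y = InK (ofK (e x) - ofK (e x'))"
        by (auto simp: struct_S_simps eq_diff_eq)
    qed (use x y has_sort_S_skel_Var has_sort_S_skel in auto)
  qed (use diff in auto)
  then show ?case by blast
next
  case (mult f g)
  have "definable L_S_skel (struct_S scale val) (\<lambda>e. e y = InK (f e * g e))" if y: "fst y = FldS" for y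
  proof (rule definable_S_coef_binary[where H = "\<lambda>e a b. e y = InK (a * b)" and Y = "{y}"])
    fix x x' :: "sort var" assume x: "fst x = FldS" "fst x' = FldS"
    show "definable L_S_skel (struct_S scale val) (\<lambda>e. e y = InK (ofK (e x) * ofK (e x')))"
      using definable_Eq[OF has_sort_S_skel_Var(1)[OF y]
          has_sort_S_skel(2)[OF has_sort_S_skel_Var(1)[OF x(1)] has_sort_S_skel_Var(1)[OF x(2)]],
          of "struct_S scale val"]
      by (simp add: struct_S_simps)
  qed (use mult in auto)
  then show ?case by blast
qed

lemma valued_reduct_S:
  "valued_reduct scale val L_S_skel (struct_S scale val) poly_coefs"
proof (intro valued_reduct.intro valued_reduct_axioms.intro valued_vector_space_axioms poly_coefs_depends)
  let ?L = "L_S_skel" and ?M = "struct_S scale val"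
  show "definable ?L ?M (\<lambda>e. f e = 0)" if f: "f \<in> poly_coefs" for f
  proof (rule definable_S_coef_binary[OF f definable_S_coef[OF f] f definable_S_coef[OF f],
        where H = "\<lambda>e a b. a = 0" and Y = "{}"])
    fix y :: "sort var" assume y: "fst y = FldS"
    show "definable ?L ?M (\<lambda>e. ofK (e y) = 0)"
    proof (rule definable_cong[OF definable_Eq[OF has_sort_S_skel_Var(1)[OF y] has_sort_S_skel(3)]])
      fix e assume "e \<in> envs ?M"
      then show "(eval_tm ?M e (Var y) = eval_tm ?M e (App KZero_S [])) = (ofK (e y) = 0)"
        using envsD[of e ?M y] y by (auto simp: struct_S_simps)
    qed
  qed auto
  show "definable ?L ?M (\<lambda>e. ofS (e z') = skel_scale scale val (f e) (ofS (e z)))"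
    if f: "f \<in> poly_coefs" and z: "fst z = SkelS" "fst z' = SkelS" for f z z'
  proof (rule definable_S_coef_binary[OF f definable_S_coef[OF f] f definable_S_coef[OF f],
        where H = "\<lambda>e a b. ofS (e z') = skel_scale scale val a (ofS (e z))" and Y = "{z, z'}"])
    fix y :: "sort var" assume y: "fst y = FldS"
    show "definable ?L ?M (\<lambda>e. ofS (e z') = skel_scale scale val (ofK (e y)) (ofS (e z)))"
      by (rule definable_Skel_eq[OF z(2) has_sort_S_skel(5)[OF has_sort_S_skel_Var(1)[OF y] has_sort_S_skel_Var(2)[OF z(1)]]])
        (simp_all add: L_S_simps struct_S_simps)
  qed auto
  show "definable ?L ?M (\<lambda>e. ofS (e z) = skel_add val (ofS (e x)) (ofS (e y)))"
    if z: "fst z = SkelS" "fst x = SkelS" "fst y = SkelS" for x y z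
    by (rule definable_Skel_eq[OF z(1) has_sort_S_skel(6)[OF has_sort_S_skel_Var(2)[OF z(2)] has_sort_S_skel_Var(2)[OF z(3)]]])
      (simp_all add: L_S_simps struct_S_simps)
  show "definable ?L ?M (\<lambda>e. ofS (e z) = skel_zero val)" if z: "fst z = SkelS" for z
    by (rule definable_Skel_eq[OF z has_sort_S_skel(7)]) (simp_all add: L_S_simps struct_S_simps)
  show "definable ?L ?M (\<lambda>e. skel_val (ofS (e x)) < skel_val (ofS (e y)))"
    if z: "fst x = SkelS" "fst y = SkelS" for x y
  proof -
    have "definable ?L ?M (\<lambda>e. rint ?M Less (map (eval_tm ?M e) [App SVal_S [Var x], App SVal_S [Var y]]))"
      using has_sort_S_skel(8)[OF has_sort_S_skel_Var(2)[OF z(1)]] has_sort_S_skel(8)[OF has_sort_S_skel_Var(2)[OF z(2)]]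
      by (intro definable_Rel) (simp_all add: L_S_simps)
    then show ?thesis by (simp add: struct_S_simps)
  qed
  show "\<exists>T. T \<noteq> {} \<and> coef_family ?L ?M poly_coefs T \<and>
      (\<forall>e\<in>envs ?M. h e \<noteq> 0 \<longrightarrow> (\<exists>\<kappa>\<in>T. \<forall>u\<in>J. \<kappa> u = - F u e / h e))"
    if "finite J" for J :: "sort var set" and F h
  proof (intro exI[of _ "{\<kappa>. \<forall>u. u \<notin> J \<longrightarrow> \<kappa> u = 0}"] conjI ballI impI, goal_cases)
    case 1
    show ?case by (auto intro: exI[of _ "\<lambda>u. 0"])
  next
    case 2
    show ?case
      using that by (intro coef_family_all) (simp_all add: L_S_simps struct_S_simps envs_nonempty)
  next
    case (3 e)
    show ?case by (intro bexI[of _ "\<lambda>u. if u \<in> J then - F u e / h e else 0"]) auto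
  qed
qed (auto simp: struct_S_simps L_S_simps intro: poly_coefs.intros)

lemma NIP_S_iff: "NIP L_S (struct_S scale val) \<longleftrightarrow> NIP L_S_skel (struct_S scale val)"
proof -
  interpret valued_reduct scale val L_S_skel "struct_S scale val" poly_coefs
    by (rule valued_reduct_S)
  \<comment> \<open>For field terms a graph is not enough: as first argument of the scalar
    multiplication they become coefficients of linear combinations, hence the additional claim in
    the induction.\<close>
  have "(if s = VecS then vec_tm t else graph_tm t s) \<and> (s = FldS \<longrightarrow> coef_tm t)" if "has_sort L_S t s" for t s
    using that
  proof (induction rule: has_sort.induct)
    case (Var s n)
    have "coef_tm (Var (FldS, n))"
      unfolding coef_tm_def
    proof (rule bexI[of _ "\<lambda>e. ofK (e (FldS, n))"])
      show "\<forall>e\<in>envs (struct_S scale val). eval_tm (struct_S scale val) e (Var (FldS, n)) = InK (ofK (e (FldS, n)))"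
        using env_Fld_S[of _ "(FldS, n)"] by simp
    qed (simp add: poly_coefs.var)
    then show ?case
      using vec_tm_Var[of "(s, n)"] graph_tm_Var[of "(s, n)"] by (cases s) (auto simp: L_S_simps)
  next
    case (App f ts)
    have pi: "graph_tm (App Pi_S [t]) SkelS" if "vec_tm t" for t
      by (rule graph_tm_pi[OF that]) (simp add: struct_S_simps)
    have coef: "coef_tm t" if "g \<in> poly_coefs" "\<And>e. e \<in> envs (struct_S scale val) \<Longrightarrow> eval_tm (struct_S scale val) e t = InK (g e)" for g t
      using that unfolding coef_tm_def by blast
    show ?case
    proof (cases f)
      case VAdd_S
      with App.IH obtain t u where "ts = [t, u]" "vec_tm t" "vec_tm u"
        by (auto simp: L_S_simps list_all2_Cons2)
      then show ?thesis
        using vec_tm_add[of t u "App f ts"] VAdd_S by (simp add: L_S_simps struct_S_simps)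
    next
      case VZero_S
      then show ?thesis using vec_tm_zero[of "App f ts"] by (simp add: L_S_simps struct_S_simps)
    next
      case VScal_S
      with App.IH obtain k t where t: "ts = [k, t]" "coef_tm k" "vec_tm t"
        by (auto simp: L_S_simps list_all2_Cons2)
      then obtain h where "h \<in> poly_coefs" "\<forall>e\<in>envs (struct_S scale val). eval_tm (struct_S scale val) e k = InK (h e)"
        unfolding coef_tm_def by blast
      then show ?thesis
        using vec_tm_scale[of t h "App f ts"] VScal_S t by (simp add: L_S_simps struct_S_simps)
    next
      case Inf_S
      then have "ts = []" using App.IH by (simp add: L_S_simps)
      have zero: "graph_tm (App SZero_S []) SkelS"
        by (rule graph_tm_fun0[OF is_structure_S_skel]) (simp_all add: L_S_simps)
      have "graph_tm (App f ts) ValS"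
        by (rule graph_tm_fun1[OF is_structure_S_skel, of SVal_S SkelS _ "App SZero_S []"])
          (simp_all add: L_S_simps zero Inf_S struct_S_simps skel_val_zero)
      then show ?thesis using Inf_S by (simp add: L_S_simps)
    next
      case Val_S
      with App.IH obtain t where t: "ts = [t]" "vec_tm t"
        by (auto simp: L_S_simps list_all2_Cons2)
      have "graph_tm (App f ts) ValS"
        by (rule graph_tm_fun1[OF is_structure_S_skel, of SVal_S SkelS _ "App Pi_S [t]"])
          (simp_all add: L_S_simps pi t Val_S struct_S_simps skel_val_pi)
      then show ?thesis using Val_S by (simp add: L_S_simps)
    next
      case SAdd_S
      with App.IH obtain t u where "ts = [t, u]" "graph_tm t SkelS" "graph_tm u SkelS"
        by (auto simp: L_S_simps list_all2_Cons2)
      then show ?thesis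
        using graph_tm_fun2[OF is_structure_S_skel, of SAdd_S SkelS SkelS SkelS t u] SAdd_S
        by (simp add: L_S_simps)
    next
      case SZero_S
      then show ?thesis
        using graph_tm_fun0[OF is_structure_S_skel, of SZero_S SkelS] App.IH by (simp add: L_S_simps)
    next
      case SScal_S
      with App.IH obtain t u where "ts = [t, u]" "graph_tm t FldS" "graph_tm u SkelS"
        by (auto simp: L_S_simps list_all2_Cons2)
      then show ?thesis
        using graph_tm_fun2[OF is_structure_S_skel, of SScal_S FldS SkelS SkelS t u] SScal_S
        by (simp add: L_S_simps)
    next
      case SVal_S
      with App.IH obtain t where t: "ts = [t]" "graph_tm t SkelS"
        by (auto simp: L_S_simps list_all2_Cons2)
      have "graph_tm (App f ts) ValS"
        by (rule graph_tm_fun1[OF is_structure_S_skel, of SVal_S SkelS _ t])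
          (simp_all add: L_S_simps t SVal_S)
      then show ?thesis using SVal_S by (simp add: L_S_simps)
    next
      case Pi_S
      with App.IH obtain t where "ts = [t]" "vec_tm t"
        by (auto simp: L_S_simps list_all2_Cons2)
      then show ?thesis using pi Pi_S by (simp add: L_S_simps)
    next
      case KZero_S
      then show ?thesis
        using graph_tm_fun0[OF is_structure_S_skel, of KZero_S FldS] App.IH coef[OF poly_coefs.zero, of "App f ts"]
        by (simp add: L_S_simps struct_S_simps)
    next
      case KOne_S
      then show ?thesis
        using graph_tm_fun0[OF is_structure_S_skel, of KOne_S FldS] App.IH coef[OF poly_coefs.one, of "App f ts"]
        by (simp add: L_S_simps struct_S_simps)
    next
      case KAdd_S
      with App.IH obtain t u where t: "ts = [t, u]" "graph_tm t FldS" "graph_tm u FldS" "coef_tm t" "coef_tm u"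
        by (auto simp: L_S_simps list_all2_Cons2)
      obtain g where g: "g \<in> poly_coefs" "\<forall>e\<in>envs (struct_S scale val). eval_tm (struct_S scale val) e t = InK (g e)"
        using t(4) unfolding coef_tm_def by blast
      obtain h where h: "h \<in> poly_coefs" "\<forall>e\<in>envs (struct_S scale val). eval_tm (struct_S scale val) e u = InK (h e)"
        using t(5) unfolding coef_tm_def by blast
      have "coef_tm (App f ts)"
        by (rule coef[OF Cf_add[OF g(1) h(1)]]) (simp add: KAdd_S t(1) g(2) h(2) struct_S_simps)
      then show ?thesis
        using graph_tm_fun2[OF is_structure_S_skel, of KAdd_S FldS FldS FldS t u] KAdd_S t
        by (simp add: L_S_simps)
    next
      case KMul_S
      with App.IH obtain t u where t: "ts = [t, u]" "graph_tm t FldS" "graph_tm u FldS" "coef_tm t" "coef_tm u"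
        by (auto simp: L_S_simps list_all2_Cons2)
      obtain g where g: "g \<in> poly_coefs" "\<forall>e\<in>envs (struct_S scale val). eval_tm (struct_S scale val) e t = InK (g e)"
        using t(4) unfolding coef_tm_def by blast
      obtain h where h: "h \<in> poly_coefs" "\<forall>e\<in>envs (struct_S scale val). eval_tm (struct_S scale val) e u = InK (h e)"
        using t(5) unfolding coef_tm_def by blast
      have "coef_tm (App f ts)"
        by (rule coef[OF Cf_mult[OF g(1) h(1)]]) (simp add: KMul_S t(1) g(2) h(2) struct_S_simps)
      then show ?thesis
        using graph_tm_fun2[OF is_structure_S_skel, of KMul_S FldS FldS FldS t u] KMul_S t
        by (simp add: L_S_simps)
    qed
  qed
  moreover have "sorts L_S \<subseteq> insert VecS (sorts L_S_skel)"
  proof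
    fix s :: sort show "s \<in> insert VecS (sorts L_S_skel)" by (cases s) (auto simp: L_S_simps)
  qed
  ultimately show ?thesis
    by (intro NIP_iff_NIP_reduct) (auto simp: L_S_simps)
qed

end

theorem proposition3p6:
  fixes scale :: "'k::field \<Rightarrow> 'v::ab_group_add \<Rightarrow> 'v"
    and val :: "'v \<Rightarrow> 'g::{linorder, order_top}"
  assumes "valued_vector_space scale val"
  shows "(NIP L_SK (struct_SK scale val) \<longleftrightarrow> NIP L_SK_skel (struct_SK scale val)) \<and>
    (NIP L_S (struct_S scale val) \<longleftrightarrow> NIP L_S_skel (struct_S scale val))"
  using valued_vector_space.NIP_SK_iff[OF assms] valued_vector_space.NIP_S_iff[OF assms] by blast

end
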